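(* Consider the problem $\min\{f(x): x\in\Omega\}$ and the stochastic interior-point method with recursive momentum (SIPM-RM) described in the context, with input $s_\eta\in(0,1)$. Assume: (a) $\Omega^\circ\neq\emptyset$, and there is a finite $\phi_{\mathrm{low}}$ with $\inf_{x\in\Omega^\circ,\,\mu\in(0,1]}\{f(x)+\mu B(x)\}\ge\phi_{\mathrm{low}}$; (b) for every $s\in(0,1)$ there is a constant $L_1(s)>0$ such that $\|\nabla f(y)-\nabla f(x)\|_x^*\le L_1(s)\|y-x\|_x$ for all $x,y\in\Omega^\circ$ with $\|y-x\|_x\le s$; write $L_1=L_1(s_\eta)$; (c) the estimator $G:\Omega^\circ\times\Xi\to\mathbb{R}^n$ satisfies, for some $\sigma>0$, $\mathbb{E}_\xi[G(x;\xi)]=\nabla f(x)$ and $\mathbb{E}_\xi[(\|G(x;\xi)-\nabla f(x)\|_x^* )^2]\le\sigma^2$ for all $x\in\Omega^\circ$; (d) for every $s\in(0,1)$ there is a constant $L(s)>0$ such that $\mathbb{E}_\xi[(\|G(y;\xi)-G(x;\xi)\|_x^* )^2]\le L(s)^2\|y-x\|_x^2$ for all $x,y\in\Omega^\circ$ with $\|y-x\|_x\le s$; write $L=L(s_\eta)$. Let $\epsilon\in(0,1)$ and let the input parameters be, for all $k\ge0$, $$\eta_k=\frac{s_\eta}{3(k+1)^{2/3}},\qquad \gamma_k=\frac{1}{(k+1)^{2/3}},\qquad \mu_k=\max\Big\{\frac{1}{(k+1)^{1/3}},\frac{\epsilon}{1+\sqrt{\vartheta}}\Big\}.$$ Let $\kappa(K)$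 be uniformly drawn from $\{\lfloor K/2\rfloor,\ldots,K-1\}$, and define $$M_{\mathrm{rm}}=6\bigg(\frac{\Delta(x^0)+\sigma^2}{s_\eta}+\frac{2s_\eta L_\phi}{9}+4\Big(\frac{4s_\eta}{3(3-s_\eta)}+\frac{3(L_1^2+L^2)s_\eta}{(3-s_\eta)^2}+\frac{3\sigma^2}{s_\eta(1-s_\eta/3)^2}\Big)\bigg).$$ Then $$\mathbb{E}\big[\|\nabla\phi_{\mu_{\kappa(K)}}(x^{\kappa(K)})+A^T\lambda^{\kappa(K)}\|^*_{x^{\kappa(K)}}\big]\le\mu_{\kappa(K)}\quad\text{with}\quad \mu_{\kappa(K)}\le\frac{\epsilon}{1+\sqrt{\vartheta}}$$ for all integers $$K\ge\max\Big\{2\Big(\frac{1+\sqrt{\vartheta}}{\epsilon}\Big)^{3},\ \Big(\frac{6M_{\mathrm{rm}}(1+\sqrt{\vartheta})}{\epsilon}\ln\Big(\frac{6M_{\mathrm{rm}}(1+\sqrt{\vartheta})}{\epsilon}\Big)\Big)^{3},\ 3\Big\}.$$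
   Context: Setting. $\mathcal{K}\subseteq\mathbb{R}^n$ is a closed pointed convex cone with nonempty interior, $A\in\mathbb{R}^{m\times n}$ has full row rank, $b\in\mathbb{R}^m$, $\Omega=\{x: Ax=b,\ x\in\mathcal{K}\}$, $\Omega^\circ=\{x\in\mathrm{int}\,\mathcal{K}: Ax=b\}$; $f$ is continuously differentiable (possibly nonconvex) on $\Omega$, and $\min_{x\in\Omega}f(x)$ has at least one optimal solution. Barrier. $\mathcal{K}$ is equipped with a $\vartheta$-logarithmically homogeneous self-concordant barrier $B:\mathrm{int}\,\mathcal{K}\to\mathbb{R}$, $\vartheta\ge1$: $B$ is convex and three times continuously differentiable; for $\varphi(t)=B(x+tu)$ one has $|\varphi'''(0)|\le2(\varphi''(0))^{3/2}$ for all $x\in\mathrm{int}\,\mathcal{K}$, $u\in\mathbb{R}^n$; $B(x)\to\infty$ as $x$ approaches the boundary of $\mathcal{K}$; and $B(tx)=B(x)-\vartheta\ln t$ for all $x\in\mathrm{int}\,\mathcal{K}$, $t>0$. For $x\in\mathrm{int}\,\mathcal{K}$ and $v\in\mathbb{R}^n$: $\|v\|_x=(v^T\nabla^2B(x)v)^{1/2}$ and $\|v\|_x^*=(v^T\nabla^2B(x)^{-1}v)^{1/2}$. Notation. $\phi_\mu(x)=f(x)+\mu(f(x)+B(x))$ for $x\in\Omega^\circ$, $\mu\in(0,1]$. With $[t]_+=\max\{t,0\}$ and $[t]_-=\min\{t,0\}$, $\Delta(x)=f(x)+[f(x)+B(x)]_+-2[\phi_{\mathrm{low}}]_-$, and $L_\phi=2L_1+1/(1-s_\eta)$.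 Algorithm (SIPM framework). Input: $s_\eta\in(0,1)$, $x^0\in\Omega^\circ$ (deterministic), nonincreasing step sizes $\{\eta_k\}_{k\ge0}\subset(0,s_\eta]$, nonincreasing barrier parameters $\{\mu_k\}_{k\ge0}\subset(0,1]$. For $k=0,1,2,\ldots$: construct an estimator $\overline m^k$ of $\nabla f(x^k)$, set $m^k=\overline m^k+\mu_k(\overline m^k+\nabla B(x^k))$, $H_k=\nabla^2B(x^k)^{-1}$, $$\lambda^k=-(AH_kA^T)^{-1}AH_km^k,\qquad x^{k+1}=x^k-\eta_k\frac{H_k(m^k+A^T\lambda^k)}{\|m^k+A^T\lambda^k\|^*_{x^k}}.$$ The update is understood to be well defined, i.e. $m^k+A^T\lambda^k\ne0$ for all $k$. SIPM-RM is this framework with momentum parameters $\{\gamma_k\}_{k\ge0}\subset(0,1]$ and $\gamma_{-1}=1$, $x^{-1}=x^0$, $\overline m^{-1}=0$, $\overline m^k=G(x^k;\xi^k)+(1-\gamma_{k-1})(\overline m^{k-1}-G(x^{k-1};\xi^k))$ for $k\ge0$, where $\xi^0,\xi^1,\ldots$ are independent copies of the random variable $\xi$ (with sample space $\Xi$). The draw of $\kappa(K)$ is independent of the samples; $\mathbb{E}$ is expectation over all randomness. *)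

theory Defs
  imports "HOL-Analysis.Analysis" "HOL-Probability.Probability"
begin

definition gradient :: "(real^'n \<Rightarrow> real) \<Rightarrow> real^'n \<Rightarrow> real^'n"
  where "gradient f x = (THE g. GDERIV f x :> g)"

lemma gradient_eqI:
  assumes "GDERIV f x :> g"
  shows "gradient f x = g"
  unfolding gradient_def
proof (rule the_equality)
  fix g' assume "GDERIV f x :> g'"
  with assms have "(\<lambda>h. h \<bullet> g') = (\<lambda>h. h \<bullet> g)"
    unfolding gderiv_def by (rule has_derivative_unique[rotated])
  then show "g' = g"
    by (metis inner_commute vector_eq_rdot)
qed (fact assms)

definition hessian :: "(real^'n \<Rightarrow> real) \<Rightarrow> real^'n \<Rightarrow> real^'n^'n"
  where "hessian f x = jacobian (gradient f) (at x)"

text \<open>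
  Continuous differentiability on a set \<open>S\<close> which may have empty interior and may touch the
  boundary of the convex body \<open>C\<close> containing it. Derivatives are taken within \<open>C\<close>, which determines
  them uniquely because \<open>C\<close> has interior points; at points of \<open>interior C\<close> this is the ordinary
  gradient, at boundary points it is one-sided. A function that is \<open>C\<^sup>1\<close> on an open
  neighbourhood of \<open>S\<close> satisfies this.
\<close>
definition C1_on_within :: "(real^'n) set \<Rightarrow> (real^'n) set \<Rightarrow> (real^'n \<Rightarrow> real) \<Rightarrow> bool"
  where "C1_on_within S C f \<longleftrightarrow>
    (\<exists>g. (\<forall>x\<in>S. (f has_derivative (\<lambda>h. h \<bullet> g x)) (at x within C)) \<and> continuous_on S g)"

text \<open>
  For open \<open>S\<close>. In finite dimension, pointwise continuity of the third derivative in each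
  direction \<open>u\<close> is the same as continuity in operator norm.
\<close>
definition C3_on :: "(real^'n) set \<Rightarrow> (real^'n \<Rightarrow> real) \<Rightarrow> bool"
  where "C3_on S f \<longleftrightarrow>
    (\<forall>x\<in>S. f differentiable (at x)) \<and>
    (\<forall>x\<in>S. gradient f differentiable (at x)) \<and>
    (\<forall>x\<in>S. hessian f differentiable (at x)) \<and>
    (\<forall>u. continuous_on S (\<lambda>x. frechet_derivative (hessian f) (at x) u))"

definition proper_cone :: "(real^'n) set \<Rightarrow> bool"
  where "proper_cone \<K> \<longleftrightarrow>
    closed \<K> \<and> convex \<K> \<and> cone \<K> \<and> \<K> \<inter> uminus ` \<K> = {0} \<and> interior \<K> \<noteq> {}"

definition log_homogeneous_sc_barrier ::
    "(real^'n) set \<Rightarrow> real \<Rightarrow> (real^'n \<Rightarrow> real) \<Rightarrow> bool"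
  where "log_homogeneous_sc_barrier \<K> \<theta> B \<longleftrightarrow>
    1 \<le> \<theta> \<and>
    convex_on (interior \<K>) B \<and>
    C3_on (interior \<K>) B \<and>
    (\<forall>x\<in>interior \<K>. \<forall>u. let \<phi> = (\<lambda>t::real. B (x + t *\<^sub>R u)) in
       \<bar>(deriv ^^ 3) \<phi> 0\<bar> \<le> 2 * ((deriv ^^ 2) \<phi> 0) powr (3/2)) \<and>
    (\<forall>z\<in>frontier \<K>. filterlim B at_top (at z within interior \<K>)) \<and>
    (\<forall>x\<in>interior \<K>. \<forall>t>0. B (t *\<^sub>R x) = B x - \<theta> * ln t)"

definition local_norm :: "(real^'n \<Rightarrow> real) \<Rightarrow> real^'n \<Rightarrow> real^'n \<Rightarrow> real"
  where "local_norm B x v = sqrt (v \<bullet> (hessian B x *v v))"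

definition dual_local_norm :: "(real^'n \<Rightarrow> real) \<Rightarrow> real^'n \<Rightarrow> real^'n \<Rightarrow> real"
  where "dual_local_norm B x v = sqrt (v \<bullet> (matrix_inv (hessian B x) *v v))"

definition feasible_set :: "real^'n^'m \<Rightarrow> real^'m \<Rightarrow> (real^'n) set \<Rightarrow> (real^'n) set"
  where "feasible_set A b \<K> = {x \<in> \<K>. A *v x = b}"

definition strictly_feasible_set :: "real^'n^'m \<Rightarrow> real^'m \<Rightarrow> (real^'n) set \<Rightarrow> (real^'n) set"
  where "strictly_feasible_set A b \<K> = {x \<in> interior \<K>. A *v x = b}"

definition barrier_fun :: "(real^'n \<Rightarrow> real) \<Rightarrow> (real^'n \<Rightarrow> real) \<Rightarrow> real \<Rightarrow> real^'n \<Rightarrow> real"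
  where "barrier_fun f B \<mu> x = f x + \<mu> * (f x + B x)"

definition potential_gap ::
    "(real^'n \<Rightarrow> real) \<Rightarrow> (real^'n \<Rightarrow> real) \<Rightarrow> real \<Rightarrow> real^'n \<Rightarrow> real"
  where "potential_gap f B \<phi>\<^sub>l\<^sub>o\<^sub>w x = f x + max (f x + B x) 0 - 2 * min \<phi>\<^sub>l\<^sub>o\<^sub>w 0"

text \<open>
  The run of the method along one sample sequence \<open>\<xi>\<close>: iterates \<open>x\<close>, momentum estimators \<open>mb\<close>,
  search vectors \<open>m\<close> and multipliers \<open>lam\<close>. The \<open>case\<close> expressions supply the values at index
  \<open>-1\<close>: \<open>\<gamma> = 1\<close>, \<open>mb = 0\<close>, \<open>x = x0\<close>.
\<close>
definition sipm_rm_run ::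
    "real^'n^'m \<Rightarrow> (real^'n \<Rightarrow> real) \<Rightarrow> (real^'n \<Rightarrow> 's \<Rightarrow> real^'n) \<Rightarrow> real^'n
     \<Rightarrow> (nat \<Rightarrow> real) \<Rightarrow> (nat \<Rightarrow> real) \<Rightarrow> (nat \<Rightarrow> real) \<Rightarrow> (nat \<Rightarrow> 's)
     \<Rightarrow> (nat \<Rightarrow> real^'n) \<Rightarrow> (nat \<Rightarrow> real^'n) \<Rightarrow> (nat \<Rightarrow> real^'n) \<Rightarrow> (nat \<Rightarrow> real^'m) \<Rightarrow> bool"
  where "sipm_rm_run A B G x0 \<eta> \<gamma> \<mu> \<xi> x mb m lam \<longleftrightarrow>
    x 0 = x0 \<and>
    (\<forall>k. let \<gamma>' = (case k of 0 \<Rightarrow> 1 | Suc j \<Rightarrow> \<gamma> j);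
             mb' = (case k of 0 \<Rightarrow> 0 | Suc j \<Rightarrow> mb j);
             x' = (case k of 0 \<Rightarrow> x0 | Suc j \<Rightarrow> x j);
             H = matrix_inv (hessian B (x k));
             d = m k + transpose A *v lam k
         in mb k = G (x k) (\<xi> k) + (1 - \<gamma>') *\<^sub>R (mb' - G x' (\<xi> k)) \<and>
            m k = mb k + \<mu> k *\<^sub>R (mb k + gradient B (x k)) \<and>
            lam k = - (matrix_inv (A ** H ** transpose A) *v (A *v (H *v m k))) \<and>
            x (Suc k) = x k - (\<eta> k / dual_local_norm B (x k) d) *\<^sub>R (H *v d))"

end

theory Submission
  imports Defs
begin

text \<open>
  Self-concordance controls the local norms: on the unit Dikin ellipsoid at \<open>x\<close> one has
  \<open>\<nabla>\<^sup>2B(x + u) \<ge> (1 - \<parallel>u\<parallel>\<^sub>x)\<^sup>2 \<nabla>\<^sup>2B(x)\<close>, so errors measured in the dual norm at \<open>x\<^sup>k\<close> can be carried over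
  to \<open>x\<^sup>k\<^sup>+\<^sup>1\<close> at the cost of a factor \<open>1 / (1 - \<eta>\<^sub>k)\<close>. With \<open>e\<^sub>k\<close> the dual norm of the error of the momentum
  estimator and \<open>R\<^sub>k\<close> the stationarity residual, each step decreases the barrier function by
  \<open>\<eta>\<^sub>k R\<^sub>k - 4 \<eta>\<^sub>k e\<^sub>k - L\<^sub>\<phi> \<eta>\<^sub>k\<^sup>2 / 2\<close>, while
  \<open>E e\<^sub>k\<^sub>+\<^sub>1\<^sup>2 \<le> (1 - \<gamma>\<^sub>k (1 - s / 3)) E e\<^sub>k\<^sup>2 + C \<gamma>\<^sub>k\<^sup>2\<close>. Hence the potential
  \<open>E \<phi>(x\<^sup>k) + (k + 1)\<^sup>1\<^sup>/\<^sup>3 E e\<^sub>k\<^sup>2\<close> absorbs the error terms, and \<open>\<Sum> \<eta>\<^sub>k E R\<^sub>k\<close> over \<open>k < K\<close> is of order \<open>ln K\<close>.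
  Since \<open>\<eta>\<^sub>k\<close> is of order \<open>K\<^sup>-\<^sup>2\<^sup>/\<^sup>3\<close> or larger, the average of \<open>E R\<^sub>k\<close> over the second half of the run
  is of order \<open>ln K / K\<^sup>1\<^sup>/\<^sup>3\<close>.
\<close>

section \<open>Second and third derivatives\<close>

text \<open>Self-concordance is assumed only on the diagonal, for \<open>D^3 B[u, u, u]\<close>,
  whereas comparing Hessians at two points needs \<open>D^3 B[u, v, v]\<close> with the same
  constant 2. A polarization inequality for cubic forms on Euclidean planes closes this gap. A
  second obstacle is circular: the estimates for the barrier along a segment presuppose that the
  segment is interior, which is itself the claim; blow-up at the frontier breaks the circle.
  Pointedness of the cone makes the Hessian definite, so that the local norms are genuine norms.

  The given lower bound concerns \<open>f + t B\<close>, but the method decreases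
  \<open>f + \<mu> (f + B) = (1 + \<mu>) (f + \<mu> / (1 + \<mu>) B)\<close>; a shift by
  \<open>(1 + \<mu>) min \<phi>\<^sub>l\<^sub>o\<^sub>w 0\<close> makes it nonnegative and monotone
  in \<open>\<mu>\<close>. No moments of \<open>f\<close> or \<open>B\<close> along the run are
  assumed: integrability has to come out of the inequalities themselves, so one-step estimates are
  first proved pointwise or for nonnegative integrals.\<close>

lemma second_difference_tendsto:
  fixes f :: "'a::real_inner \<Rightarrow> real"
  assumes f: "eventually (\<lambda>y. GDERIV f y :> g y) (nhds x)"
    and g: "(g has_derivative D) (at x)"
  shows "((\<lambda>t. (f (x + t *\<^sub>R u + t *\<^sub>R v) - f (x + t *\<^sub>R u) - f (x + t *\<^sub>R v) + f x) / t\<^sup>2)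
    \<longlongrightarrow> D v \<bullet> u) (at_right 0)"
proof (rule tendstoI)
  fix e :: real assume "e > 0"
  define c where "c = norm u + norm v"
  have c: "c \<ge> 0" by (simp add: c_def)
  \<comment> \<open>The choice of \<open>e'\<close> leaves \<open>2 * e' * c * norm u\<close> at
    most \<open>e / 2\<close>; the summands 1 keep \<open>X\<close> positive when \<open>u\<close>
    and \<open>v\<close> vanish.\<close>
  define X where "X = (c + 1) * (norm u + 1)"
  define e' where "e' = e / (4 * X)"
  have X: "X > 0" unfolding X_def using c by (intro mult_pos_pos) (auto simp: add_nonneg_pos)
  have e': "e' > 0" using \<open>e > 0\<close> X by (simp add: e'_def)
  have eN: "2 * e' * c * norm u < e"
  proof -
    have "2 * e' * c * norm u \<le> 2 * e' * (c + 1) * (norm u + 1)"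
      using e' c by (intro mult_mono) auto
    also have "\<dots> = e / 2"
      using X by (simp add: e'_def X_def[symmetric] mult.assoc)
    also have "\<dots> < e" using \<open>e > 0\<close> by simp
    finally show ?thesis .
  qed
  have linD: "linear D" using g by (rule has_derivative_linear)
  obtain d1 where d1: "d1 > 0" "\<And>y. norm (y - x) < d1 \<Longrightarrow> GDERIV f y :> g y"
    using f unfolding eventually_nhds_metric by (auto simp: dist_norm)
  obtain d2 where d2: "d2 > 0"
    "\<And>y. norm (y - x) < d2 \<Longrightarrow> norm (g y - g x - D (y - x)) \<le> e' * norm (y - x)"
    using g e' unfolding has_derivative_at_alt by blast
  define t0 where "t0 = min d1 d2 / (c + 1)"
  have t0: "t0 > 0" using d1 d2 c by (auto simp: t0_def)
  have main: "dist ((f (x + t *\<^sub>R u + t *\<^sub>R v) - f (x + t *\<^sub>R u) - f (x + t *\<^sub>R v) + f x) / t\<^sup>2) (D v \<bullet> u) < e"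
    if t: "0 < t" "t < t0" for t
  proof -
    have tc: "t * c < min d1 d2"
    proof -
      have "t * c \<le> t * (c + 1)" using t by simp
      also have "\<dots> < min d1 d2" using t c by (simp add: t0_def field_simps)
      finally show ?thesis .
    qed
    have near: "norm (s *\<^sub>R u + r *\<^sub>R v) \<le> t * c" if "0 \<le> s" "s \<le> t" "0 \<le> r" "r \<le> t" for s r
    proof -
      have "norm (s *\<^sub>R u + r *\<^sub>R v) \<le> s * norm u + r * norm v"
        using that by (metis abs_of_nonneg norm_scaleR norm_triangle_ineq)
      also have "\<dots> \<le> t * norm u + t * norm v" using that by (intro add_mono mult_right_mono) auto
      finally show ?thesis by (simp add: c_def algebra_simps)
    qed
    \<comment> \<open>Differencing in direction \<open>v\<close> first and then applying the mean
      value theorem in direction \<open>u\<close> leaves one difference of gradients near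
      \<open>x\<close>. Differentiability of \<open>g\<close> at the single point \<open>x\<close>
      then suffices; no continuity of the second derivative enters.\<close>
    define F where "F s = f (x + s *\<^sub>R u + t *\<^sub>R v) - f (x + s *\<^sub>R u)" for s
    define F' where "F' s = u \<bullet> g (x + s *\<^sub>R u + t *\<^sub>R v) - u \<bullet> g (x + s *\<^sub>R u)" for s
    have F': "(F has_real_derivative F' s) (at s)" if s: "0 \<le> s" "s \<le> t" for s
    proof -
      have 1: "(f has_derivative (\<lambda>h. h \<bullet> g (x + s *\<^sub>R u + t *\<^sub>R v))) (at (x + s *\<^sub>R u + t *\<^sub>R v))"
        using d1(2)[of "x + s *\<^sub>R u + t *\<^sub>R v"] near[of s t] s t tc
        by (auto simp: gderiv_def algebra_simps)
      have 2: "(f has_derivative (\<lambda>h. h \<bullet> g (x + s *\<^sub>R u))) (at (x + s *\<^sub>R u))"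
        using d1(2)[of "x + s *\<^sub>R u"] near[of s 0] s t tc by (auto simp: gderiv_def)
      have 3: "((\<lambda>s. f (x + s *\<^sub>R u + t *\<^sub>R v)) has_derivative (\<lambda>h. (h *\<^sub>R u) \<bullet> g (x + s *\<^sub>R u + t *\<^sub>R v))) (at s)"
        by (rule has_derivative_compose[where g = f and f = "\<lambda>s. x + s *\<^sub>R u + t *\<^sub>R v", OF _ 1])
        (auto intro!: derivative_eq_intros)
      have 4: "((\<lambda>s. f (x + s *\<^sub>R u)) has_derivative (\<lambda>h. (h *\<^sub>R u) \<bullet> g (x + s *\<^sub>R u))) (at s)"
        by (rule has_derivative_compose[where g = f and f = "\<lambda>s. x + s *\<^sub>R u", OF _ 2])
        (auto intro!: derivative_eq_intros)
      show ?thesis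
        unfolding F_def F'_def has_field_derivative_def
        by (rule has_derivative_eq_rhs[OF has_derivative_diff[OF 3 4]]) (auto simp: algebra_simps)
    qed
    obtain s where s: "0 < s" "s < t" "F t - F 0 = t * F' s"
      using MVT2[of 0 t F F'] F' t by auto
    define p where "p = g (x + s *\<^sub>R u + t *\<^sub>R v) - g x - D (s *\<^sub>R u + t *\<^sub>R v)"
    define q where "q = g (x + s *\<^sub>R u) - g x - D (s *\<^sub>R u)"
    have p: "norm p \<le> e' * (t * c)"
    proof -
      have "norm p \<le> e' * norm (s *\<^sub>R u + t *\<^sub>R v)"
        using d2(2)[of "x + s *\<^sub>R u + t *\<^sub>R v"] near[of s t] s t tc
        by (auto simp: p_def algebra_simps)
      also have "\<dots> \<le> e' * (t * c)" using near[of s t] s t e' by (intro mult_left_mono) auto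
      finally show ?thesis .
    qed
    have q: "norm q \<le> e' * (t * c)"
    proof -
      have "norm q \<le> e' * norm (s *\<^sub>R u)"
        using d2(2)[of "x + s *\<^sub>R u"] near[of s 0] s t tc
        by (auto simp: q_def algebra_simps)
      also have "\<dots> \<le> e' * (t * c)" using near[of s 0] s t e' by (intro mult_left_mono) auto
      finally show ?thesis .
    qed
    have "F' s = u \<bullet> (p - q) + t * (D v \<bullet> u)"
      unfolding F'_def p_def q_def
      by (simp add: linear_add[OF linD] linear_scale[OF linD] inner_diff_right inner_add_right inner_commute)
    then have eq: "(F t - F 0) / t\<^sup>2 - D v \<bullet> u = (u \<bullet> (p - q)) / t"
      using s t by (simp add: power2_eq_square field_simps)
    have "\<bar>u \<bullet> (p - q)\<bar> \<le> norm u * norm (p - q)" by (rule Cauchy_Schwarz_ineq2)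
    also have "\<dots> \<le> norm u * (e' * (t * c) + e' * (t * c))"
      using norm_triangle_ineq4[of p q] p q by (intro mult_left_mono) (linarith, simp)
    finally have "\<bar>u \<bullet> (p - q)\<bar> / t \<le> 2 * e' * c * norm u"
      using t by (simp add: field_simps)
    then have "\<bar>(F t - F 0) / t\<^sup>2 - D v \<bullet> u\<bar> < e"
      unfolding eq using eN t by simp
    then show ?thesis by (simp add: F_def dist_real_def algebra_simps)
  qed
  show "eventually (\<lambda>t. dist ((f (x + t *\<^sub>R u + t *\<^sub>R v) - f (x + t *\<^sub>R u) - f (x + t *\<^sub>R v) + f x) / t\<^sup>2) (D v \<bullet> u) < e) (at_right 0)"
    unfolding eventually_at_right_field using main t0 by (intro exI[of _ t0]) auto
qed

text \<open>The second difference quotient is symmetric in \<open>u\<close> and \<open>v\<close>, so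
  its two limits agree.\<close>

lemma second_derivative_symmetric:
  fixes f :: "'a::real_inner \<Rightarrow> real"
  assumes "eventually (\<lambda>y. GDERIV f y :> g y) (nhds x)" "(g has_derivative D) (at x)"
  shows "D v \<bullet> u = D u \<bullet> v"
proof (rule tendsto_unique[OF trivial_limit_at_right_real second_difference_tendsto[OF assms, of u v]])
  show "((\<lambda>t. (f (x + t *\<^sub>R u + t *\<^sub>R v) - f (x + t *\<^sub>R u) - f (x + t *\<^sub>R v) + f x) / t\<^sup>2)
    \<longlongrightarrow> D u \<bullet> v) (at_right 0)"
    using second_difference_tendsto[OF assms, of v u] by (simp add: algebra_simps)
qed

text \<open>
  With \<open>x = (c, s)\<close> and \<open>u = (c\<^sup>3 - 3 c s\<^sup>2, 3 c\<^sup>2 s - s\<^sup>3)\<close> (the angle tripled), the polarized value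
  is a combination of the values of the cubic at the three rotations of \<open>x\<close> by multiples of
  \<open>\<pi> / 3\<close>, and the absolute values of the coefficients sum to 1.
\<close>
lemma binary_cubic_polarization_unit:
  fixes a b e d c s :: real
  assumes bound: "\<And>c s. c\<^sup>2 + s\<^sup>2 = 1 \<Longrightarrow> \<bar>a * c^3 + 3 * b * c^2 * s + 3 * e * c * s^2 + d * s^3\<bar> \<le> M"
    and cs: "c\<^sup>2 + s\<^sup>2 = 1"
  shows "\<bar>a * (c^3 - 3 * c * s\<^sup>2) + b * (3 * c\<^sup>2 * s - s^3)\<bar> \<le> M"
proof -
  define p where "p c s = a * c^3 + 3 * b * c^2 * s + 3 * e * c * s^2 + d * s^3" for c s
  define h q :: real where "h = 1 / 2" and "q = sqrt 3 / 2"
  have hq: "2 * h = 1" "4 * q\<^sup>2 = 3" by (simp_all add: h_def q_def power_divide)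
  define c1 s1 c2 s2 where "c1 = h * c - q * s" and "s1 = q * c + h * s"
    and "c2 = - h * c - q * s" and "s2 = q * c - h * s"
  \<comment> \<open>At angle \<open>t\<close> this weight equals \<open>(1 + 2 cos 2t)^2\<close>,
    the square of a Dirichlet kernel; its values at three angles spaced by pi/3 sum to 9, so after
    division by 9 they are convex weights.\<close>
  define w where "w c s = (3 * c\<^sup>2 - s\<^sup>2)\<^sup>2" for c s :: real
  have cs1: "c1\<^sup>2 + s1\<^sup>2 = 1"
    using cs hq unfolding c1_def s1_def by algebra
  have cs2: "c2\<^sup>2 + s2\<^sup>2 = 1"
    using cs hq unfolding c2_def s2_def by algebra
  have w0: "w c s \<ge> 0" "w c1 s1 \<ge> 0" "w c2 s2 \<ge> 0" by (auto simp: w_def)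
  have w: "w c s + w c1 s1 + w c2 s2 = 9"
    using cs hq unfolding w_def c1_def s1_def c2_def s2_def by algebra
  have "9 * (a * (c^3 - 3 * c * s\<^sup>2) + b * (3 * c\<^sup>2 * s - s^3))
      = w c s * p c s - w c1 s1 * p c1 s1 + w c2 s2 * p c2 s2"
    using cs hq unfolding w_def p_def c1_def s1_def c2_def s2_def by algebra
  also have "\<bar>\<dots>\<bar> \<le> \<bar>w c s * p c s\<bar> + \<bar>w c1 s1 * p c1 s1\<bar> + \<bar>w c2 s2 * p c2 s2\<bar>"
    by linarith
  also have "\<dots> = w c s * \<bar>p c s\<bar> + w c1 s1 * \<bar>p c1 s1\<bar> + w c2 s2 * \<bar>p c2 s2\<bar>"
    using w0 by (simp add: abs_mult)
  also have "\<dots> \<le> w c s * M + w c1 s1 * M + w c2 s2 * M"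
    using bound[OF cs] bound[OF cs1] bound[OF cs2] w0
    by (intro add_mono mult_left_mono) (auto simp: p_def)
  also have "\<dots> = 9 * M" using w by (simp add: distrib_right[symmetric])
  finally show ?thesis by (simp add: abs_mult)
qed

text \<open>Every unit vector arises by tripling some angle: a third of the angle of
  \<open>(\<alpha>, \<beta>)\<close> is inserted into the unit case, and homogeneity supplies the
  factor \<open>\<rho>\<close>.\<close>

lemma binary_cubic_polarization:
  fixes a b e d \<alpha> \<beta> :: real
  assumes bound: "\<And>c s. c\<^sup>2 + s\<^sup>2 = 1 \<Longrightarrow> \<bar>a * c^3 + 3 * b * c^2 * s + 3 * e * c * s^2 + d * s^3\<bar> \<le> M"
  shows "\<bar>a * \<alpha> + b * \<beta>\<bar> \<le> M * sqrt (\<alpha>\<^sup>2 + \<beta>\<^sup>2)"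
proof (cases "\<alpha>\<^sup>2 + \<beta>\<^sup>2 = 0")
  case True
  then show ?thesis by (simp add: sum_power2_eq_zero_iff)
next
  case False
  define \<rho> where "\<rho> = sqrt (\<alpha>\<^sup>2 + \<beta>\<^sup>2)"
  have \<rho>: "\<rho> > 0" using False by (simp add: \<rho>_def sum_power2_gt_zero_iff sum_power2_eq_zero_iff)
  have "(\<alpha> / \<rho>)\<^sup>2 + (\<beta> / \<rho>)\<^sup>2 = 1"
    using \<rho> by (simp add: power_divide add_divide_distrib[symmetric]) (simp add: \<rho>_def)
  then obtain \<psi> where \<psi>: "\<alpha> / \<rho> = cos \<psi>" "\<beta> / \<rho> = sin \<psi>"
    by (metis sincos_total_2pi)
  define c s where "c = cos (\<psi> / 3)" and "s = sin (\<psi> / 3)"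
  have cs: "c\<^sup>2 + s\<^sup>2 = 1" by (simp add: c_def s_def)
  have "cos \<psi> = cos (2 * (\<psi> / 3) + \<psi> / 3)" "sin \<psi> = sin (2 * (\<psi> / 3) + \<psi> / 3)" by simp_all
  then have tri: "cos \<psi> = (c\<^sup>2 - s\<^sup>2) * c - 2 * s * c * s" "sin \<psi> = 2 * s * c * c + (c\<^sup>2 - s\<^sup>2) * s"
    unfolding cos_add sin_add cos_double sin_double c_def s_def by simp_all
  have "cos \<psi> = c^3 - 3 * c * s\<^sup>2" "sin \<psi> = 3 * c\<^sup>2 * s - s^3"
    unfolding tri by (simp_all add: power2_eq_square power3_eq_cube algebra_simps)
  then have "\<bar>a * (\<alpha> / \<rho>) + b * (\<beta> / \<rho>)\<bar> \<le> M"
    using binary_cubic_polarization_unit[OF bound cs] \<psi> by simp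
  moreover have "a * (\<alpha> / \<rho>) + b * (\<beta> / \<rho>) = (a * \<alpha> + b * \<beta>) / \<rho>"
    by (simp add: add_divide_distrib)
  ultimately show ?thesis
    using \<rho> by (simp add: abs_div_pos[symmetric] divide_le_eq \<rho>_def[symmetric] mult.commute)
qed

text \<open>
  The cubic form restricted to the plane spanned by \<open>v\<close> and \<open>u\<close>, in coordinates that are
  orthonormal for the quadratic form, is a binary cubic form.
\<close>
lemma cubic_form_polarization:
  fixes T :: "'a::real_vector \<Rightarrow> 'a \<Rightarrow> 'a \<Rightarrow> real" and Q :: "'a \<Rightarrow> 'a \<Rightarrow> real"
  assumes T: "\<And>v w. linear (\<lambda>u. T u v w)" "\<And>u v w. T u v w = T v u w" "\<And>u v w. T u v w = T u w v"
    and Q: "\<And>v. linear (\<lambda>u. Q u v)" "\<And>u v. Q u v = Q v u" "\<And>u. u \<noteq> 0 \<Longrightarrow> Q u u > 0"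
    and bound: "\<And>u. \<bar>T u u u\<bar> \<le> M * sqrt (Q u u) ^ 3"
    and M: "0 \<le> M"
  shows "\<bar>T u v v\<bar> \<le> M * sqrt (Q u u) * Q v v"
proof -
  have T1: "T (x + y) v w = T x v w + T y v w" "T (r *\<^sub>R x) v w = r * T x v w" for x y v w r
    using T(1)[of v w] by (auto simp: linear_iff)
  have T2: "T v (x + y) w = T v x w + T v y w" "T v (r *\<^sub>R x) w = r * T v x w" for x y v w r
    using T1 T(2) by metis+
  have T3: "T v w (x + y) = T v w x + T v w y" "T v w (r *\<^sub>R x) = r * T v w x" for x y v w r
    using T2 T(3) by metis+
  have Q1: "Q (x + y) v = Q x v + Q y v" "Q (r *\<^sub>R x) v = r * Q x v" for x y v r
    using Q(1)[of v] by (auto simp: linear_iff)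
  have Q2: "Q v (x + y) = Q v x + Q v y" "Q v (r *\<^sub>R x) = r * Q v x" for x y v r
    using Q1 Q(2) by metis+
  have Q0: "Q 0 0 = 0" using Q1(2)[of 0 0 0] by simp
  have T0: "T u 0 v = 0" for u v using T2(2)[of u 0 0 v] by simp
  have sq: "sqrt (Q u u) * sqrt (Q u u) = Q u u" for u
    using Q(3)[of u] Q0 by (cases "u = 0") auto
  show ?thesis
  proof (cases "v = 0")
    case True
    then show ?thesis using Q0 T0 by simp
  next
    case False
    define n where "n = sqrt (Q v v)"
    have n: "n > 0" "n * n = Q v v" using Q(3)[OF False] sq by (auto simp: n_def)
    define e1 where "e1 = (1 / n) *\<^sub>R v"
    have v: "v = n *\<^sub>R e1" using n by (simp add: e1_def)
    have e1: "Q e1 e1 = 1" unfolding e1_def Q1 Q2 using n(1) by (simp add: n(2)[symmetric])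
    define \<alpha> where "\<alpha> = Q u e1"
    define w where "w = u + (- \<alpha>) *\<^sub>R e1"
    have we1: "Q w e1 = 0" "Q e1 w = 0" unfolding w_def Q1 Q2 using e1 Q(2) by (auto simp: \<alpha>_def)
    define \<beta> where "\<beta> = sqrt (Q w w)"
    \<comment> \<open>If \<open>u\<close> is a multiple of \<open>v\<close>, there is no second
      direction and \<open>e2 = 0\<close> serves. Hence only \<open>Q e2 e2 \<le> 1\<close>, which
      still keeps the vectors \<open>c e1 + s e2\<close> below in the unit ball.\<close>
    obtain e2 where e2: "w = \<beta> *\<^sub>R e2" "Q e1 e2 = 0" "Q e2 e1 = 0" "Q e2 e2 \<le> 1"
    proof (cases "w = 0")
      case True
      then show ?thesis using that[of 0] Q2(2)[of e1 0 0] Q1(2)[of 0 0 e1] Q0 by simp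
    next
      case False
      then have "\<beta> > 0" "\<beta> * \<beta> = Q w w" using Q(3) sq by (auto simp: \<beta>_def)
      then show ?thesis
        using we1 by (intro that[of "(1 / \<beta>) *\<^sub>R w"]) (auto simp: Q1 Q2)
    qed
    have u: "u = \<alpha> *\<^sub>R e1 + \<beta> *\<^sub>R e2" using e2(1) by (simp add: w_def algebra_simps)
    have \<alpha>\<beta>: "\<alpha>\<^sup>2 + \<beta>\<^sup>2 = Q u u"
    proof -
      have "u = \<alpha> *\<^sub>R e1 + w" by (simp add: w_def)
      then have "Q u u = \<alpha> * \<alpha> + Q w w" using e1 we1 by (simp add: Q1 Q2)
      then show ?thesis using sq[of w] by (simp add: power2_eq_square \<beta>_def)
    qed
    have "\<bar>T e1 e1 e1 * c^3 + 3 * T e2 e1 e1 * c^2 * s + 3 * T e2 e2 e1 * c * s^2 + T e2 e2 e2 * s^3\<bar> \<le> M"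
      if cs: "c\<^sup>2 + s\<^sup>2 = 1" for c s
    proof -
      let ?z = "c *\<^sub>R e1 + s *\<^sub>R e2"
      have "Q ?z ?z = c\<^sup>2 + s\<^sup>2 * Q e2 e2"
        using e1 e2 by (simp add: Q1 Q2 power2_eq_square)
      also have "\<dots> \<le> 1" using cs e2(4) mult_left_mono[of "Q e2 e2" 1 "s\<^sup>2"] by simp
      finally have "sqrt (Q ?z ?z) \<le> 1" by simp
      moreover have "sqrt (Q ?z ?z) \<ge> 0" using Q(3)[of ?z] Q0 by (cases "?z = 0") auto
      ultimately have "sqrt (Q ?z ?z) ^ 3 \<le> 1" by (intro power_le_one)
      then have "M * sqrt (Q ?z ?z) ^ 3 \<le> M" using mult_left_mono[of _ 1 M] M by simp
      moreover have "T ?z ?z ?z = T e1 e1 e1 * c^3 + 3 * T e2 e1 e1 * c^2 * s + 3 * T e2 e2 e1 * c * s^2 + T e2 e2 e2 * s^3"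
        using T(2)[of e1 e2] T(3)[of _ e1 e2]
        by (simp add: T1 T2 T3 power2_eq_square power3_eq_cube algebra_simps)
      ultimately show ?thesis using bound[of ?z] by simp
    qed
    from binary_cubic_polarization[OF this, of \<alpha> \<beta>]
    have "\<bar>T u e1 e1\<bar> \<le> M * sqrt (Q u u)"
      unfolding \<alpha>\<beta> by (subst u) (simp add: T1 mult.commute)
    then have "n * n * \<bar>T u e1 e1\<bar> \<le> n * n * (M * sqrt (Q u u))"
      using n(1) by (intro mult_left_mono) auto
    moreover have "\<bar>T u v v\<bar> = n * n * \<bar>T u e1 e1\<bar>"
      unfolding v T2 T3 using n by (simp add: abs_mult)
    ultimately show ?thesis using n by (simp add: mult.commute mult.left_commute)
  qed
qed

section \<open>Self-concordant barriers\<close>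

text \<open>Here \<open>h\<close> stands for the second derivative of the barrier along a line. The
  bound is the solution of the extremal equation \<open>h' = 2 h^(3/2)\<close>, along which
  \<open>1 / sqrt h\<close> decreases at unit speed.\<close>

lemma self_concordant_second_derivative_bound:
  fixes h h' :: "real \<Rightarrow> real"
  assumes deriv: "\<And>t. 0 \<le> t \<Longrightarrow> t \<le> T \<Longrightarrow> (h has_real_derivative h' t) (at t)"
    and h0: "\<And>t. 0 \<le> t \<Longrightarrow> t \<le> T \<Longrightarrow> 0 \<le> h t"
    and sc: "\<And>t. 0 \<le> t \<Longrightarrow> t \<le> T \<Longrightarrow> \<bar>h' t\<bar> \<le> 2 * sqrt (h t) ^ 3"
    and T: "0 \<le> T" "sqrt (h 0) * T < 1"
  shows "h T \<le> (sqrt (h 0) / (1 - sqrt (h 0) * T))\<^sup>2"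
proof -
  define \<rho> where "\<rho> \<delta> = sqrt (h 0 + \<delta>)" for \<delta>
  have lim\<rho>: "(\<rho> \<longlongrightarrow> sqrt (h 0)) (at_right 0)"
    unfolding \<rho>_def by (auto intro!: tendsto_eq_intros)
  then have lim: "((\<lambda>\<delta>. (\<rho> \<delta> / (1 - \<rho> \<delta> * T))\<^sup>2) \<longlongrightarrow> (sqrt (h 0) / (1 - sqrt (h 0) * T))\<^sup>2) (at_right 0)"
    using T by (intro tendsto_intros) auto
  have "((\<lambda>\<delta>. \<rho> \<delta> * T) \<longlongrightarrow> sqrt (h 0) * T) (at_right 0)"
    by (intro tendsto_intros lim\<rho>)
  then have ev: "eventually (\<lambda>\<delta>. \<rho> \<delta> * T < 1) (at_right 0)"
    using T(2) by (rule order_tendstoD)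
  have "h T \<le> (\<rho> \<delta> / (1 - \<rho> \<delta> * T))\<^sup>2" if \<delta>: "\<delta> > 0" "\<rho> \<delta> * T < 1" for \<delta>
  proof -
    \<comment> \<open>the function \<open>1 / sqrt h\<close> is 1-Lipschitz; adding \<open>\<delta>\<close> avoids its poles\<close>
    define g where "g t = 1 / sqrt (h t + \<delta>) + t" for t
    have pos: "0 < h t + \<delta>" if "0 \<le> t" "t \<le> T" for t using h0[OF that] \<delta> by simp
    have g': "\<exists>y. (g has_real_derivative y) (at t) \<and> y \<ge> 0" if t: "0 \<le> t" "t \<le> T" for t
    proof (intro exI conjI)
      show "(g has_real_derivative (1 - h' t / (2 * sqrt (h t + \<delta>) ^ 3))) (at t)"
        unfolding g_def using pos[OF t]
        by (auto intro!: derivative_eq_intros deriv[OF t] simp: field_simps power3_eq_cube power2_eq_square)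
      have "h' t \<le> 2 * sqrt (h t) ^ 3" using sc[OF t] by simp
      also have "\<dots> \<le> 2 * sqrt (h t + \<delta>) ^ 3"
        using h0[OF t] \<delta> by (intro mult_left_mono power_mono) auto
      finally show "0 \<le> 1 - h' t / (2 * sqrt (h t + \<delta>) ^ 3)"
        using pos[OF t] by (simp add: divide_le_eq)
    qed
    have "g 0 \<le> g T" by (rule DERIV_nonneg_imp_nondecreasing[OF T(1)]) (rule g')
    then have "1 / \<rho> \<delta> - T \<le> 1 / sqrt (h T + \<delta>)" by (simp add: g_def \<rho>_def)
    moreover have \<rho>: "\<rho> \<delta> > 0" using pos[of 0] T by (simp add: \<rho>_def)
    ultimately have *: "(1 - \<rho> \<delta> * T) / \<rho> \<delta> \<le> 1 / sqrt (h T + \<delta>)"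
      by (simp add: diff_divide_distrib)
    have "sqrt (h T + \<delta>) \<le> \<rho> \<delta> / (1 - \<rho> \<delta> * T)"
    proof -
      have "(1 - \<rho> \<delta> * T) * sqrt (h T + \<delta>) \<le> \<rho> \<delta>"
        using * \<rho> pos[of T] T by (simp add: divide_le_eq pos_le_divide_eq mult.commute)
      then show ?thesis using that by (simp add: pos_le_divide_eq mult.commute)
    qed
    then have "(sqrt (h T + \<delta>))\<^sup>2 \<le> (\<rho> \<delta> / (1 - \<rho> \<delta> * T))\<^sup>2"
      using pos[of T] T by (intro power_mono) auto
    then show ?thesis using pos[of T] T \<delta> by simp
  qed
  then have "eventually (\<lambda>\<delta>. h T \<le> (\<rho> \<delta> / (1 - \<rho> \<delta> * T))\<^sup>2) (at_right 0)"
    using ev eventually_at_right_less[of "0::real"] by (auto elim: eventually_elim2)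
  then show ?thesis by (rule tendsto_lowerbound[OF lim]) simp
qed

text \<open>Integrating \<open>(r / (1 - r t))^2\<close> twice would give
  \<open>- r T - ln (1 - r T)\<close>. The rational majorant has the larger second derivative
  \<open>r^2 / (1 - r t)^3\<close> and is the form that produces the term \<open>1 / (1 - s)\<close>
  of the curvature constant.\<close>

lemma self_concordant_upper_bound:
  fixes \<phi> \<phi>' \<phi>'' :: "real \<Rightarrow> real"
  assumes d1: "\<And>t. 0 \<le> t \<Longrightarrow> t \<le> T \<Longrightarrow> (\<phi> has_real_derivative \<phi>' t) (at t)"
    and d2: "\<And>t. 0 \<le> t \<Longrightarrow> t \<le> T \<Longrightarrow> (\<phi>' has_real_derivative \<phi>'' t) (at t)"
    and bound: "\<And>t. 0 \<le> t \<Longrightarrow> t \<le> T \<Longrightarrow> \<phi>'' t \<le> (r / (1 - r * t))\<^sup>2"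
    and T: "0 \<le> T" "0 \<le> r" "r * T < 1"
  shows "\<phi> T \<le> \<phi> 0 + \<phi>' 0 * T + (r * T)\<^sup>2 / (2 * (1 - r * T))"
proof -
  have pos: "0 < 1 - r * t" "1 - r * t \<le> 1" if "0 \<le> t" "t \<le> T" for t
    using that T mult_left_mono[of t T r] by auto
  \<comment> \<open>The derivative of the majorant \<open>\<psi>\<close> defined below; the
    comparison is made first for derivatives, then for values.\<close>
  define \<psi>1 where "\<psi>1 t = \<phi>' 0 + r\<^sup>2 * (2 * t - r * t\<^sup>2) / (2 * (1 - r * t)\<^sup>2)" for t
  have 1: "\<phi>' t \<le> \<psi>1 t" if t: "0 \<le> t" "t \<le> T" for t
  proof -
    have "\<exists>y. ((\<lambda>s. \<psi>1 s - \<phi>' s) has_real_derivative y) (at s) \<and> y \<ge> 0" if s: "0 \<le> s" "s \<le> t" for s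
    proof (intro exI conjI)
      have ps: "0 < 1 - r * s" "1 - r * s \<le> 1" "0 \<le> s" "s \<le> T" using pos[of s] s t by auto
      have "((\<lambda>s. r\<^sup>2 * (2 * s - r * s\<^sup>2) / (2 * (1 - r * s)\<^sup>2)) has_real_derivative
         ((r\<^sup>2 * (2 - r * (2 * s))) * (2 * (1 - r * s)\<^sup>2) - (r\<^sup>2 * (2 * s - r * s\<^sup>2)) * (2 * (2 * (1 - r * s) * (- r))))
          / ((2 * (1 - r * s)\<^sup>2) * (2 * (1 - r * s)\<^sup>2))) (at s)"
        by (rule DERIV_divide) (use ps in \<open>auto intro!: derivative_eq_intros\<close>)
      also have "((r\<^sup>2 * (2 - r * (2 * s))) * (2 * (1 - r * s)\<^sup>2) - (r\<^sup>2 * (2 * s - r * s\<^sup>2)) * (2 * (2 * (1 - r * s) * (- r))))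
          = (4 * (1 - r * s)) * r\<^sup>2"
        by (simp add: power2_eq_square algebra_simps)
      also have "(4 * (1 - r * s)) * r\<^sup>2 / ((2 * (1 - r * s)\<^sup>2) * (2 * (1 - r * s)\<^sup>2))
          = ((4 * (1 - r * s)) * r\<^sup>2) / ((4 * (1 - r * s)) * (1 - r * s) ^ 3)"
        by (rule arg_cong2[where f = "(/)"]) algebra+
      also have "\<dots> = r\<^sup>2 / (1 - r * s) ^ 3"
        using ps by (subst mult_divide_mult_cancel_left) auto
      finally have D: "((\<lambda>s. r\<^sup>2 * (2 * s - r * s\<^sup>2) / (2 * (1 - r * s)\<^sup>2)) has_real_derivative
          r\<^sup>2 / (1 - r * s) ^ 3) (at s)" .
      show "((\<lambda>s. \<psi>1 s - \<phi>' s) has_real_derivative r\<^sup>2 / (1 - r * s) ^ 3 - \<phi>'' s) (at s)"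
        unfolding \<psi>1_def using DERIV_diff[OF DERIV_add[OF DERIV_const D] d2] ps by simp
      have "\<phi>'' s \<le> r\<^sup>2 / (1 - r * s)\<^sup>2" using bound[of s] ps by (simp add: power_divide)
      also have "\<dots> \<le> r\<^sup>2 / (1 - r * s) ^ 3"
        using ps power_decreasing[of 2 3 "1 - r * s"] by (intro divide_left_mono) auto
      finally show "0 \<le> r\<^sup>2 / (1 - r * s) ^ 3 - \<phi>'' s" by simp
    qed
    then have "\<psi>1 0 - \<phi>' 0 \<le> \<psi>1 t - \<phi>' t" using t by (intro DERIV_nonneg_imp_nondecreasing[where f = "\<lambda>s. \<psi>1 s - \<phi>' s"]) auto
    then show ?thesis by (simp add: \<psi>1_def)
  qed
  define \<psi> where "\<psi> t = \<phi> 0 + \<phi>' 0 * t + (r * t)\<^sup>2 / (2 * (1 - r * t))" for t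
  have "\<exists>y. ((\<lambda>s. \<psi> s - \<phi> s) has_real_derivative y) (at s) \<and> y \<ge> 0" if s: "0 \<le> s" "s \<le> T" for s
  proof (intro exI conjI)
    have ps: "0 < 1 - r * s" using pos[of s] s by auto
    have "((\<lambda>s. (r * s)\<^sup>2 / (2 * (1 - r * s))) has_real_derivative
       ((2 * (r * s) * r) * (2 * (1 - r * s)) - (r * s)\<^sup>2 * (2 * (- r))) / ((2 * (1 - r * s)) * (2 * (1 - r * s)))) (at s)"
      by (rule DERIV_divide) (use ps in \<open>auto intro!: derivative_eq_intros\<close>)
    also have "(2 * (r * s) * r) * (2 * (1 - r * s)) - (r * s)\<^sup>2 * (2 * (- r)) = 2 * (r\<^sup>2 * (2 * s - r * s\<^sup>2))"
      by (simp add: power2_eq_square algebra_simps)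
    also have "2 * (r\<^sup>2 * (2 * s - r * s\<^sup>2)) / ((2 * (1 - r * s)) * (2 * (1 - r * s))) = \<psi>1 s - \<phi>' 0"
    proof -
      have "2 * X / ((2 * Y) * (2 * Y)) = X / (2 * Y\<^sup>2)" for X Y :: real
        by (simp add: power2_eq_square)
      then show ?thesis unfolding \<psi>1_def by (simp only: add_diff_cancel_left')
    qed
    finally have D: "((\<lambda>s. (r * s)\<^sup>2 / (2 * (1 - r * s))) has_real_derivative \<psi>1 s - \<phi>' 0) (at s)" .
    have "((\<lambda>s. \<phi> 0 + \<phi>' 0 * s) has_real_derivative \<phi>' 0) (at s)"
      by (auto intro!: derivative_eq_intros)
    from DERIV_diff[OF DERIV_add[OF this D] d1]
    show "((\<lambda>s. \<psi> s - \<phi> s) has_real_derivative \<psi>1 s - \<phi>' s) (at s)"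
      unfolding \<psi>_def using s by simp
    show "0 \<le> \<psi>1 s - \<phi>' s" using 1[of s] s by simp
  qed
  then have "\<psi> 0 - \<phi> 0 \<le> \<psi> T - \<phi> T" using T by (intro DERIV_nonneg_imp_nondecreasing[where f = "\<lambda>s. \<psi> s - \<phi> s"]) auto
  then show ?thesis by (simp add: \<psi>_def)
qed

text \<open>The hypothesis bounds the logarithmic derivative of \<open>q\<close> below by that of
  \<open>(1 - r t)^2\<close>, so the quotient of the two is nondecreasing. Using the quotient
  instead of logarithms admits zeros of \<open>q\<close>.\<close>

lemma self_concordant_quadratic_form_lower_bound:
  fixes q q' h :: "real \<Rightarrow> real"
  assumes deriv: "\<And>t. 0 \<le> t \<Longrightarrow> t \<le> 1 \<Longrightarrow> (q has_real_derivative q' t) (at t)"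
    and q': "\<And>t. 0 \<le> t \<Longrightarrow> t \<le> 1 \<Longrightarrow> \<bar>q' t\<bar> \<le> 2 * (r / (1 - r * t)) * q t"
    and r: "0 \<le> r" "r < 1"
  shows "(1 - r)\<^sup>2 * q 0 \<le> q 1"
proof -
  define g where "g t = q t / (1 - r * t)\<^sup>2" for t
  have "\<exists>y. (g has_real_derivative y) (at t) \<and> y \<ge> 0" if t: "0 \<le> t" "t \<le> 1" for t
  proof (intro exI conjI)
    have p: "0 < 1 - r * t" using t r mult_left_mono[of t 1 r] by auto
    show "(g has_real_derivative (q' t + 2 * (r / (1 - r * t)) * q t) / (1 - r * t)\<^sup>2) (at t)"
      unfolding g_def using p
      by (auto intro!: derivative_eq_intros deriv[OF t] simp: divide_simps power2_eq_square)
        (simp add: algebra_simps)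
    show "0 \<le> (q' t + 2 * (r / (1 - r * t)) * q t) / (1 - r * t)\<^sup>2"
      using q'[OF t] p by (intro divide_nonneg_pos) auto
  qed
  then have "g 0 \<le> g 1" by (intro DERIV_nonneg_imp_nondecreasing[of 0 1 g]) auto
  then show ?thesis using r by (simp add: g_def pos_le_divide_eq mult.commute)
qed

section \<open>Differential calculus of the barrier on the interior of the cone\<close>

lemma differentiable_imp_GDERIV:
  fixes f :: "real^'n \<Rightarrow> real"
  assumes "f differentiable (at x)"
  shows "GDERIV f x :> gradient f x"
proof -
  obtain D where D: "(f has_derivative D) (at x)" using assms by (auto simp: differentiable_def)
  then have "D = (\<lambda>h. h \<bullet> adjoint D 1)"
    using adjoint_works[OF has_derivative_linear[OF D]] by (auto simp: fun_eq_iff)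
  with D have "GDERIV f x :> adjoint D 1" by (simp add: gderiv_def)
  then show ?thesis using gradient_eqI by metis
qed

lemma bounded_linear_matrix_vector_mul_left:
  "bounded_linear (\<lambda>M::real^'n^'m. M *v (v::real^'n))"
  by (rule linear_conv_bounded_linear[THEN iffD1])
    (auto simp: linear_iff matrix_vector_mult_add_rdistrib scaleR_matrix_vector_assoc)

lemma powr_three_halves: "0 \<le> x \<Longrightarrow> x powr (3/2) = sqrt x ^ 3" for x :: real
proof -
  assume "0 \<le> x"
  then have "x powr (3/2) = (x powr (1/2)) powr 3" by (simp add: powr_powr)
  also have "\<dots> = sqrt x ^ 3" using \<open>0 \<le> x\<close> by (simp add: powr_half_sqrt powr_numeral)
  finally show ?thesis .
qed

locale sc_barrier_cone =
  fixes \<K> :: "(real^'n) set" and \<theta> :: real and B :: "real^'n \<Rightarrow> real"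
  assumes cone: "proper_cone \<K>" and barrier: "log_homogeneous_sc_barrier \<K> \<theta> B"
begin

abbreviation "H \<equiv> hessian B"

text \<open>The trilinear form \<open>D^3 B(x)[u, v, w]\<close>. The Hessian is differentiated in
  direction \<open>u\<close>, so symmetry between \<open>u\<close> and the other two arguments is a
  theorem and not built in.\<close>

definition third :: "real^'n \<Rightarrow> real^'n \<Rightarrow> real^'n \<Rightarrow> real^'n \<Rightarrow> real"
  where "third x u v w = w \<bullet> (frechet_derivative H (at x) u *v v)"

lemma barrier_GDERIV: "x \<in> interior \<K> \<Longrightarrow> GDERIV B x :> gradient B x"
  using barrier by (intro differentiable_imp_GDERIV)
    (auto simp: log_homogeneous_sc_barrier_def C3_on_def)

lemma gradient_has_derivative:
  "x \<in> interior \<K> \<Longrightarrow> (gradient B has_derivative (\<lambda>h. H x *v h)) (at x)"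
  using barrier jacobian_works[of "gradient B" "at x"]
  by (auto simp: log_homogeneous_sc_barrier_def C3_on_def hessian_def)

lemma hessian_has_derivative:
  "x \<in> interior \<K> \<Longrightarrow> (H has_derivative frechet_derivative H (at x)) (at x)"
  using barrier by (auto simp: log_homogeneous_sc_barrier_def C3_on_def frechet_derivative_works)

lemma hessian_mult_has_derivative:
  assumes "x \<in> interior \<K>"
  shows "((\<lambda>y. H y *v w) has_derivative (\<lambda>u. frechet_derivative H (at x) u *v w)) (at x)"
  using bounded_linear.has_derivative[OF bounded_linear_matrix_vector_mul_left hessian_has_derivative[OF assms]] .

lemma eventually_interior: "x \<in> interior \<K> \<Longrightarrow> eventually (\<lambda>y. y \<in> interior \<K>) (nhds x)"
  by (intro eventually_nhds_in_open) auto

lemma hessian_symmetric: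
  assumes x: "x \<in> interior \<K>"
  shows "u \<bullet> (H x *v v) = v \<bullet> (H x *v u)"
  using second_derivative_symmetric[OF _ gradient_has_derivative[OF x], of B v u]
    eventually_mono[OF eventually_interior[OF x], of "\<lambda>y. GDERIV B y :> gradient B y"] barrier_GDERIV
  by (auto simp: inner_commute)

text \<open>For the directions \<open>u\<close> and \<open>- u\<close> the second difference is
  \<open>2 B(x) - B(x + t u) - B(x - t u)\<close>, nonpositive by midpoint convexity, and its scaled
  limit is the negative of the quadratic form.\<close>

lemma hessian_quadratic_nonneg:
  assumes x: "x \<in> interior \<K>"
  shows "0 \<le> u \<bullet> (H x *v u)"
proof -
  have "((\<lambda>t. (B (x + t *\<^sub>R u + t *\<^sub>R (- u)) - B (x + t *\<^sub>R u) - B (x + t *\<^sub>R (- u)) + B x) / t\<^sup>2)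
      \<longlongrightarrow> (H x *v (- u)) \<bullet> u) (at_right 0)"
    using eventually_interior[OF x] barrier_GDERIV
    by (intro second_difference_tendsto[OF _ gradient_has_derivative[OF x]])
      (auto elim: eventually_mono)
  moreover have "eventually (\<lambda>t. (B (x + t *\<^sub>R u + t *\<^sub>R (- u)) - B (x + t *\<^sub>R u) - B (x + t *\<^sub>R (- u)) + B x) / t\<^sup>2 \<le> 0)
      (at_right 0)"
  proof -
    have "((\<lambda>t. x + t *\<^sub>R v) \<longlongrightarrow> x) (at_right 0)" for v
      by (auto intro!: tendsto_eq_intros)
    then have "eventually (\<lambda>t. x + t *\<^sub>R v \<in> interior \<K>) (at_right 0)" for v
      using x by (intro topological_tendstoD) auto
    from this[of u] this[of "- u"] show ?thesis
    proof eventually_elim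
      case (elim t)
      have cv: "convex_on (interior \<K>) B" using barrier by (simp add: log_homogeneous_sc_barrier_def)
      have "(1 - 1/2) *\<^sub>R (x + t *\<^sub>R u) + (1/2) *\<^sub>R (x + t *\<^sub>R (- u)) = x"
        by (simp add: vec_eq_iff field_simps)
      with convex_onD[OF cv, of "1/2" "x + t *\<^sub>R u" "x + t *\<^sub>R (- u)"] elim
      have "B x \<le> (1 - 1/2) * B (x + t *\<^sub>R u) + (1/2) * B (x + t *\<^sub>R (- u))" by simp
      then show ?case by (intro divide_nonpos_nonneg) auto
    qed
  qed
  ultimately have "(H x *v (- u)) \<bullet> u \<le> 0"
    by (rule tendsto_upperbound) simp
  then show ?thesis by (simp add: inner_commute vec.neg)
qed

lemma third_swap_last:
  assumes x: "x \<in> interior \<K>"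
  shows "third x u v w = third x u w v"
proof -
  have "((\<lambda>y. w \<bullet> (H y *v v)) has_derivative (\<lambda>u. third x u v w)) (at x)"
    unfolding third_def by (intro has_derivative_inner_right hessian_mult_has_derivative x)
  moreover have "((\<lambda>y. w \<bullet> (H y *v v)) has_derivative (\<lambda>u. third x u w v)) (at x)"
  proof (rule has_derivative_transform_within_open[of "\<lambda>y. v \<bullet> (H y *v w)"])
    show "((\<lambda>y. v \<bullet> (H y *v w)) has_derivative (\<lambda>u. third x u w v)) (at x)"
      unfolding third_def by (intro has_derivative_inner_right hessian_mult_has_derivative x)
  qed (use x hessian_symmetric in auto)
  ultimately show ?thesis by (auto dest: has_derivative_unique simp: fun_eq_iff)
qed

text \<open>Symmetry of second derivatives is applied once more, to the scalar function
  \<open>w \<bullet> gradient B y\<close>, whose gradient is \<open>H y *v w\<close> because the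
  Hessian is symmetric.\<close>

lemma third_swap_first:
  assumes x: "x \<in> interior \<K>"
  shows "third x u v w = third x v u w"
proof -
  have "GDERIV (\<lambda>y. w \<bullet> gradient B y) y :> H y *v w" if "y \<in> interior \<K>" for y
    unfolding gderiv_def hessian_symmetric[OF that, of _ w]
    by (intro has_derivative_inner_right gradient_has_derivative that)
  then have "eventually (\<lambda>y. GDERIV (\<lambda>y. w \<bullet> gradient B y) y :> H y *v w) (nhds x)"
    using eventually_interior[OF x] by (auto elim: eventually_mono)
  from second_derivative_symmetric[OF this hessian_mult_has_derivative[OF x]]
  have "third x v w u = third x u w v" by (simp add: third_def inner_commute)
  then show ?thesis using third_swap_last[OF x] by metis
qed

lemma linear_third:
  assumes x: "x \<in> interior \<K>"
  shows "linear (\<lambda>u. third x u v w)"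
  unfolding third_def
  using has_derivative_linear[OF has_derivative_inner_right[OF hessian_mult_has_derivative[OF x]], of w v]
  by simp

section \<open>The barrier restricted to lines\<close>

context
  fixes x u :: "real^'n" and t :: real
  assumes xt: "x + t *\<^sub>R u \<in> interior \<K>"
begin

lemma line_has_derivative: "((\<lambda>t. x + t *\<^sub>R u) has_derivative (\<lambda>h. h *\<^sub>R u)) (at t)"
  by (auto intro!: derivative_eq_intros)

lemma barrier_line_deriv:
  "((\<lambda>t. B (x + t *\<^sub>R u)) has_real_derivative u \<bullet> gradient B (x + t *\<^sub>R u)) (at t)"
  unfolding has_field_derivative_def
  by (rule has_derivative_eq_rhs,
      rule has_derivative_compose[OF line_has_derivative barrier_GDERIV[OF xt, unfolded gderiv_def]]) auto

lemma gradient_line_deriv: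
  "((\<lambda>t. v \<bullet> gradient B (x + t *\<^sub>R u)) has_real_derivative v \<bullet> (H (x + t *\<^sub>R u) *v u)) (at t)"
  unfolding has_field_derivative_def
  by (rule has_derivative_eq_rhs,
      rule has_derivative_inner_right[OF has_derivative_compose[OF line_has_derivative gradient_has_derivative[OF xt]]])
    (auto simp: matrix_vector_mult_scaleR mult.commute)

lemma hessian_line_deriv:
  "((\<lambda>t. w \<bullet> (H (x + t *\<^sub>R u) *v v)) has_real_derivative third (x + t *\<^sub>R u) u v w) (at t)"
  unfolding has_field_derivative_def
  by (rule has_derivative_eq_rhs,
      rule has_derivative_inner_right[OF has_derivative_compose[OF line_has_derivative hessian_mult_has_derivative[OF xt]]])
    (use linear_scale[OF linear_third[OF xt]] in \<open>auto simp: third_def mult.commute\<close>)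

end

text \<open>The barrier axiom speaks of iterated \<open>deriv\<close> of a restriction to a line.
  Each derivative is identified on the whole open set \<open>S\<close> of admissible parameters,
  since the next \<open>deriv\<close> sees a neighbourhood and not a single point.\<close>

lemma third_diagonal_bound:
  assumes x: "x \<in> interior \<K>"
  shows "\<bar>third x u u u\<bar> \<le> 2 * sqrt (u \<bullet> (H x *v u)) ^ 3"
proof -
  define \<phi> where "\<phi> = (\<lambda>t::real. B (x + t *\<^sub>R u))"
  define S where "S = {t. x + t *\<^sub>R u \<in> interior \<K>}"
  have "open ((\<lambda>t. x + t *\<^sub>R u) -` interior \<K>)"
    by (intro open_vimage continuous_intros open_interior)
  then have "open S" by (simp add: S_def vimage_def)
  have ev: "eventually (\<lambda>s. s \<in> S) (nhds t)" if "t \<in> S" for t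
    using that \<open>open S\<close> by (rule eventually_nhds_in_open[rotated])
  have 1: "deriv \<phi> t = u \<bullet> gradient B (x + t *\<^sub>R u)" if "t \<in> S" for t
    using that unfolding \<phi>_def S_def by (intro DERIV_imp_deriv barrier_line_deriv) simp
  have 2: "(deriv ^^ 2) \<phi> t = u \<bullet> (H (x + t *\<^sub>R u) *v u)" if "t \<in> S" for t
  proof -
    have "deriv (deriv \<phi>) t = deriv (\<lambda>t. u \<bullet> gradient B (x + t *\<^sub>R u)) t"
      by (rule deriv_cong_ev[OF _ refl], rule eventually_mono[OF ev[OF that] 1])
    also have "\<dots> = u \<bullet> (H (x + t *\<^sub>R u) *v u)"
      using that unfolding S_def by (intro DERIV_imp_deriv gradient_line_deriv) simp
    finally show ?thesis by (simp add: numeral_2_eq_2)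
  qed
  have 0: "0 \<in> S" using x by (simp add: S_def)
  have 3: "(deriv ^^ 3) \<phi> 0 = third x u u u"
  proof -
    have "deriv ((deriv ^^ 2) \<phi>) 0 = deriv (\<lambda>t. u \<bullet> (H (x + t *\<^sub>R u) *v u)) 0"
      by (rule deriv_cong_ev[OF _ refl], rule eventually_mono[OF ev[OF 0] 2])
    also have "\<dots> = third (x + 0 *\<^sub>R u) u u u"
      using 0 unfolding S_def by (intro DERIV_imp_deriv hessian_line_deriv) simp
    finally show ?thesis by (simp add: numeral_3_eq_3 numeral_2_eq_2)
  qed
  have "\<bar>(deriv ^^ 3) \<phi> 0\<bar> \<le> 2 * ((deriv ^^ 2) \<phi> 0) powr (3/2)"
    using barrier x unfolding \<phi>_def by (auto simp: log_homogeneous_sc_barrier_def Let_def)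
  then show ?thesis
    unfolding 3 2[OF 0] using powr_three_halves[OF hessian_quadratic_nonneg[OF x]] by simp
qed

text \<open>\<open>T\<close> is the first exit parameter. The point reached there lies in the closed
  cone but not in its interior, hence on the frontier, where the barrier tends to infinity.\<close>

lemma barrier_exit:
  assumes x: "x \<in> interior \<K>" and t0: "0 \<le> t0" "x + t0 *\<^sub>R u \<notin> interior \<K>"
  obtains T where "0 < T" "T \<le> t0" "\<And>t. 0 \<le> t \<Longrightarrow> t < T \<Longrightarrow> x + t *\<^sub>R u \<in> interior \<K>"
    "filterlim (\<lambda>t. B (x + t *\<^sub>R u)) at_top (at_left T)"
proof -
  define S where "S = {t. x + t *\<^sub>R u \<notin> interior \<K>} \<inter> {0..}"
  have "open ((\<lambda>t. x + t *\<^sub>R u) -` interior \<K>)"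
    by (intro open_vimage continuous_intros open_interior)
  then have "closed {t. x + t *\<^sub>R u \<notin> interior \<K>}" by (simp add: closed_def Compl_eq vimage_def)
  then have S: "closed S" "bdd_below S" "t0 \<in> S" using t0 by (auto simp: S_def)
  define T where "T = Inf S"
  have TS: "T \<in> S" unfolding T_def using S by (intro closed_contains_Inf) auto
  have "T \<le> t0" unfolding T_def using S by (intro cInf_lower) auto
  have "T \<noteq> 0" using TS x by (auto simp: S_def)
  then have "0 < T" using TS by (auto simp: S_def)
  have in_int: "x + t *\<^sub>R u \<in> interior \<K>" if "0 \<le> t" "t < T" for t
    using that cInf_lower[OF _ S(2), of t] by (force simp: S_def T_def)
  have ev: "eventually (\<lambda>t. x + t *\<^sub>R u \<in> interior \<K>) (at_left T)"
    unfolding eventually_at_left_field using \<open>0 < T\<close> in_int by (intro exI[of _ 0]) auto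
  have lim: "((\<lambda>t. x + t *\<^sub>R u) \<longlongrightarrow> x + T *\<^sub>R u) (at_left T)"
    by (auto intro!: tendsto_eq_intros)
  have "closed \<K>" using cone by (simp add: proper_cone_def)
  moreover have "eventually (\<lambda>t. x + t *\<^sub>R u \<in> \<K>) (at_left T)"
    using ev by eventually_elim (use interior_subset in auto)
  ultimately have "x + T *\<^sub>R u \<in> \<K>"
    using lim by (intro Lim_in_closed_set) (auto simp: trivial_limit_at_left_real)
  then have "x + T *\<^sub>R u \<in> frontier \<K>"
    using TS by (auto simp: S_def frontier_def closure_closed[OF \<open>closed \<K>\<close>])
  then have "filterlim B at_top (at (x + T *\<^sub>R u) within interior \<K>)"
    using barrier by (auto simp: log_homogeneous_sc_barrier_def)
  moreover have "filterlim (\<lambda>t. x + t *\<^sub>R u) (at (x + T *\<^sub>R u) within interior \<K>) (at_left T)"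
    unfolding filterlim_at using lim
  proof (intro conjI)
    show "eventually (\<lambda>t. x + t *\<^sub>R u \<in> interior \<K> \<and> x + t *\<^sub>R u \<noteq> x + T *\<^sub>R u) (at_left T)"
      using ev by eventually_elim (use TS in \<open>auto simp: S_def\<close>)
  qed
  ultimately have "filterlim (\<lambda>t. B (x + t *\<^sub>R u)) at_top (at_left T)" by (rule filterlim_compose)
  with \<open>0 < T\<close> \<open>T \<le> t0\<close> in_int show ?thesis by (rule that)
qed

text \<open>A continuation principle: the bound on the barrier may be proved under the assumption
  that the segment traversed so far is interior, which is exactly what the estimates along lines
  require.\<close>

lemma bounded_barrier_imp_interior:
  assumes x: "x \<in> interior \<K>" and t0: "0 \<le> t0"
    and bound: "\<And>t. 0 \<le> t \<Longrightarrow> t \<le> t0 \<Longrightarrow> (\<And>s. 0 \<le> s \<Longrightarrow> s \<le> t \<Longrightarrow> x + s *\<^sub>R u \<in> interior \<K>)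
      \<Longrightarrow> B (x + t *\<^sub>R u) \<le> M"
  shows "x + t0 *\<^sub>R u \<in> interior \<K>"
proof (rule ccontr)
  assume "x + t0 *\<^sub>R u \<notin> interior \<K>"
  from barrier_exit[OF x t0 this] obtain T where T: "0 < T" "T \<le> t0"
    "\<And>t. 0 \<le> t \<Longrightarrow> t < T \<Longrightarrow> x + t *\<^sub>R u \<in> interior \<K>"
    "filterlim (\<lambda>t. B (x + t *\<^sub>R u)) at_top (at_left T)" by blast
  have "eventually (\<lambda>t. M < B (x + t *\<^sub>R u)) (at_left T)"
    using T(4) by (auto simp: filterlim_at_top_dense)
  moreover have "eventually (\<lambda>t. t < T) (at_left T)" by (simp add: eventually_at_filter)
  moreover have "eventually (\<lambda>t. 0 < t) (at_left T)"
    using T(1) by (intro order_tendstoD(1)[OF tendsto_ident_at]) auto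
  ultimately have "eventually (\<lambda>t. False) (at_left T)"
  proof eventually_elim
    case (elim t)
    have "B (x + t *\<^sub>R u) \<le> M" using elim T by (intro bound) auto
    with elim show False by simp
  qed
  then show False by simp
qed

lemma hessian_line_bound:
  assumes seg: "\<And>s. 0 \<le> s \<Longrightarrow> s \<le> t \<Longrightarrow> x + s *\<^sub>R u \<in> interior \<K>"
    and t: "0 \<le> t" and r: "r = sqrt (u \<bullet> (H x *v u))" "r * t < 1"
  shows "u \<bullet> (H (x + t *\<^sub>R u) *v u) \<le> (r / (1 - r * t))\<^sup>2"
  using self_concordant_second_derivative_bound[where h = "\<lambda>s. u \<bullet> (H (x + s *\<^sub>R u) *v u)" and T = t
      and h' = "\<lambda>s. third (x + s *\<^sub>R u) u u u"] t r hessian_line_deriv[OF seg]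
    hessian_quadratic_nonneg[OF seg] third_diagonal_bound[OF seg]
  by simp

lemma barrier_line_bound:
  assumes seg: "\<And>s. 0 \<le> s \<Longrightarrow> s \<le> t \<Longrightarrow> x + s *\<^sub>R u \<in> interior \<K>"
    and t: "0 \<le> t" and r: "r = sqrt (u \<bullet> (H x *v u))" "r * t < 1"
  shows "B (x + t *\<^sub>R u) \<le> B x + (u \<bullet> gradient B x) * t + (r * t)\<^sup>2 / (2 * (1 - r * t))"
proof -
  have x: "x \<in> interior \<K>" using seg[of 0] t by simp
  have r0: "r \<ge> 0" using hessian_quadratic_nonneg[OF x] r by simp
  have "B (x + t *\<^sub>R u) \<le> B (x + 0 *\<^sub>R u) + (u \<bullet> gradient B (x + 0 *\<^sub>R u)) * t + (r * t)\<^sup>2 / (2 * (1 - r * t))"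
  proof (rule self_concordant_upper_bound[where \<phi>' = "\<lambda>s. u \<bullet> gradient B (x + s *\<^sub>R u)"
      and \<phi>'' = "\<lambda>s. u \<bullet> (H (x + s *\<^sub>R u) *v u)"])
    fix s assume s: "0 \<le> s" "s \<le> t"
    then have "r * s < 1" using mult_left_mono[of s t r] r0 r by simp
    then show "u \<bullet> (H (x + s *\<^sub>R u) *v u) \<le> (r / (1 - r * s))\<^sup>2"
      using s r by (intro hessian_line_bound seg) auto
  qed (use barrier_line_deriv gradient_line_deriv seg t r r0 in auto)
  then show ?thesis by simp
qed

lemma hessian_pos_def:
  assumes x: "x \<in> interior \<K>" and u: "u \<noteq> 0"
  shows "0 < u \<bullet> (H x *v u)"
proof (rule ccontr)
  assume "\<not> 0 < u \<bullet> (H x *v u)"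
  then have z: "u \<bullet> (H x *v u) = 0" using hessian_quadratic_nonneg[OF x, of u] by simp
  \<comment> \<open>the barrier is affine in the direction \<open>u\<close>, so the cone contains a line\<close>
  have ray: "x + t *\<^sub>R v \<in> interior \<K>" if t: "t \<ge> 0" and v: "v \<bullet> (H x *v v) = 0" for t v
  proof (rule bounded_barrier_imp_interior[OF x t])
    fix s assume s: "0 \<le> s" "s \<le> t" and seg: "\<And>r. 0 \<le> r \<Longrightarrow> r \<le> s \<Longrightarrow> x + r *\<^sub>R v \<in> interior \<K>"
    have "B (x + s *\<^sub>R v) \<le> B x + (v \<bullet> gradient B x) * s"
      using barrier_line_bound[OF seg s(1), of 0] v by simp
    also have "\<dots> \<le> B x + \<bar>v \<bullet> gradient B x\<bar> * t"
      using s by (intro add_left_mono mult_mono) auto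
    finally show "B (x + s *\<^sub>R v) \<le> B x + \<bar>v \<bullet> gradient B x\<bar> * t" .
  qed
  \<comment> \<open>Dividing \<open>x + n v\<close> by \<open>n\<close> stays in the cone and
    converges to \<open>v\<close>, so closedness puts the direction itself into the cone. Used for
    \<open>u\<close> and \<open>- u\<close>, this contradicts pointedness.\<close>
  have inK: "v \<in> \<K>" if v: "v \<bullet> (H x *v v) = 0" for v
  proof -
    have "cone \<K>" "closed \<K>" using cone by (auto simp: proper_cone_def)
    have "(inverse (real (Suc n))) *\<^sub>R x + v \<in> \<K>" for n
    proof -
      have "x + real (Suc n) *\<^sub>R v \<in> \<K>" using ray[of "real (Suc n)" v] v interior_subset by auto
      then have "inverse (real (Suc n)) *\<^sub>R (x + real (Suc n) *\<^sub>R v) \<in> \<K>"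
        using \<open>cone \<K>\<close> by (intro mem_cone) auto
      then show ?thesis by (simp add: scaleR_add_right del: of_nat_Suc)
    qed
    moreover have "(\<lambda>n. (inverse (real (Suc n))) *\<^sub>R x + v) \<longlonglongrightarrow> 0 *\<^sub>R x + v"
      by (intro tendsto_intros LIMSEQ_inverse_real_of_nat)
    ultimately show ?thesis
      using closed_sequentially[OF \<open>closed \<K>\<close>, of "\<lambda>n. (inverse (real (Suc n))) *\<^sub>R x + v"] by simp
  qed
  have "u \<in> \<K>" using inK z by simp
  moreover have "- u \<in> \<K>" using inK[of "- u"] z by (simp add: vec.neg)
  ultimately have "u \<in> \<K> \<inter> uminus ` \<K>" by (auto intro: image_eqI[of _ _ "- u"])
  then show False using cone u by (auto simp: proper_cone_def)
qed

text \<open>The quantity on the left is the derivative of \<open>v \<bullet> (H x *v v)\<close> in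
  direction \<open>u\<close>. Polarization loses nothing, so the diagonal constant 2 survives; this
  is what makes the factor \<open>(1 - r)^2\<close> in the Hessian comparison possible.\<close>

lemma third_bound:
  assumes x: "x \<in> interior \<K>"
  shows "\<bar>third x u v v\<bar> \<le> 2 * sqrt (u \<bullet> (H x *v u)) * (v \<bullet> (H x *v v))"
proof (rule cubic_form_polarization[where T = "third x" and Q = "\<lambda>u v. v \<bullet> (H x *v u)"])
  show "linear (\<lambda>u. v \<bullet> (H x *v u))" for v
    by (auto simp: linear_iff matrix_vector_right_distrib inner_add_right matrix_vector_mult_scaleR)
qed (rule linear_third[OF x] third_swap_first[OF x] third_swap_last[OF x] hessian_symmetric[OF x]
    hessian_pos_def[OF x] third_diagonal_bound[OF x] | assumption | simp)+

text \<open>As long as the segment stays interior, the upper estimate keeps the barrier below a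
  constant depending only on \<open>x\<close>, \<open>u\<close> and \<open>r < 1\<close>, so it
  cannot leave the interior.\<close>

lemma dikin_ellipsoid:
  assumes x: "x \<in> interior \<K>" and u: "local_norm B x u < 1" and t: "0 \<le> t" "t \<le> 1"
  shows "x + t *\<^sub>R u \<in> interior \<K>"
proof (rule bounded_barrier_imp_interior[OF x t(1)])
  define r where "r = local_norm B x u"
  have r: "r = sqrt (u \<bullet> (H x *v u))" "0 \<le> r" "r < 1"
    using hessian_quadratic_nonneg[OF x, of u] u by (auto simp: r_def local_norm_def)
  fix s assume s: "0 \<le> s" "s \<le> t" and seg: "\<And>r. 0 \<le> r \<Longrightarrow> r \<le> s \<Longrightarrow> x + r *\<^sub>R u \<in> interior \<K>"
  have rs: "0 \<le> r * s" "r * s \<le> r" using r s t mult_left_mono[of s 1 r] by auto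
  have "B (x + s *\<^sub>R u) \<le> B x + (u \<bullet> gradient B x) * s + (r * s)\<^sup>2 / (2 * (1 - r * s))"
    using rs r(3) by (intro barrier_line_bound seg s r(1)) auto
  also have "\<dots> \<le> B x + \<bar>u \<bullet> gradient B x\<bar> * 1 + 1 / (2 * (1 - r))"
    using rs r(2,3) s t by (intro add_mono mult_mono frac_le power_le_one) auto
  finally show "B (x + s *\<^sub>R u) \<le> B x + \<bar>u \<bullet> gradient B x\<bar> * 1 + 1 / (2 * (1 - r))" .
qed

lemma barrier_upper_bound:
  assumes x: "x \<in> interior \<K>" and u: "local_norm B x u < 1"
  shows "B (x + u) \<le> B x + u \<bullet> gradient B x + (local_norm B x u)\<^sup>2 / (2 * (1 - local_norm B x u))"
  using barrier_line_bound[of 1 x u "local_norm B x u"] dikin_ellipsoid[OF x u] u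
  by (auto simp: local_norm_def)

text \<open>Along the segment the local length of \<open>u\<close> grows at most to
  \<open>r / (1 - r t)\<close>; inserted into \<open>third_bound\<close> this is the differential
  inequality for the quadratic form in the fixed vector \<open>v\<close>.\<close>

lemma hessian_lower_bound:
  assumes x: "x \<in> interior \<K>" and u: "local_norm B x u < 1"
  shows "(1 - local_norm B x u)\<^sup>2 * (v \<bullet> (H x *v v)) \<le> v \<bullet> (H (x + u) *v v)"
proof -
  define r where "r = local_norm B x u"
  have r: "r = sqrt (u \<bullet> (H x *v u))" "0 \<le> r" "r < 1"
    using hessian_quadratic_nonneg[OF x, of u] u by (auto simp: r_def local_norm_def)
  note seg = dikin_ellipsoid[OF x u]
  have "(1 - r)\<^sup>2 * (v \<bullet> (H (x + 0 *\<^sub>R u) *v v)) \<le> v \<bullet> (H (x + 1 *\<^sub>R u) *v v)"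
  proof (rule self_concordant_quadratic_form_lower_bound[where q' = "\<lambda>s. third (x + s *\<^sub>R u) u v v"])
    fix t :: real assume t: "0 \<le> t" "t \<le> 1"
    have rt: "r * t < 1" using r(2,3) t mult_left_mono[of t 1 r] by auto
    have "u \<bullet> (H (x + t *\<^sub>R u) *v u) \<le> (r / (1 - r * t))\<^sup>2"
      using t rt r by (intro hessian_line_bound seg) auto
    then have "sqrt (u \<bullet> (H (x + t *\<^sub>R u) *v u)) \<le> r / (1 - r * t)"
      using r rt by (intro real_le_lsqrt) auto
    then have "2 * sqrt (u \<bullet> (H (x + t *\<^sub>R u) *v u)) * (v \<bullet> (H (x + t *\<^sub>R u) *v v))
        \<le> 2 * (r / (1 - r * t)) * (v \<bullet> (H (x + t *\<^sub>R u) *v v))"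
      using hessian_quadratic_nonneg[OF seg[OF t]] by (intro mult_right_mono) auto
    then show "\<bar>third (x + t *\<^sub>R u) u v v\<bar> \<le> 2 * (r / (1 - r * t)) * (v \<bullet> (H (x + t *\<^sub>R u) *v v))"
      using third_bound[OF seg[OF t], of u v] by linarith
  qed (use hessian_line_deriv[OF seg] r in auto)
  then show ?thesis by (simp add: r_def)
qed

end

section \<open>Norms of positive definite matrices\<close>

definition pos_def_matrix :: "real^'n^'n \<Rightarrow> bool"
  where "pos_def_matrix M \<longleftrightarrow>
    (\<forall>u v. u \<bullet> (M *v v) = v \<bullet> (M *v u)) \<and> (\<forall>u. u \<noteq> 0 \<longrightarrow> 0 < u \<bullet> (M *v u))"

text \<open>Common form of the local norm (the Hessian) and the dual local norm (its inverse), so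
  that each norm property is proved once.\<close>

definition matrix_norm_of :: "real^'n^'n \<Rightarrow> real^'n \<Rightarrow> real"
  where "matrix_norm_of M v = sqrt (v \<bullet> (M *v v))"

lemma pos_def_matrix_nonneg: "pos_def_matrix M \<Longrightarrow> 0 \<le> v \<bullet> (M *v v)"
  by (cases "v = 0") (auto simp: pos_def_matrix_def less_imp_le)

lemma matrix_norm_of_square: "pos_def_matrix M \<Longrightarrow> (matrix_norm_of M v)\<^sup>2 = v \<bullet> (M *v v)"
  by (simp add: matrix_norm_of_def pos_def_matrix_nonneg)

lemma matrix_norm_of_nonneg [simp]: "pos_def_matrix M \<Longrightarrow> 0 \<le> matrix_norm_of M v"
  by (simp add: matrix_norm_of_def pos_def_matrix_nonneg)

lemma matrix_norm_of_scaleR: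
  "matrix_norm_of M (c *\<^sub>R v) = \<bar>c\<bar> * matrix_norm_of M v"
proof -
  have "(c *\<^sub>R v) \<bullet> (M *v (c *\<^sub>R v)) = c\<^sup>2 * (v \<bullet> (M *v v))"
    by (simp add: matrix_vector_mult_scaleR power2_eq_square)
  then show ?thesis by (simp add: matrix_norm_of_def real_sqrt_mult)
qed

lemma matrix_norm_of_minus: "matrix_norm_of M (- v) = matrix_norm_of M v"
  using matrix_norm_of_scaleR[of M "-1" v] by simp

lemma matrix_norm_of_Cauchy_Schwarz:
  assumes M: "pos_def_matrix M"
  shows "\<bar>u \<bullet> (M *v w)\<bar> \<le> matrix_norm_of M u * matrix_norm_of M w"
proof (cases "w = 0")
  case False
  define a b c where "a = u \<bullet> (M *v u)" and "b = u \<bullet> (M *v w)" and "c = w \<bullet> (M *v w)"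
  have c: "c > 0" using M False by (auto simp: c_def pos_def_matrix_def)
  have sym: "w \<bullet> (M *v u) = b" using M by (auto simp: b_def pos_def_matrix_def)
  \<comment> \<open>The minimizing multiple of \<open>w\<close> would be \<open>b / c\<close>;
    clearing the denominator leaves \<open>c (c a - b^2)\<close>.\<close>
  have "0 \<le> (c *\<^sub>R u - b *\<^sub>R w) \<bullet> (M *v (c *\<^sub>R u - b *\<^sub>R w))"
    by (rule pos_def_matrix_nonneg[OF M])
  also have "\<dots> = c * (c * a - b * b)"
    by (simp add: matrix_vector_mult_diff_distrib matrix_vector_mult_scaleR inner_diff_left
        inner_diff_right a_def[symmetric] b_def[symmetric] c_def[symmetric] sym algebra_simps)
  finally have "b\<^sup>2 \<le> a * c" using c by (simp add: zero_le_mult_iff power2_eq_square mult.commute)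
  then have "sqrt (b\<^sup>2) \<le> sqrt (a * c)" by (rule real_sqrt_le_mono)
  then show ?thesis by (simp add: matrix_norm_of_def a_def b_def c_def real_sqrt_mult)
qed (simp add: matrix_norm_of_def)

lemma matrix_norm_of_triangle:
  assumes M: "pos_def_matrix M"
  shows "matrix_norm_of M (u + w) \<le> matrix_norm_of M u + matrix_norm_of M w"
proof (rule power2_le_imp_le)
  have sym: "w \<bullet> (M *v u) = u \<bullet> (M *v w)" using M by (auto simp: pos_def_matrix_def)
  have "(matrix_norm_of M (u + w))\<^sup>2
      = (matrix_norm_of M u)\<^sup>2 + 2 * (u \<bullet> (M *v w)) + (matrix_norm_of M w)\<^sup>2"
    by (simp add: matrix_norm_of_square[OF M] matrix_vector_right_distrib inner_add_left inner_add_right sym)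
  also have "\<dots> \<le> (matrix_norm_of M u + matrix_norm_of M w)\<^sup>2"
    using matrix_norm_of_Cauchy_Schwarz[OF M, of u w] by (simp add: power2_sum)
  finally show "(matrix_norm_of M (u + w))\<^sup>2 \<le> (matrix_norm_of M u + matrix_norm_of M w)\<^sup>2" .
qed (use M in simp)

lemma pos_def_matrix_invertible:
  assumes "pos_def_matrix M"
  shows "invertible M"
proof -
  have "\<forall>x. M *v x = 0 \<longrightarrow> x = 0" using assms by (auto simp: pos_def_matrix_def)
  then show ?thesis using invertible_left_inverse matrix_left_invertible_ker by blast
qed

lemma matrix_inv_works:
  assumes "invertible (M :: real^'n^'n)"
  shows "M ** matrix_inv M = mat 1" "matrix_inv M ** M = mat 1"
    "M *v (matrix_inv M *v v) = v" "matrix_inv M *v (M *v v) = v"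
proof -
  show *: "M ** matrix_inv M = mat 1" "matrix_inv M ** M = mat 1"
    using someI_ex[of "\<lambda>A'. M ** A' = mat 1 \<and> A' ** M = mat 1"] assms
    unfolding invertible_def matrix_inv_def by auto
  then show "M *v (matrix_inv M *v v) = v" "matrix_inv M *v (M *v v) = v"
    by (simp_all add: matrix_vector_mul_assoc)
qed

lemma pos_def_matrix_inv:
  assumes M: "pos_def_matrix M"
  shows "pos_def_matrix (matrix_inv M)"
  unfolding pos_def_matrix_def
proof (intro conjI allI impI)
  note inv = matrix_inv_works[OF pos_def_matrix_invertible[OF M]]
  have eq: "u \<bullet> (matrix_inv M *v v) = (matrix_inv M *v v) \<bullet> (M *v (matrix_inv M *v u))" for u v
    by (simp add: inv inner_commute)
  show "u \<bullet> (matrix_inv M *v v) = v \<bullet> (matrix_inv M *v u)" for u v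
    unfolding eq[of u v] eq[of v u] using M by (auto simp: pos_def_matrix_def)
  show "0 < u \<bullet> (matrix_inv M *v u)" if "u \<noteq> 0" for u
  proof -
    have "matrix_inv M *v u \<noteq> 0" using that inv(3)[of u] by auto
    then show ?thesis unfolding eq using M by (auto simp: pos_def_matrix_def)
  qed
qed

lemma matrix_norm_of_inv_image:
  assumes M: "pos_def_matrix M"
  shows "matrix_norm_of M (matrix_inv M *v v) = matrix_norm_of (matrix_inv M) v"
  by (simp add: matrix_norm_of_def matrix_inv_works[OF pos_def_matrix_invertible[OF M]] inner_commute)

lemma matrix_norm_of_dual_Cauchy_Schwarz:
  assumes M: "pos_def_matrix M"
  shows "\<bar>v \<bullet> w\<bar> \<le> matrix_norm_of (matrix_inv M) v * matrix_norm_of M w"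
proof -
  have "v \<bullet> w = w \<bullet> (M *v (matrix_inv M *v v))"
    by (simp add: matrix_inv_works[OF pos_def_matrix_invertible[OF M]] inner_commute)
  then show ?thesis
    using matrix_norm_of_Cauchy_Schwarz[OF M, of w "matrix_inv M *v v"] matrix_norm_of_inv_image[OF M]
    by (simp add: mult.commute)
qed

text \<open>Inversion reverses the order of quadratic forms. Duality replaces matrix square roots:
  with \<open>w = matrix_inv M' *v v\<close>, the square of the left side is
  \<open>v \<bullet> w\<close>, at most the product of the dual \<open>M\<close>-norm of
  \<open>v\<close> and the \<open>M\<close>-norm of \<open>w\<close>, and the latter is at most the
  left side divided by \<open>c\<close>. One factor cancels.\<close>

lemma matrix_norm_of_inv_mono:
  assumes M: "pos_def_matrix M" "pos_def_matrix M'" and c: "0 < c"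
    and le: "\<And>v. c\<^sup>2 * (v \<bullet> (M *v v)) \<le> v \<bullet> (M' *v v)"
  shows "matrix_norm_of (matrix_inv M') v \<le> matrix_norm_of (matrix_inv M) v / c"
proof -
  let ?w = "matrix_inv M' *v v"
  let ?n = "matrix_norm_of (matrix_inv M') v" and ?m = "matrix_norm_of (matrix_inv M) v"
  have pd: "pos_def_matrix (matrix_inv M)" "pos_def_matrix (matrix_inv M')"
    using M pos_def_matrix_inv by auto
  have w: "matrix_norm_of M' ?w = ?n" by (rule matrix_norm_of_inv_image[OF M(2)])
  have "(c * matrix_norm_of M ?w)\<^sup>2 \<le> (matrix_norm_of M' ?w)\<^sup>2"
    using le[of ?w] M by (simp add: power_mult_distrib matrix_norm_of_square)
  then have cw: "c * matrix_norm_of M ?w \<le> ?n"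
    unfolding w by (rule power2_le_imp_le) (use pd in simp)
  have "c * ?n\<^sup>2 = c * (v \<bullet> ?w)" using pd by (simp add: matrix_norm_of_square)
  also have "\<dots> \<le> c * (?m * matrix_norm_of M ?w)"
    using matrix_norm_of_dual_Cauchy_Schwarz[OF M(1), of v ?w] c by (intro mult_left_mono) auto
  also have "\<dots> \<le> ?m * ?n" using mult_left_mono[OF cw, of ?m] pd by (simp add: mult.left_commute)
  finally have "?n * (c * ?n) \<le> ?n * ?m" by (simp add: power2_eq_square mult.commute mult.left_commute)
  moreover have "0 \<le> ?n" "0 \<le> ?m" using pd by auto
  ultimately have "c * ?n \<le> ?m" using c by (cases "?n = 0") auto
  then show ?thesis using c by (simp add: pos_le_divide_eq mult.commute)
qed

lemma inner_transpose_mult: "u \<bullet> (transpose A *v w) = (A *v u) \<bullet> w" for A :: "real^'n^'m"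
  by (metis dot_lmul_matrix inner_commute transpose_matrix_vector)

text \<open>Full row rank makes \<open>transpose A\<close> injective. With the inverse Hessian for
  \<open>M\<close> this yields invertibility of the matrix in the multiplier formula.\<close>

lemma pos_def_matrix_congruence:
  fixes A :: "real^'n^'m"
  assumes M: "pos_def_matrix M" and A: "rank A = CARD('m)"
  shows "pos_def_matrix (A ** M ** transpose A)"
proof -
  have "inj ((*v) (transpose A))"
    using A full_rank_injective[of "transpose A"] by (simp add: rank_transpose)
  then have inj: "transpose A *v u \<noteq> 0" if "u \<noteq> 0" for u
    using that matrix_vector_mult_0_right[of "transpose A"] by (metis injD)
  have eq: "u \<bullet> ((A ** M ** transpose A) *v v) = (transpose A *v u) \<bullet> (M *v (transpose A *v v))" for u v
    using inner_transpose_mult[of "M *v (transpose A *v v)" A u]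
    by (simp only: matrix_vector_mul_assoc[symmetric] inner_commute)
  show ?thesis unfolding pos_def_matrix_def eq using M inj by (auto simp: pos_def_matrix_def simp del: transpose_matrix_vector)
qed

section \<open>Measurability of matrix operations\<close>

lemma borel_measurable_axis: "(axis i :: 'a::euclidean_space \<Rightarrow> 'a^'n) \<in> borel_measurable borel"
proof (intro borel_measurable_continuous_onI linear_continuous_on linear_conv_bounded_linear[THEN iffD1])
  show "linear (axis i :: 'a \<Rightarrow> 'a^'n)"
    by (auto simp: linear_iff axis_def vec_eq_iff)
qed

lemma borel_measurable_vecI:
  fixes f :: "'b \<Rightarrow> ('a::euclidean_space)^'n"
  assumes "\<And>i. (\<lambda>x. f x $ i) \<in> borel_measurable M"
  shows "f \<in> borel_measurable M"
proof -
  have "(\<lambda>x. \<Sum>i\<in>UNIV. axis i (f x $ i)) \<in> borel_measurable M"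
    by (intro borel_measurable_sum measurable_compose[OF assms borel_measurable_axis])
  also have "(\<lambda>x. \<Sum>i\<in>UNIV. axis i (f x $ i)) = f"
    by (auto simp: fun_eq_iff vec_eq_iff axis_def if_distrib if_distribR cong: if_cong)
  finally show ?thesis .
qed

lemma borel_measurable_vec_nth:
  fixes f :: "'b \<Rightarrow> ('a::euclidean_space)^'n"
  assumes "f \<in> borel_measurable M"
  shows "(\<lambda>x. f x $ i) \<in> borel_measurable M"
  by (intro measurable_compose[OF assms] borel_measurable_continuous_onI
      linear_continuous_on bounded_linear_vec_nth)

lemma borel_measurable_matrix_nth:
  fixes f :: "'b \<Rightarrow> real^'n^'m"
  assumes "f \<in> borel_measurable M"
  shows "(\<lambda>x. f x $ i $ j) \<in> borel_measurable M"
  by (intro borel_measurable_vec_nth assms)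

lemma borel_measurable_matrix_vector_mult:
  fixes f :: "'b \<Rightarrow> real^'n^'m"
  assumes "f \<in> borel_measurable M" "g \<in> borel_measurable M"
  shows "(\<lambda>x. f x *v g x) \<in> borel_measurable M"
  by (intro borel_measurable_vecI, unfold matrix_vector_mult_def)
    (simp, intro borel_measurable_sum borel_measurable_times borel_measurable_vec_nth assms)

lemma borel_measurable_matrix_matrix_mult:
  fixes f :: "'b \<Rightarrow> real^'n^'m" and g :: "'b \<Rightarrow> real^'k^'n"
  assumes "f \<in> borel_measurable M" "g \<in> borel_measurable M"
  shows "(\<lambda>x. f x ** g x) \<in> borel_measurable M"
  by (intro borel_measurable_vecI, unfold matrix_matrix_mult_def)
    (simp, intro borel_measurable_sum borel_measurable_times borel_measurable_vec_nth assms)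

lemma borel_measurable_det:
  fixes f :: "'b \<Rightarrow> real^'n^'n"
  assumes "\<And>i j. (\<lambda>x. f x $ i $ j) \<in> borel_measurable M"
  shows "(\<lambda>x. det (f x)) \<in> borel_measurable M"
  unfolding det_def
  by (intro borel_measurable_sum borel_measurable_times borel_measurable_prod borel_measurable_const assms)

text \<open>Cramer's rule for the right-hand side \<open>axis j 1\<close>. It exhibits the entries
  of the inverse as quotients of determinants, hence as measurable functions of the entries.\<close>

lemma matrix_inv_component:
  fixes M :: "real^'n^'n"
  assumes "det M \<noteq> 0"
  shows "matrix_inv M $ i $ j = det (\<chi> a b. if b = i then (if a = j then 1 else 0) else M $ a $ b) / det M"
proof -
  have inv: "invertible M" using assms by (simp add: invertible_det_nz)
  have "M *v (matrix_inv M *v axis j 1) = axis j 1" by (rule matrix_inv_works(3)[OF inv])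
  then have "matrix_inv M *v axis j 1 = (\<chi> k. det (\<chi> a b. if b = k then axis j 1 $ a else M $ a $ b) / det M)"
    using cramer[OF assms] by blast
  then have "(matrix_inv M *v axis j 1) $ i = det (\<chi> a b. if b = i then axis j 1 $ a else M $ a $ b) / det M"
    by simp
  moreover have "(matrix_inv M *v axis j 1) $ i = matrix_inv M $ i $ j"
    by (simp add: matrix_vector_mult_basis column_def)
  moreover have "axis j (1::real) $ a = (if a = j then 1 else 0)" for a by (simp add: axis_def)
  ultimately show ?thesis by (simp cong: if_cong)
qed

lemma borel_measurable_matrix_inv:
  fixes f :: "'b \<Rightarrow> real^'n^'n"
  assumes f: "f \<in> borel_measurable M"
  shows "(\<lambda>x. matrix_inv (f x)) \<in> borel_measurable M"
proof (intro borel_measurable_vecI)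
  fix i j
  \<comment> \<open>The value of \<open>matrix_inv\<close> at a singular matrix: the predicate under
    the choice operator is then identically false, so all singular matrices share this one
    unspecified value.\<close>
  define c where "c = (SOME A' :: real^'n^'n. False)"
  have nth: "(\<lambda>x. f x $ i $ j) \<in> borel_measurable M" for i j
    by (rule borel_measurable_matrix_nth[OF f])
  have "(\<lambda>x. if det (f x) \<noteq> 0
      then det (\<chi> a b. if b = i then (if a = j then 1 else 0) else f x $ a $ b) / det (f x)
      else c $ i $ j) \<in> borel_measurable M"
  proof (intro measurable_If borel_measurable_divide borel_measurable_det borel_measurable_const)
    show "(\<lambda>x. (\<chi> a b. if b = i then (if a = j then 1 else 0) else f x $ a $ b) $ a $ b) \<in> borel_measurable M" for a b
      using nth by simp
    have "(\<lambda>x. det (f x)) \<in> borel_measurable M" by (rule borel_measurable_det[OF nth])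
    then show "{x \<in> space M. det (f x) \<noteq> 0} \<in> sets M" by measurable
  qed (rule nth)
  also have "(\<lambda>x. if det (f x) \<noteq> 0
      then det (\<chi> a b. if b = i then (if a = j then 1 else 0) else f x $ a $ b) / det (f x)
      else c $ i $ j) = (\<lambda>x. matrix_inv (f x) $ i $ j)"
  proof
    fix x
    have "matrix_inv (f x) = c" if "det (f x) = 0"
    proof -
      have "(\<lambda>A'. f x ** A' = mat 1 \<and> A' ** f x = mat 1) = (\<lambda>A'. False)"
        using that invertible_det_nz[of "f x"] by (auto simp: invertible_def)
      then show ?thesis unfolding matrix_inv_def c_def by simp
    qed
    then show "(if det (f x) \<noteq> 0
      then det (\<chi> a b. if b = i then (if a = j then 1 else 0) else f x $ a $ b) / det (f x)
      else c $ i $ j) = matrix_inv (f x) $ i $ j"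
      using matrix_inv_component[of "f x" i j] by simp
  qed
  finally show "(\<lambda>x. matrix_inv (f x) $ i $ j) \<in> borel_measurable M" .
qed

section \<open>Descent along a normalized step\<close>

definition lagrange_multiplier ::
    "real^'n^'m \<Rightarrow> (real^'n \<Rightarrow> real) \<Rightarrow> real^'n \<Rightarrow> real^'n \<Rightarrow> real^'m"
  where "lagrange_multiplier A B z g =
    - (matrix_inv (A ** matrix_inv (hessian B z) ** transpose A) *v (A *v (matrix_inv (hessian B z) *v g)))"

definition projected_vector ::
    "real^'n^'m \<Rightarrow> (real^'n \<Rightarrow> real) \<Rightarrow> real^'n \<Rightarrow> real^'n \<Rightarrow> real^'n"
  where "projected_vector A B z g = g + transpose A *v lagrange_multiplier A B z g"

text \<open>Total in both arguments: where the projected vector vanishes, division by zero gives 0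
  and the step stays at \<open>z\<close>.\<close>

definition normalized_step ::
    "real^'n^'m \<Rightarrow> (real^'n \<Rightarrow> real) \<Rightarrow> real \<Rightarrow> real^'n \<Rightarrow> real^'n \<Rightarrow> real^'n"
  where "normalized_step A B h z g =
    z - (h / dual_local_norm B z (projected_vector A B z g)) *\<^sub>R
      (matrix_inv (hessian B z) *v projected_vector A B z g)"

context sc_barrier_cone
begin

lemma hessian_pos_def_matrix: "x \<in> interior \<K> \<Longrightarrow> pos_def_matrix (H x)"
  using hessian_symmetric hessian_pos_def by (auto simp: pos_def_matrix_def)

lemma inv_hessian_pos_def_matrix: "x \<in> interior \<K> \<Longrightarrow> pos_def_matrix (matrix_inv (H x))"
  by (intro pos_def_matrix_inv hessian_pos_def_matrix)

lemma local_norm_eq: "local_norm B x = matrix_norm_of (H x)"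
  by (simp add: fun_eq_iff local_norm_def matrix_norm_of_def)

lemma dual_local_norm_eq: "dual_local_norm B x = matrix_norm_of (matrix_inv (H x))"
  by (simp add: fun_eq_iff dual_local_norm_def matrix_norm_of_def)

lemma local_norm_nonneg [simp]: "x \<in> interior \<K> \<Longrightarrow> 0 \<le> local_norm B x v"
  by (simp add: local_norm_eq hessian_pos_def_matrix)

lemma dual_local_norm_nonneg [simp]: "x \<in> interior \<K> \<Longrightarrow> 0 \<le> dual_local_norm B x v"
  by (simp add: dual_local_norm_eq inv_hessian_pos_def_matrix)

lemma dual_local_norm_triangle:
  "x \<in> interior \<K> \<Longrightarrow> dual_local_norm B x (u + v) \<le> dual_local_norm B x u + dual_local_norm B x v"
  by (simp add: dual_local_norm_eq inv_hessian_pos_def_matrix matrix_norm_of_triangle)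

lemma dual_local_norm_scaleR: "dual_local_norm B x (c *\<^sub>R v) = \<bar>c\<bar> * dual_local_norm B x v"
  by (simp add: dual_local_norm_eq matrix_norm_of_scaleR)

lemma local_norm_scaleR: "local_norm B x (c *\<^sub>R v) = \<bar>c\<bar> * local_norm B x v"
  by (simp add: local_norm_eq matrix_norm_of_scaleR)

lemma dual_local_norm_Cauchy_Schwarz:
  "x \<in> interior \<K> \<Longrightarrow> \<bar>v \<bullet> w\<bar> \<le> dual_local_norm B x v * local_norm B x w"
  by (simp add: dual_local_norm_eq local_norm_eq hessian_pos_def_matrix matrix_norm_of_dual_Cauchy_Schwarz)

text \<open>The Hessian comparison, reversed by inversion. Only a bound \<open>r\<close> on the
  displacement is required, so along the random run the factor can be taken deterministic.\<close>

lemma dual_local_norm_transfer: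
  assumes x: "x \<in> interior \<K>" and y: "local_norm B x (y - x) \<le> r" "r < 1"
  shows "dual_local_norm B y v \<le> dual_local_norm B x v / (1 - r)"
proof -
  let ?r = "local_norm B x (y - x)"
  have yI: "y \<in> interior \<K>" using dikin_ellipsoid[OF x, of "y - x" 1] y by auto
  have "dual_local_norm B y v \<le> dual_local_norm B x v / (1 - ?r)"
    unfolding dual_local_norm_eq
    using hessian_lower_bound[OF x, of "y - x"] y x yI
    by (intro matrix_norm_of_inv_mono hessian_pos_def_matrix) auto
  also have "\<dots> \<le> dual_local_norm B x v / (1 - r)"
    using x y by (intro divide_left_mono mult_pos_pos) auto
  finally show ?thesis .
qed

end

locale sipm = sc_barrier_cone \<K> \<theta> B
  for \<K> :: "(real^'n) set" and \<theta> :: real and B :: "real^'n \<Rightarrow> real" +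
  fixes A :: "real^'n^'m" and b :: "real^'m" and f :: "real^'n \<Rightarrow> real"
    and \<phi>\<^sub>l\<^sub>o\<^sub>w s L\<^sub>1 :: real and \<Omega>\<^sub>o :: "(real^'n) set"
  assumes full_row_rank: "rank A = CARD('m)"
    and feasible: "\<Omega>\<^sub>o = strictly_feasible_set A b \<K>"
    and f_C1: "C1_on_within (feasible_set A b \<K>) \<K> f"
    and s: "0 < s" "s < 1"
    and lower_bound: "\<And>z t. z \<in> \<Omega>\<^sub>o \<Longrightarrow> 0 < t \<Longrightarrow> t \<le> 1 \<Longrightarrow> \<phi>\<^sub>l\<^sub>o\<^sub>w \<le> f z + t * B z"
    and L\<^sub>1: "0 < L\<^sub>1" "\<And>z y. z \<in> \<Omega>\<^sub>o \<Longrightarrow> y \<in> \<Omega>\<^sub>o \<Longrightarrow> local_norm B z (y - z) \<le> s \<Longrightarrow>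
         dual_local_norm B z (gradient f y - gradient f z) \<le> L\<^sub>1 * local_norm B z (y - z)"
begin

lemma feasible_interior: "z \<in> \<Omega>\<^sub>o \<Longrightarrow> z \<in> interior \<K>"
  by (simp add: feasible strictly_feasible_set_def)

lemma feasible_closed_set: "z \<in> \<Omega>\<^sub>o \<Longrightarrow> z \<in> feasible_set A b \<K>"
  using interior_subset by (auto simp: feasible strictly_feasible_set_def feasible_set_def)

text \<open>At interior points the derivative within the cone is the ordinary one, so the continuous
  witness in \<open>C1_on_within\<close> agrees there with \<open>gradient f\<close>.\<close>

lemma objective_GDERIV: "z \<in> \<Omega>\<^sub>o \<Longrightarrow> GDERIV f z :> gradient f z"
  and continuous_on_gradient: "continuous_on \<Omega>\<^sub>o (gradient f)"
proof -
  obtain g where g: "\<And>x. x \<in> feasible_set A b \<K> \<Longrightarrow> (f has_derivative (\<lambda>h. h \<bullet> g x)) (at x within \<K>)"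
    "continuous_on (feasible_set A b \<K>) g"
    using f_C1 by (auto simp: C1_on_within_def)
  have D: "GDERIV f z :> g z" if "z \<in> \<Omega>\<^sub>o" for z
    using g(1)[OF feasible_closed_set[OF that]] at_within_interior[OF feasible_interior[OF that]]
    by (simp add: gderiv_def)
  then have eq: "gradient f z = g z" if "z \<in> \<Omega>\<^sub>o" for z using gradient_eqI that by blast
  show "z \<in> \<Omega>\<^sub>o \<Longrightarrow> GDERIV f z :> gradient f z" using D eq by simp
  have "continuous_on \<Omega>\<^sub>o g"
    using g(2) feasible_closed_set by (meson continuous_on_subset subsetI)
  then show "continuous_on \<Omega>\<^sub>o (gradient f)" using eq by (simp cong: continuous_on_cong)
qed

text \<open>The usual descent lemma with the norm frozen at \<open>x\<close>. The Dikin ellipsoid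
  keeps the segment feasible, and monotonicity of the gap \<open>\<psi>\<close> between quadratic
  model and objective replaces integration of the gradient.\<close>

lemma objective_upper_bound:
  assumes x: "x \<in> \<Omega>\<^sub>o" and y: "y \<in> \<Omega>\<^sub>o" and r: "local_norm B x (y - x) \<le> s"
  shows "f y \<le> f x + (y - x) \<bullet> gradient f x + L\<^sub>1 / 2 * (local_norm B x (y - x))\<^sup>2"
proof -
  define p where "p = y - x"
  define r where "r = local_norm B x p"
  have xI: "x \<in> interior \<K>" by (rule feasible_interior[OF x])
  have r0: "0 \<le> r" "r \<le> s" using xI assms(3) by (auto simp: r_def p_def)
  have seg: "x + t *\<^sub>R p \<in> \<Omega>\<^sub>o" if t: "0 \<le> t" "t \<le> 1" for t
  proof -
    have "A *v p = 0" using x y by (simp add: p_def feasible strictly_feasible_set_def matrix_vector_mult_diff_distrib)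
    then have "A *v (x + t *\<^sub>R p) = b"
      using x by (simp add: feasible strictly_feasible_set_def matrix_vector_right_distrib matrix_vector_mult_scaleR)
    moreover have "x + t *\<^sub>R p \<in> interior \<K>"
      using r0 s by (intro dikin_ellipsoid[OF xI _ t]) (simp add: r_def)
    ultimately show ?thesis by (simp add: feasible strictly_feasible_set_def)
  qed
  define \<psi> where "\<psi> t = t * (p \<bullet> gradient f x) + L\<^sub>1 / 2 * r\<^sup>2 * t\<^sup>2 - f (x + t *\<^sub>R p)" for t
  have "\<exists>y. (\<psi> has_real_derivative y) (at t) \<and> y \<ge> 0" if t: "0 \<le> t" "t \<le> 1" for t
  proof (intro exI conjI)
    have "((\<lambda>t. f (x + t *\<^sub>R p)) has_real_derivative p \<bullet> gradient f (x + t *\<^sub>R p)) (at t)"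
      unfolding has_field_derivative_def
      by (rule has_derivative_eq_rhs, rule has_derivative_compose[OF line_has_derivative
            objective_GDERIV[OF seg[OF t], unfolded gderiv_def]])
        (use feasible_interior[OF seg[OF t]] in auto)
    then show "(\<psi> has_real_derivative p \<bullet> gradient f x + L\<^sub>1 * r\<^sup>2 * t - p \<bullet> gradient f (x + t *\<^sub>R p)) (at t)"
      unfolding \<psi>_def by (auto intro!: derivative_eq_intros)
    have tr: "local_norm B x ((x + t *\<^sub>R p) - x) = t * r"
      using t by (simp add: local_norm_scaleR r_def)
    have "t * r \<le> s" using t r0 mult_right_mono[of t 1 r] by simp
    then have *: "dual_local_norm B x (gradient f (x + t *\<^sub>R p) - gradient f x) \<le> L\<^sub>1 * (t * r)"
      using L\<^sub>1(2)[OF x seg[OF t]] tr by simp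
    have "(gradient f (x + t *\<^sub>R p) - gradient f x) \<bullet> p
        \<le> dual_local_norm B x (gradient f (x + t *\<^sub>R p) - gradient f x) * r"
      using dual_local_norm_Cauchy_Schwarz[OF xI] unfolding r_def by (rule order_trans[OF abs_ge_self])
    also have "\<dots> \<le> L\<^sub>1 * (t * r) * r" using * r0 by (intro mult_right_mono)
    finally show "0 \<le> p \<bullet> gradient f x + L\<^sub>1 * r\<^sup>2 * t - p \<bullet> gradient f (x + t *\<^sub>R p)"
      by (simp add: inner_diff_right inner_commute power2_eq_square mult.commute mult.left_commute)
  qed
  then have "\<psi> 0 \<le> \<psi> 1" by (intro DERIV_nonneg_imp_nondecreasing[of 0 1 \<psi>]) auto
  then show ?thesis by (simp add: \<psi>_def p_def r_def)
qed

lemma gradient_barrier_fun: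
  assumes "z \<in> \<Omega>\<^sub>o"
  shows "gradient (barrier_fun f B \<mu>) z = gradient f z + \<mu> *\<^sub>R (gradient f z + gradient B z)"
proof (rule gradient_eqI)
  have "(f has_derivative (\<lambda>h. h \<bullet> gradient f z)) (at z)" "(B has_derivative (\<lambda>h. h \<bullet> gradient B z)) (at z)"
    using objective_GDERIV[OF assms] barrier_GDERIV[OF feasible_interior[OF assms]] by (auto simp: gderiv_def)
  then show "GDERIV (barrier_fun f B \<mu>) z :> gradient f z + \<mu> *\<^sub>R (gradient f z + gradient B z)"
    unfolding gderiv_def barrier_fun_def
    by (auto intro!: derivative_eq_intros simp: inner_add_right)
qed

text \<open>The multiplier is the solution of \<open>A H (g + A^T \<lambda>) = 0\<close>, with
  \<open>H\<close> here the inverse Hessian; hence steps preserve the equality constraints.\<close>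

lemma A_projected_vector:
  assumes "z \<in> interior \<K>"
  shows "A *v (matrix_inv (H z) *v projected_vector A B z g) = 0"
proof -
  let ?Hi = "matrix_inv (H z)"
  let ?M = "A ** ?Hi ** transpose A"
  have inv: "invertible ?M"
    by (intro pos_def_matrix_invertible pos_def_matrix_congruence inv_hessian_pos_def_matrix assms full_row_rank)
  have "A *v (?Hi *v (transpose A *v lagrange_multiplier A B z g)) = ?M *v lagrange_multiplier A B z g"
    by (simp only: matrix_vector_mul_assoc matrix_mul_assoc)
  also have "\<dots> = - (A *v (?Hi *v g))"
    unfolding lagrange_multiplier_def vec.neg matrix_inv_works(3)[OF inv] ..
  finally show ?thesis
    by (simp add: projected_vector_def matrix_vector_right_distrib del: transpose_matrix_vector)
qed

text \<open>The inverse Hessian is an isometry from the dual to the local norm, so normalization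
  gives local length \<open>h\<close> (or 0), and \<open>h < 1\<close> keeps the step inside the
  Dikin ellipsoid.\<close>

lemma normalized_step_feasible:
  assumes z: "z \<in> \<Omega>\<^sub>o" and h: "0 \<le> h" "h \<le> s"
  shows "normalized_step A B h z g \<in> \<Omega>\<^sub>o"
    and "local_norm B z (normalized_step A B h z g - z) \<le> h"
proof -
  let ?d = "projected_vector A B z g"
  have zI: "z \<in> interior \<K>" by (rule feasible_interior[OF z])
  define p where "p = normalized_step A B h z g - z"
  have p: "p = - (h / dual_local_norm B z ?d) *\<^sub>R (matrix_inv (H z) *v ?d)"
    by (simp add: p_def normalized_step_def)
  have "local_norm B z p = \<bar>h / dual_local_norm B z ?d\<bar> * dual_local_norm B z ?d"
    unfolding p local_norm_scaleR abs_minus_cancel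
    using matrix_norm_of_inv_image[OF hessian_pos_def_matrix[OF zI]]
    by (simp add: local_norm_eq dual_local_norm_eq)
  also have "\<dots> \<le> h" using h zI by (simp add: abs_divide)
  finally show le: "local_norm B z (normalized_step A B h z g - z) \<le> h" by (simp add: p_def)
  then have "z + 1 *\<^sub>R p \<in> interior \<K>"
    using h s by (intro dikin_ellipsoid[OF zI]) (auto simp: p_def)
  moreover have "A *v p = 0"
    unfolding p by (simp add: matrix_vector_mult_scaleR vec.neg A_projected_vector[OF zI])
  moreover have "normalized_step A B h z g = z + p" by (simp add: p_def)
  ultimately show "normalized_step A B h z g \<in> \<Omega>\<^sub>o"
    using z by (simp add: feasible strictly_feasible_set_def matrix_vector_right_distrib)
qed

text \<open>The factor 4 is twice 2. The search vector differs from the true gradient by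
  \<open>(1 + \<mu>)\<close> times the estimator error, at most \<open>2 e\<close> in dual norm;
  this is paid once in the linear term along the step and once when the norm \<open>D\<close> of the
  projected vector is replaced by \<open>R\<close>. The constraint \<open>A p = 0\<close> removes
  the multiplier from the linear term.\<close>

lemma normalized_step_descent:
  fixes mb g z :: "real^'n" and \<mu> h :: real
  defines "y \<equiv> normalized_step A B h z g"
    and "R \<equiv> dual_local_norm B z (gradient (barrier_fun f B \<mu>) z + transpose A *v lagrange_multiplier A B z g)"
    and "e \<equiv> dual_local_norm B z (mb - gradient f z)"
  assumes z: "z \<in> \<Omega>\<^sub>o" and h: "0 \<le> h" "h \<le> s" and \<mu>: "0 < \<mu>" "\<mu> \<le> 1"
    and g: "g = mb + \<mu> *\<^sub>R (mb + gradient B z)"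
  shows "barrier_fun f B \<mu> y \<le> barrier_fun f B \<mu> z - h * R + 4 * h * e + (2 * L\<^sub>1 + 1 / (1 - s)) / 2 * h\<^sup>2"
proof -
  let ?d = "projected_vector A B z g"
  have zI: "z \<in> interior \<K>" by (rule feasible_interior[OF z])
  have yo: "y \<in> \<Omega>\<^sub>o" and r: "local_norm B z (y - z) \<le> h"
    unfolding y_def by (rule normalized_step_feasible[OF z h])+
  define p where "p = y - z"
  define r where "r = local_norm B z p"
  define D where "D = dual_local_norm B z ?d"
  define q where "q = gradient (barrier_fun f B \<mu>) z - g"
  have r0: "0 \<le> r" "r \<le> h" using zI r by (auto simp: r_def p_def)
  have rh2: "r\<^sup>2 \<le> h\<^sup>2" using r0 by (intro power_mono)
  have p: "p = - (h / D) *\<^sub>R (matrix_inv (H z) *v ?d)"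
    by (simp add: p_def y_def normalized_step_def D_def)
  have D0: "0 \<le> D" using zI by (simp add: D_def)
  have e0: "0 \<le> e" using zI by (simp add: e_def)
  have q: "q = (1 + \<mu>) *\<^sub>R - (mb - gradient f z)"
    unfolding q_def gradient_barrier_fun[OF z] g by (simp add: algebra_simps)
  have "dual_local_norm B z q = (1 + \<mu>) * e"
    unfolding q dual_local_norm_scaleR e_def
    using \<mu> matrix_norm_of_minus[of "matrix_inv (H z)" "mb - gradient f z"]
    by (simp add: dual_local_norm_eq)
  also have "\<dots> \<le> 2 * e" using \<mu> e0 by (intro mult_right_mono) auto
  finally have qe: "dual_local_norm B z q \<le> 2 * e" .
  have Ap: "A *v p = 0" using z yo by (simp add: p_def feasible strictly_feasible_set_def matrix_vector_mult_diff_distrib)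
  have dp: "?d \<bullet> p = - h * D"
  proof -
    have "?d \<bullet> (matrix_inv (H z) *v ?d) = D * D"
      using matrix_norm_of_square[OF inv_hessian_pos_def_matrix[OF zI]]
      by (simp add: D_def dual_local_norm_eq power2_eq_square)
    then show ?thesis unfolding p by (cases "D = 0") auto
  qed
  have gp: "g \<bullet> p = - h * D"
  proof -
    have "?d \<bullet> p = g \<bullet> p + (A *v p) \<bullet> lagrange_multiplier A B z g"
      unfolding projected_vector_def inner_add_left
      using inner_transpose_mult[of p A] by (metis inner_commute)
    then show ?thesis using Ap dp by simp
  qed
  have qp: "q \<bullet> p \<le> 2 * e * h"
  proof -
    have "q \<bullet> p \<le> dual_local_norm B z q * r"
      using dual_local_norm_Cauchy_Schwarz[OF zI] unfolding r_def by (rule order_trans[OF abs_ge_self])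
    also have "\<dots> \<le> 2 * e * h" using qe r0 e0 by (intro mult_mono) auto
    finally show ?thesis .
  qed
  have "R \<le> D + 2 * e"
  proof -
    have "gradient (barrier_fun f B \<mu>) z + transpose A *v lagrange_multiplier A B z g = ?d + q"
      by (simp add: projected_vector_def q_def)
    then show ?thesis
      unfolding R_def D_def using dual_local_norm_triangle[OF zI, of ?d q] qe by simp
  qed
  then have RD: "- (h * D) \<le> - (h * R) + h * (2 * e)"
    using mult_left_mono[of R "D + 2 * e" h] h by (simp add: algebra_simps)
  have f_le: "f y \<le> f z + p \<bullet> gradient f z + L\<^sub>1 / 2 * h\<^sup>2"
  proof -
    have "L\<^sub>1 / 2 * r\<^sup>2 \<le> L\<^sub>1 / 2 * h\<^sup>2" using rh2 L\<^sub>1(1) by (intro mult_left_mono) auto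
    then show ?thesis using objective_upper_bound[OF z yo] r h by (simp add: p_def r_def)
  qed
  have B_le: "B y \<le> B z + p \<bullet> gradient B z + (1 / (1 - s)) / 2 * h\<^sup>2"
  proof -
    have "r\<^sup>2 / (2 * (1 - r)) \<le> h\<^sup>2 / (2 * (1 - s))"
      using rh2 r0 h s by (intro frac_le) auto
    moreover have "B (z + p) \<le> B z + p \<bullet> gradient B z + r\<^sup>2 / (2 * (1 - r))"
      unfolding r_def using r0 h s by (intro barrier_upper_bound[OF zI]) (auto simp: r_def)
    moreover have "B (z + p) = B y" by (simp add: p_def)
    moreover have "(1 / (1 - s)) / 2 * h\<^sup>2 = h\<^sup>2 / (2 * (1 - s))"
      by (simp only: divide_divide_eq_left times_divide_eq_left times_divide_eq_right mult_1 mult_1_right mult.commute)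
    ultimately show ?thesis by linarith
  qed
  have "barrier_fun f B \<mu> y \<le> barrier_fun f B \<mu> z + gradient (barrier_fun f B \<mu>) z \<bullet> p
      + ((1 + \<mu>) * L\<^sub>1 + \<mu> * (1 / (1 - s))) / 2 * h\<^sup>2"
  proof -
    have "(1 + \<mu>) * f y \<le> (1 + \<mu>) * (f z + p \<bullet> gradient f z + L\<^sub>1 / 2 * h\<^sup>2)"
      using f_le \<mu> by (intro mult_left_mono) auto
    moreover have "\<mu> * B y \<le> \<mu> * (B z + p \<bullet> gradient B z + (1 / (1 - s)) / 2 * h\<^sup>2)"
      using B_le \<mu> by (intro mult_left_mono) auto
    ultimately show ?thesis
      unfolding gradient_barrier_fun[OF z] barrier_fun_def
      by (simp add: algebra_simps inner_add_left inner_add_right inner_commute add_divide_distrib)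
  qed
  also have "gradient (barrier_fun f B \<mu>) z \<bullet> p = q \<bullet> p - h * D"
    using gp by (simp add: q_def inner_diff_left)
  also have "((1 + \<mu>) * L\<^sub>1 + \<mu> * (1 / (1 - s))) / 2 * h\<^sup>2 \<le> (2 * L\<^sub>1 + 1 / (1 - s)) / 2 * h\<^sup>2"
  proof -
    have "(1 + \<mu>) * L\<^sub>1 \<le> 2 * L\<^sub>1" using \<mu> L\<^sub>1(1) by (intro mult_right_mono) auto
    moreover have "\<mu> * (1 / (1 - s)) \<le> 1 * (1 / (1 - s))" using \<mu> s by (intro mult_right_mono) auto
    ultimately show ?thesis by (intro mult_right_mono divide_right_mono) auto
  qed
  finally show ?thesis using RD qp by (simp add: algebra_simps)
qed

section \<open>A nonnegative merit function\<close>

definition merit :: "real \<Rightarrow> real^'n \<Rightarrow> real"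
  where "merit \<mu> z = barrier_fun f B \<mu> z - (1 + \<mu>) * min \<phi>\<^sub>l\<^sub>o\<^sub>w 0"

text \<open>The barrier function is \<open>1 + \<mu>\<close> times \<open>f + t B\<close> with
  \<open>t = \<mu> / (1 + \<mu>)\<close>, a parameter in the range of the lower bound.\<close>

lemma merit_nonneg:
  assumes z: "z \<in> \<Omega>\<^sub>o" and \<mu>: "0 < \<mu>" "\<mu> \<le> 1"
  shows "0 \<le> merit \<mu> z"
proof -
  have "\<phi>\<^sub>l\<^sub>o\<^sub>w \<le> f z + \<mu> / (1 + \<mu>) * B z" using \<mu> by (intro lower_bound z) auto
  then have "(1 + \<mu>) * min \<phi>\<^sub>l\<^sub>o\<^sub>w 0 \<le> (1 + \<mu>) * (f z + \<mu> / (1 + \<mu>) * B z)"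
    using \<mu> by (intro mult_left_mono) auto
  also have "\<dots> = barrier_fun f B \<mu> z" using \<mu> by (simp add: barrier_fun_def field_simps)
  finally show ?thesis by (simp add: merit_def)
qed

text \<open>The merit is affine in \<open>\<mu>\<close> with slope
  \<open>f + B - min \<phi>\<^sub>l\<^sub>o\<^sub>w 0\<close>, nonnegative by the lower bound at
  parameter 1. This makes decreasing barrier parameters harmless when descent inequalities are
  summed.\<close>

lemma merit_mono:
  assumes z: "z \<in> \<Omega>\<^sub>o" and \<mu>: "\<mu>' \<le> \<mu>"
  shows "merit \<mu>' z \<le> merit \<mu> z"
proof -
  have "0 \<le> f z + B z - min \<phi>\<^sub>l\<^sub>o\<^sub>w 0" using lower_bound[OF z, of 1] by simp
  then have "\<mu>' * (f z + B z - min \<phi>\<^sub>l\<^sub>o\<^sub>w 0) \<le> \<mu> * (f z + B z - min \<phi>\<^sub>l\<^sub>o\<^sub>w 0)"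
    using \<mu> by (intro mult_right_mono)
  then show ?thesis by (simp add: merit_def barrier_fun_def algebra_simps)
qed

lemma merit_1_le_potential_gap: "merit 1 z \<le> potential_gap f B \<phi>\<^sub>l\<^sub>o\<^sub>w z"
  by (simp add: merit_def barrier_fun_def potential_gap_def)

end

section \<open>Summation of the descent inequalities\<close>

text \<open>All step parameters are integer powers of this quantity, so the summation arguments
  become polynomial algebra in it.\<close>

definition cbrt_index :: "nat \<Rightarrow> real"
  where "cbrt_index k = (real k + 1) powr (1/3)"

lemma cbrt_index_ge_1: "1 \<le> cbrt_index k"
  by (simp add: cbrt_index_def ge_one_powr_ge_zero)

lemma cbrt_index_pos: "0 < cbrt_index k"
  using cbrt_index_ge_1[of k] by linarith

lemma cbrt_index_cube: "cbrt_index k ^ 3 = real k + 1"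
  by (simp add: cbrt_index_def powr_power)

lemma cbrt_index_square: "(real k + 1) powr (2/3) = (cbrt_index k)\<^sup>2"
  by (simp add: cbrt_index_def powr_power)

lemma cbrt_index_mono: "j \<le> k \<Longrightarrow> cbrt_index j \<le> cbrt_index k"
  by (simp add: cbrt_index_def powr_mono2)

text \<open>The tangent bound for the concave cube root, checked by cubing: the terms dropped from
  \<open>(w + d)^3\<close> are nonnegative.\<close>

lemma cbrt_index_Suc_le: "cbrt_index (Suc k) \<le> cbrt_index k + 1 / (3 * (cbrt_index k)\<^sup>2)"
proof (rule power_le_imp_le_base[of _ 2])
  let ?w = "cbrt_index k"
  have w: "?w > 0" by (rule cbrt_index_pos)
  let ?d = "1 / (3 * ?w\<^sup>2)"
  have "cbrt_index (Suc k) ^ Suc 2 = ?w ^ 3 + 1"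
    using cbrt_index_cube[of "Suc k"] cbrt_index_cube[of k] by (simp add: numeral_3_eq_3 numeral_2_eq_2)
  also have "1 = 3 * ?w\<^sup>2 * ?d" using w by simp
  also have "?w ^ 3 + 3 * ?w\<^sup>2 * ?d \<le> ?w ^ 3 + 3 * ?w\<^sup>2 * ?d + (3 * ?w * ?d\<^sup>2 + ?d ^ 3)"
    using w by simp
  also have "\<dots> = (?w + ?d) ^ 3" by (simp only: power2_eq_square power3_eq_cube) algebra
  finally show "cbrt_index (Suc k) ^ Suc 2 \<le> (?w + ?d) ^ Suc 2" by (simp add: numeral_3_eq_3 numeral_2_eq_2)
  show "0 \<le> ?w + ?d" using w by simp
qed

lemma cbrt_index_Suc_le_double: "cbrt_index (Suc k) \<le> 2 * cbrt_index k"
proof -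
  have "1 \<le> (cbrt_index k)\<^sup>2" using cbrt_index_ge_1[of k] by (rule one_le_power)
  then have "1 / (3 * (cbrt_index k)\<^sup>2) \<le> 1" by (simp add: divide_le_eq)
  then show ?thesis using cbrt_index_Suc_le[of k] cbrt_index_ge_1[of k] by linarith
qed

text \<open>The integral test for the exponent 4/3 in telescoping form: with \<open>w\<close> and
  \<open>v\<close> at consecutive indices, \<open>v^3 - w^3 = 1\<close> gives
  \<open>1 / v^4 \<le> 3 / w - 3 / v\<close>.\<close>

lemma sum_inverse_cbrt_index_pow4:
  "(\<Sum>k<Suc n. 1 / cbrt_index k ^ 4) \<le> 4 - 3 / cbrt_index n"
proof (induction n)
  case 0
  show ?case by (simp add: cbrt_index_def)
next
  case (Suc n)
  let ?w = "cbrt_index n" and ?v = "cbrt_index (Suc n)"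
  have w: "0 < ?w" "0 < ?v" "?w \<le> ?v" by (auto simp: cbrt_index_pos cbrt_index_mono)
  have "1 = (?v - ?w) * (?v\<^sup>2 + ?v * ?w + ?w\<^sup>2)"
  proof -
    have "(?v - ?w) * (?v\<^sup>2 + ?v * ?w + ?w\<^sup>2) = ?v ^ 3 - ?w ^ 3"
      by (simp add: power2_eq_square power3_eq_cube algebra_simps)
    then show ?thesis by (simp add: cbrt_index_cube)
  qed
  also have "\<dots> \<le> (?v - ?w) * (3 * ?v\<^sup>2)"
  proof (rule mult_left_mono)
    have "?v * ?w \<le> ?v * ?v" "?w * ?w \<le> ?v * ?v" using w by (auto intro!: mult_mono)
    then show "?v\<^sup>2 + ?v * ?w + ?w\<^sup>2 \<le> 3 * ?v\<^sup>2" by (simp add: power2_eq_square)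
  qed (use w in simp)
  finally have "1 / (?v ^ 3 * ?w) \<le> ((?v - ?w) * (3 * ?v\<^sup>2)) / (?v ^ 3 * ?w)"
    using w by (intro divide_right_mono) auto
  also have "\<dots> = 3 / ?w - 3 / ?v"
    using w by (simp add: field_simps power2_eq_square power3_eq_cube)
  finally have "1 / (?v ^ 3 * ?w) \<le> 3 / ?w - 3 / ?v" .
  moreover have "1 / ?v ^ 4 \<le> 1 / (?v ^ 3 * ?w)"
  proof (rule divide_left_mono)
    have "?v ^ 4 = ?v ^ 3 * ?v" by (simp add: power3_eq_cube power4_eq_xxxx)
    then show "?v ^ 3 * ?w \<le> ?v ^ 4" using w by simp
  qed (use w in auto)
  ultimately show ?case using Suc by simp
qed

lemma sum_inverse_le_ln: "(\<Sum>k<Suc n. 1 / (real k + 1)) \<le> 1 + ln (real (Suc n))"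
proof (induction n)
  case (Suc n)
  let ?a = "real (Suc n)"
  have "ln (?a / (?a + 1)) \<le> ?a / (?a + 1) - 1" by (rule ln_le_minus_one) simp
  then have "1 / (?a + 1) \<le> ln (?a + 1) - ln ?a"
    by (simp add: ln_div field_simps)
  then show ?case using Suc by (simp add: algebra_simps)
qed simp

lemma ln_ge_1: "3 \<le> x \<Longrightarrow> 1 \<le> ln x" for x :: real
proof -
  assume "3 \<le> x"
  then have "exp 1 \<le> x" using exp_le by linarith
  then show ?thesis using ln_ge_iff[of x 1] \<open>3 \<le> x\<close> by simp
qed

text \<open>The Young weight \<open>q k\<close> is what the potential leaves over. With
  \<open>w\<close> for \<open>cbrt_index k\<close>, contraction removes about
  \<open>(1 - s / 3) / w\<close> from the weight \<open>w\<close> of \<open>V k\<close>, while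
  growth of the weight returns at most \<open>1 / (3 w)\<close>; the difference is
  \<open>(2 - s) / (3 w)\<close>. The Young remainder is then of order
  \<open>1 / w^3 = 1 / (k + 1)\<close>, whence the logarithm.\<close>

lemma weighted_descent_sum_bound:
  fixes R \<Phi> V :: "nat \<Rightarrow> real"
  assumes s: "0 < s" "s < 1" and C: "0 \<le> C" and l: "0 \<le> l"
    and h: "\<And>k. h k = s / (3 * (cbrt_index k)\<^sup>2)" and \<gamma>: "\<And>k. \<gamma> k = 1 / (cbrt_index k)\<^sup>2"
    and q: "\<And>k. q k = (2 - s) / (3 * cbrt_index k)"
    and \<Phi>: "\<And>k. 0 \<le> \<Phi> k" and V: "\<And>k. 0 \<le> V k"
    and descent: "\<And>k. h k * R k \<le> \<Phi> k - \<Phi> (Suc k) + q k * V k + 4 * (h k)\<^sup>2 / q k + l / 2 * (h k)\<^sup>2"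
    and contraction: "\<And>k. V (Suc k) \<le> (1 - \<gamma> k * (1 - s / 3)) * V k + C * (\<gamma> k)\<^sup>2"
    and K: "3 \<le> K"
  shows "(\<Sum>k<K. h k * R k)
    \<le> (\<Phi> 0 + V 0 + 2 * s\<^sup>2 * l / 9 + 4 * (4 * s\<^sup>2 / (3 * (3 - s)) + C)) * ln (real K)"
proof -
  let ?w = cbrt_index
  \<comment> \<open>Coefficient of \<open>1 / (k + 1)\<close>: the Young remainder, plus the fresh
    variance, doubled because it is weighted by the index \<open>k + 1\<close> instead of
    \<open>k\<close>.\<close>
  define a where "a = 4 * s\<^sup>2 / (3 * (2 - s)) + 2 * C"
  define \<Psi> where "\<Psi> k = \<Phi> k + ?w k * V k" for k
  have a0: "0 \<le> a" using s C by (auto simp: a_def)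
  have step: "h k * R k \<le> \<Psi> k - \<Psi> (Suc k) + (l * s\<^sup>2 / 18) * (1 / ?w k ^ 4) + a * (1 / (real k + 1))" for k
  proof -
    let ?v = "?w (Suc k)" and ?u = "?w k"
    have u: "0 < ?u" "1 \<le> ?u" "?u \<le> ?v" "0 < ?v"
      by (auto simp: cbrt_index_pos cbrt_index_ge_1 cbrt_index_mono)
    have u2: "1 \<le> ?u\<^sup>2" using u(2) by (rule one_le_power)
    have \<gamma>0: "0 < \<gamma> k" "\<gamma> k \<le> 1" unfolding \<gamma> using u u2 by (auto simp: divide_le_eq)
    have 1: "?v * (1 - \<gamma> k * (1 - s / 3)) + q k \<le> ?u"
    proof -
      have "?v \<le> ?u + \<gamma> k / 3" using cbrt_index_Suc_le[of k] by (simp add: \<gamma>)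
      moreover have "?u * (\<gamma> k * (1 - s / 3)) \<le> ?v * (\<gamma> k * (1 - s / 3))"
        using u s \<gamma>0 by (intro mult_right_mono) auto
      moreover have "\<gamma> k / 3 \<le> ?u * \<gamma> k / 3" using u \<gamma>0 by simp
      moreover have "q k = ?u * \<gamma> k * (2 - s) / 3"
        using u by (simp add: q \<gamma> power2_eq_square)
      ultimately show ?thesis by (simp add: algebra_simps add_divide_distrib diff_divide_distrib)
    qed
    have 2: "4 * (h k)\<^sup>2 / q k = 4 * s\<^sup>2 / (3 * (2 - s)) * (1 / (real k + 1))"
    proof -
      have "4 * (h k)\<^sup>2 / q k = 4 * s\<^sup>2 / (3 * (2 - s)) * (1 / ?u ^ 3)"
        using u s by (simp add: h q field_simps power2_eq_square power3_eq_cube)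
      then show ?thesis by (simp add: cbrt_index_cube)
    qed
    have 3: "?v * (C * (\<gamma> k)\<^sup>2) \<le> 2 * C * (1 / (real k + 1))"
    proof -
      have "?v * (C * (\<gamma> k)\<^sup>2) \<le> (2 * ?u) * (C * (\<gamma> k)\<^sup>2)"
        using cbrt_index_Suc_le_double[of k] C by (intro mult_right_mono) auto
      also have "\<dots> = 2 * C * (1 / ?u ^ 3)"
        using u by (simp add: \<gamma> field_simps power2_eq_square power3_eq_cube)
      finally show ?thesis by (simp add: cbrt_index_cube)
    qed
    have 4: "l / 2 * (h k)\<^sup>2 = (l * s\<^sup>2 / 18) * (1 / ?u ^ 4)"
      using u by (simp add: h field_simps power2_eq_square power4_eq_xxxx)
    have "?v * V (Suc k) \<le> ?v * ((1 - \<gamma> k * (1 - s / 3)) * V k + C * (\<gamma> k)\<^sup>2)"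
      using contraction u by (intro mult_left_mono) auto
    also have "\<dots> = (?v * (1 - \<gamma> k * (1 - s / 3))) * V k + ?v * (C * (\<gamma> k)\<^sup>2)"
      by (simp add: algebra_simps)
    also have "\<dots> \<le> (?u - q k) * V k + 2 * C * (1 / (real k + 1))"
      using 1 V[of k] 3 by (intro add_mono mult_right_mono) auto
    finally show ?thesis
      using descent[of k] unfolding 2 4 \<Psi>_def a_def by (simp add: algebra_simps)
  qed
  obtain n where n: "K = Suc n" using K by (cases K) auto
  \<comment> \<open>From \<open>K \<ge> 3\<close> one has \<open>ln K \<ge> 1\<close>, so bounded
    terms can be multiplied by the logarithm and \<open>1 + ln K\<close> replaced by
    \<open>2 ln K\<close>.\<close>
  have lnK: "1 \<le> ln (real K)" using K by (intro ln_ge_1) auto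
  let ?X = "\<Sum>k<K. 1 / ?w k ^ 4" and ?Y = "\<Sum>k<K. 1 / (real k + 1)"
  have "(\<Sum>k<K. h k * R k) \<le> (\<Sum>k<K. \<Psi> k - \<Psi> (Suc k)) + (l * s\<^sup>2 / 18) * ?X + a * ?Y"
    using sum_mono[of "{..<K}", OF step] by (simp only: sum.distrib sum_distrib_left)
  moreover have "(\<Sum>k<K. \<Psi> k - \<Psi> (Suc k)) \<le> \<Phi> 0 + V 0"
  proof -
    have "0 \<le> \<Psi> K" using \<Phi> V cbrt_index_pos[of K] by (simp add: \<Psi>_def)
    then have "\<Psi> 0 - \<Psi> K \<le> \<Phi> 0 + V 0" by (simp add: \<Psi>_def cbrt_index_def)
    then show ?thesis by (simp only: sum_lessThan_telescope')
  qed
  \<comment> \<open>The total weight is at most 4, and \<open>4 / 18\<close> is the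
    \<open>2 / 9\<close> of the final constant.\<close>
  moreover have "(l * s\<^sup>2 / 18) * ?X \<le> (l * s\<^sup>2 / 18) * 4"
    using sum_inverse_cbrt_index_pow4[of n] cbrt_index_pos[of n] l unfolding n
    by (intro mult_left_mono) (smt (verit) divide_pos_pos, simp)
  moreover have "a * ?Y \<le> a * (2 * ln (real K))"
    using sum_inverse_le_ln[of n] lnK a0 unfolding n by (intro mult_left_mono) linarith+
  ultimately have "(\<Sum>k<K. h k * R k) \<le> (\<Phi> 0 + V 0 + 2 * s\<^sup>2 * l / 9) + 2 * a * ln (real K)"
    by (simp add: mult.commute mult.left_commute)
  also have "\<dots> \<le> (\<Phi> 0 + V 0 + 2 * s\<^sup>2 * l / 9) * ln (real K)
      + 4 * (4 * s\<^sup>2 / (3 * (3 - s)) + C) * ln (real K)"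
  proof (rule add_mono)
    have "0 \<le> \<Phi> 0 + V 0 + 2 * s\<^sup>2 * l / 9" using \<Phi>[of 0] V[of 0] l by simp
    from mult_left_mono[OF lnK this]
    show "\<Phi> 0 + V 0 + 2 * s\<^sup>2 * l / 9 \<le> (\<Phi> 0 + V 0 + 2 * s\<^sup>2 * l / 9) * ln (real K)" by simp
    \<comment> \<open>Passage to the denominator \<open>3 - s\<close> of the announced constant:
      \<open>2 / (2 - s) \<le> 4 / (3 - s)\<close> amounts to \<open>s \<le> 1\<close>.\<close>
    have "4 * s\<^sup>2 * 2 / (3 * (2 - s)) \<le> 4 * s\<^sup>2 * 4 / (3 * (3 - s))"
    proof -
      have "2 / (2 - s) \<le> 4 / (3 - s)" using s by (simp add: field_simps)
      then have "4 * s\<^sup>2 / 3 * (2 / (2 - s)) \<le> 4 * s\<^sup>2 / 3 * (4 / (3 - s))"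
        by (intro mult_left_mono) auto
      then show ?thesis by simp
    qed
    then have "2 * a \<le> 4 * (4 * s\<^sup>2 / (3 * (3 - s)) + C)" by (simp add: a_def)
    then show "2 * a * ln (real K) \<le> 4 * (4 * s\<^sup>2 / (3 * (3 - s)) + C) * ln (real K)"
      using lnK by (intro mult_right_mono) auto
  qed
  finally show ?thesis by (simp add: algebra_simps)
qed

text \<open>On the window the step sizes are at least \<open>s / (3 K^(2/3))\<close>, and the window
  has at least \<open>K / 2\<close> elements. The factors 3 and 2 account for the 6 in the
  constant.\<close>

lemma tail_average_bound:
  fixes R :: "nat \<Rightarrow> real"
  assumes s: "0 < s" and h: "\<And>k. h k = s / (3 * (cbrt_index k)\<^sup>2)" and R: "\<And>k. 0 \<le> R k"
    and sum: "(\<Sum>k<K. h k * R k) \<le> s * M / 6 * ln (real K)"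
    and K: "1 \<le> K"
  shows "(\<Sum>k\<in>{K div 2..K - 1}. R k) / real (card {K div 2..K - 1}) \<le> M * ln (real K) / real K powr (1/3)"
proof -
  let ?I = "{K div 2..K - 1}"
  define y where "y = real K powr (1/3)"
  have y: "y > 0" "y ^ 3 = real K" using K by (auto simp: y_def powr_power)
  have y_eq: "cbrt_index (K - 1) = y" using K by (simp add: y_def cbrt_index_def of_nat_diff)
  have "s / (3 * y\<^sup>2) * (\<Sum>k\<in>?I. R k) \<le> (\<Sum>k\<in>?I. h k * R k)"
    unfolding sum_distrib_left
  proof (rule sum_mono)
    fix k assume "k \<in> ?I"
    then have "cbrt_index k \<le> y" unfolding y_eq[symmetric] by (intro cbrt_index_mono) auto
    then have "(cbrt_index k)\<^sup>2 \<le> y\<^sup>2" using cbrt_index_pos[of k] by (intro power_mono) auto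
    then have "s / (3 * y\<^sup>2) \<le> h k"
      unfolding h using s y cbrt_index_pos[of k] by (intro divide_left_mono) auto
    then show "s / (3 * y\<^sup>2) * R k \<le> h k * R k" using R by (intro mult_right_mono)
  qed
  also have "\<dots> \<le> (\<Sum>k<K. h k * R k)"
    using K R s by (intro sum_mono2) (auto simp: h)
  also note sum
  finally have le: "s / (3 * y\<^sup>2) * (\<Sum>k\<in>?I. R k) \<le> s * M / 6 * ln (real K)" .
  have div: "S \<le> X / c" if "c * S \<le> X" "0 < c" for c S X :: real
    using that by (simp add: pos_le_divide_eq mult.commute)
  have "(\<Sum>k\<in>?I. R k) \<le> (s * M / 6 * ln (real K)) / (s / (3 * y\<^sup>2))"
    using s y by (intro div[OF le]) simp
  also have "\<dots> = M * ln (real K) * y\<^sup>2 / 2" using s y by (simp add: field_simps)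
  finally have S: "(\<Sum>k\<in>?I. R k) \<le> M * ln (real K) * y\<^sup>2 / 2" .
  have "real K \<le> 2 * real (card ?I)" using K by (simp add: of_nat_diff)
  then have c: "real K / 2 \<le> real (card ?I)" by simp
  have "(\<Sum>k\<in>?I. R k) / real (card ?I) \<le> (\<Sum>k\<in>?I. R k) / (real K / 2)"
    using K R c by (intro divide_left_mono sum_nonneg mult_pos_pos) auto
  also have "\<dots> \<le> (M * ln (real K) * y\<^sup>2 / 2) / (real K / 2)"
    using S K by (intro divide_right_mono) auto
  also have "\<dots> = M * ln (real K) / y"
    unfolding y(2)[symmetric] using y(1) by (simp add: power2_eq_square power3_eq_cube)
  finally show ?thesis by (simp add: y_def)
qed

text \<open>From \<open>ln (y / 2a) \<le> y / 2a - 1\<close> one gets \<open>a ln y \<le> y / 2 + a ln (2a)\<close>.\<close>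
lemma mult_ln_le:
  assumes a: "0 < a" and y: "0 < y" "2 * a * ln (2 * a) \<le> y"
  shows "a * ln y \<le> (y::real)"
proof -
  have "ln (y / (2 * a)) \<le> y / (2 * a) - 1" using a y by (intro ln_le_minus_one) auto
  then have "ln y \<le> ln (2 * a) + y / (2 * a) - 1" using a y by (simp add: ln_div)
  then have "a * ln y \<le> a * (ln (2 * a) + y / (2 * a) - 1)" using a by (intro mult_left_mono) auto
  also have "\<dots> = a * ln (2 * a) + y / 2 - a" using a by (simp add: field_simps)
  also have "\<dots> \<le> y" using a y by simp
  finally show ?thesis .
qed

text \<open>In terms of \<open>y = K^(1/3)\<close> the logarithm is \<open>3 ln y\<close>, so the
  claim reads \<open>a ln y \<le> y\<close> with \<open>a = 3 M c\<close>. The sufficient condition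
  \<open>2 a ln (2 a) \<le> y\<close> explains both the 6 and the cube in the threshold.\<close>

lemma iteration_threshold:
  assumes c: "0 < c" and M: "0 < M" and K: "1 \<le> K" and thr: "(6 * M * c * ln (6 * M * c)) ^ 3 \<le> K"
  shows "M * ln K / K powr (1/3) \<le> 1 / (c::real)"
proof -
  define y where "y = K powr (1/3)"
  have y: "y > 0" "y ^ 3 = K" using K by (auto simp: y_def powr_power)
  have lnK: "ln K = 3 * ln y" using K by (simp add: y_def ln_powr)
  have "6 * M * c * ln (6 * M * c) \<le> y"
    using thr y power_le_imp_le_base[of "6 * M * c * ln (6 * M * c)" 2 y] by (simp add: numeral_3_eq_3 numeral_2_eq_2)
  then have "(3 * M * c) * ln y \<le> y"
    using c M y by (intro mult_ln_le) (auto simp: mult.assoc)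
  then have "c * (M * ln K) \<le> y" unfolding lnK by (simp add: algebra_simps)
  then show ?thesis using c y unfolding y_def[symmetric] by (simp add: field_simps)
qed

section \<open>The stochastic process\<close>

lemma borel_measurable_matrix_norm_of:
  assumes "f \<in> borel_measurable M" "g \<in> borel_measurable M"
  shows "(\<lambda>x. matrix_norm_of (f x) (g x)) \<in> borel_measurable M"
  unfolding matrix_norm_of_def
  by (intro measurable_compose[OF _ borel_measurable_sqrt] borel_measurable_inner borel_measurable_matrix_vector_mult assms)

lemma power2_sum3_le: "(a + b + c)\<^sup>2 \<le> 3 * (a\<^sup>2 + b\<^sup>2 + c\<^sup>2)" for a b c :: real
proof -
  have "3 * (a\<^sup>2 + b\<^sup>2 + c\<^sup>2) - (a + b + c)\<^sup>2 = (a - b)\<^sup>2 + (b - c)\<^sup>2 + (a - c)\<^sup>2"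
    by (simp add: power2_eq_square algebra_simps)
  then show ?thesis by (smt (verit) zero_le_power2)
qed

locale stochastic_sipm = sipm \<K> \<theta> B A b f \<phi>\<^sub>l\<^sub>o\<^sub>w s L\<^sub>1 \<Omega>\<^sub>o + prob_space \<Xi>
  for \<K> :: "(real^'n) set" and \<theta> :: real and B :: "real^'n \<Rightarrow> real"
    and A :: "real^'n^'m" and b :: "real^'m" and f :: "real^'n \<Rightarrow> real"
    and \<phi>\<^sub>l\<^sub>o\<^sub>w s L\<^sub>1 :: real and \<Omega>\<^sub>o :: "(real^'n) set" and \<Xi> :: "'s measure" +
  fixes G :: "real^'n \<Rightarrow> 's \<Rightarrow> real^'n" and \<sigma> L :: real
  assumes G_measurable: "(\<lambda>(z, w). G z w) \<in> borel_measurable (restrict_space borel \<Omega>\<^sub>o \<Otimes>\<^sub>M \<Xi>)"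
    and G_integrable: "\<And>z. z \<in> \<Omega>\<^sub>o \<Longrightarrow> integrable \<Xi> (G z)"
    and G_unbiased: "\<And>z. z \<in> \<Omega>\<^sub>o \<Longrightarrow> (\<integral>w. G z w \<partial>\<Xi>) = gradient f z"
    and G_variance: "\<And>z. z \<in> \<Omega>\<^sub>o \<Longrightarrow>
      integrable \<Xi> (\<lambda>w. (dual_local_norm B z (G z w - gradient f z))\<^sup>2)"
      "\<And>z. z \<in> \<Omega>\<^sub>o \<Longrightarrow> (\<integral>w. (dual_local_norm B z (G z w - gradient f z))\<^sup>2 \<partial>\<Xi>) \<le> \<sigma>\<^sup>2"
    and G_Lipschitz: "\<And>z y. z \<in> \<Omega>\<^sub>o \<Longrightarrow> y \<in> \<Omega>\<^sub>o \<Longrightarrow> local_norm B z (y - z) \<le> s \<Longrightarrow>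
         integrable \<Xi> (\<lambda>w. (dual_local_norm B z (G y w - G z w))\<^sup>2)"
      "\<And>z y. z \<in> \<Omega>\<^sub>o \<Longrightarrow> y \<in> \<Omega>\<^sub>o \<Longrightarrow> local_norm B z (y - z) \<le> s \<Longrightarrow>
         (\<integral>w. (dual_local_norm B z (G y w - G z w))\<^sup>2 \<partial>\<Xi>) \<le> L\<^sup>2 * (local_norm B z (y - z))\<^sup>2"
begin

text \<open>
  The error of the momentum estimator splits into a part that does not depend on the new sample
  and a part with mean zero, which are orthogonal in expectation.
\<close>
lemma momentum_estimator_variance:
  fixes z y g :: "real^'n" and \<gamma> h :: real
  defines "E \<equiv> \<lambda>w. G y w + (1 - \<gamma>) *\<^sub>R (g - G z w) - gradient f y"
    and "bound \<equiv> ((1 - \<gamma>) / (1 - h))\<^sup>2 * (dual_local_norm B z (g - gradient f z))\<^sup>2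
      + 3 * (\<gamma>\<^sup>2 * \<sigma>\<^sup>2 + (L\<^sup>2 + L\<^sub>1\<^sup>2) * (h / (1 - h))\<^sup>2)"
  assumes z: "z \<in> \<Omega>\<^sub>o" and y: "y \<in> \<Omega>\<^sub>o" and zy: "local_norm B z (y - z) \<le> h" and h: "h \<le> s"
    and \<gamma>: "0 \<le> \<gamma>" "\<gamma> \<le> 1"
  shows "integrable \<Xi> (\<lambda>w. (dual_local_norm B y (E w))\<^sup>2)"
    and "(\<integral>w. (dual_local_norm B y (E w))\<^sup>2 \<partial>\<Xi>) \<le> bound"
proof -
  note zI = feasible_interior[OF z] and yI = feasible_interior[OF y]
  define Q where "Q = matrix_inv (H y)"
  have pd: "pos_def_matrix Q" unfolding Q_def by (rule inv_hessian_pos_def_matrix[OF yI])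
  let ?n = "matrix_norm_of Q"
  have n: "dual_local_norm B y = ?n" by (simp add: dual_local_norm_eq Q_def)
  have r0: "0 \<le> local_norm B z (y - z)" using zI by simp
  then have h01: "0 \<le> h" "h < 1" "local_norm B z (y - z) \<le> s" using zy h s by linarith+
  define c where "c = 1 / (1 - h)"
  have c: "0 < c" using h01 by (simp add: c_def)
  have transfer: "?n v \<le> c * dual_local_norm B z v" for v
    using dual_local_norm_transfer[OF zI zy h01(2), of v] by (simp add: n c_def)
  have transfer2: "(?n v)\<^sup>2 \<le> c\<^sup>2 * (dual_local_norm B z v)\<^sup>2" for v
    using power_mono[OF transfer[of v], of 2] pd by (simp add: power_mult_distrib)
  \<comment> \<open>The old error \<open>a\<close> is damped and does not involve the new sample.
    \<open>U\<close> is fresh noise of size \<open>\<gamma>\<close>, \<open>W\<close> compares the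
    two points under one sample, and \<open>d\<close> is the negative of the mean of
    \<open>W\<close>, so \<open>U + W + d\<close> is centred.\<close>
  define a where "a = (1 - \<gamma>) *\<^sub>R (g - gradient f z)"
  define U where "U w = \<gamma> *\<^sub>R (G y w - gradient f y)" for w
  define W where "W w = (1 - \<gamma>) *\<^sub>R (G y w - G z w)" for w
  define d where "d = (1 - \<gamma>) *\<^sub>R (gradient f z - gradient f y)"
  define N where "N w = U w + W w + d" for w
  have E: "E w = a + N w" for w
    by (simp add: E_def a_def N_def U_def W_def d_def algebra_simps)
  have intU: "integrable \<Xi> U" and intW: "integrable \<Xi> W"
    unfolding U_def W_def using G_integrable z y by (auto intro!: integrable_scaleR_right Bochner_Integration.integrable_diff)
  then have intN: "integrable \<Xi> N" unfolding N_def by auto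
  have meanN: "(\<integral>w. N w \<partial>\<Xi>) = 0"
  proof -
    have "(\<integral>w. N w \<partial>\<Xi>) = (\<integral>w. U w \<partial>\<Xi>) + (\<integral>w. W w \<partial>\<Xi>) + d"
      unfolding N_def using intU intW by (simp add: prob_space)
    also have "(\<integral>w. U w \<partial>\<Xi>) = 0"
      unfolding U_def using G_integrable[OF y] G_unbiased[OF y] by (simp add: prob_space)
    also have "(\<integral>w. W w \<partial>\<Xi>) = - d"
      unfolding W_def d_def using G_integrable G_unbiased z y by (simp add: scaleR_diff_right)
    finally show ?thesis by simp
  qed
  have N_meas: "N \<in> borel_measurable \<Xi>" using intN by auto
  have meas: "(\<lambda>w. (?n (N w))\<^sup>2) \<in> borel_measurable \<Xi>"
    by (intro borel_measurable_power borel_measurable_matrix_norm_of N_meas) simp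
  \<comment> \<open>An integrable majorant of the squared noise: 3 from splitting into three
    summands, \<open>c^2\<close> from moving the norm from \<open>z\<close> to
    \<open>y\<close>.\<close>
  define T where "T w = 3 * (\<gamma>\<^sup>2 * (dual_local_norm B y (G y w - gradient f y))\<^sup>2
      + c\<^sup>2 * (dual_local_norm B z (G y w - G z w))\<^sup>2
      + c\<^sup>2 * (dual_local_norm B z (gradient f y - gradient f z))\<^sup>2)" for w
  have NT: "(?n (N w))\<^sup>2 \<le> T w" for w
  proof -
    have "?n (N w) \<le> ?n (U w) + ?n (W w) + ?n d"
      unfolding N_def using matrix_norm_of_triangle[OF pd, of "U w + W w" d]
        matrix_norm_of_triangle[OF pd, of "U w" "W w"] by linarith
    then have "(?n (N w))\<^sup>2 \<le> (?n (U w) + ?n (W w) + ?n d)\<^sup>2"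
      using pd by (intro power_mono) auto
    also have "\<dots> \<le> 3 * ((?n (U w))\<^sup>2 + (?n (W w))\<^sup>2 + (?n d)\<^sup>2)" by (rule power2_sum3_le)
    also have "\<dots> \<le> T w"
    proof -
      have shrink: "(1 - \<gamma>)\<^sup>2 * t \<le> t" if "0 \<le> t" for t
        using that \<gamma> mult_right_mono[of "(1 - \<gamma>)\<^sup>2" 1 t] by (simp add: power_le_one)
      have "(?n (W w))\<^sup>2 \<le> (?n (G y w - G z w))\<^sup>2"
        unfolding W_def matrix_norm_of_scaleR power_mult_distrib power2_abs by (rule shrink) simp
      moreover have "(?n d)\<^sup>2 \<le> (?n (gradient f y - gradient f z))\<^sup>2"
      proof -
        have "?n (gradient f z - gradient f y) = ?n (gradient f y - gradient f z)"
          using matrix_norm_of_minus[of Q "gradient f y - gradient f z"] by simp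
        then show ?thesis
          unfolding d_def matrix_norm_of_scaleR power_mult_distrib power2_abs by (simp add: shrink)
      qed
      moreover have "(?n (U w))\<^sup>2 = \<gamma>\<^sup>2 * (dual_local_norm B y (G y w - gradient f y))\<^sup>2"
        unfolding U_def matrix_norm_of_scaleR power_mult_distrib power2_abs n ..
      ultimately show ?thesis
        unfolding T_def using transfer2[of "G y w - G z w"] transfer2[of "gradient f y - gradient f z"]
        by (intro mult_left_mono add_mono) auto
    qed
    finally show ?thesis .
  qed
  have intT: "integrable \<Xi> T"
    unfolding T_def using G_variance(1)[OF y] G_Lipschitz(1)[OF z y h01(3)] by auto
  have intN2: "integrable \<Xi> (\<lambda>w. (?n (N w))\<^sup>2)"
    by (rule Bochner_Integration.integrable_bound[OF intT meas]) (use NT in \<open>auto intro: order_trans[OF _ abs_ge_self]\<close>)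
  have "(\<integral>w. (?n (N w))\<^sup>2 \<partial>\<Xi>) \<le> (\<integral>w. T w \<partial>\<Xi>)"
    by (rule integral_mono[OF intN2 intT NT])
  also have "\<dots> = 3 * (\<gamma>\<^sup>2 * (\<integral>w. (dual_local_norm B y (G y w - gradient f y))\<^sup>2 \<partial>\<Xi>)
      + c\<^sup>2 * (\<integral>w. (dual_local_norm B z (G y w - G z w))\<^sup>2 \<partial>\<Xi>)
      + c\<^sup>2 * (dual_local_norm B z (gradient f y - gradient f z))\<^sup>2)"
    unfolding T_def using G_variance(1)[OF y] G_Lipschitz(1)[OF z y h01(3)] by (simp add: prob_space)
  also have "\<dots> \<le> 3 * (\<gamma>\<^sup>2 * \<sigma>\<^sup>2 + c\<^sup>2 * (L\<^sup>2 * h\<^sup>2) + c\<^sup>2 * (L\<^sub>1\<^sup>2 * h\<^sup>2))"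
  proof (intro mult_left_mono add_mono)
    have r2: "(local_norm B z (y - z))\<^sup>2 \<le> h\<^sup>2" using r0 zy by (intro power_mono)
    then have "L\<^sup>2 * (local_norm B z (y - z))\<^sup>2 \<le> L\<^sup>2 * h\<^sup>2" by (intro mult_left_mono) auto
    with G_Lipschitz(2)[OF z y h01(3)]
    show "(\<integral>w. (dual_local_norm B z (G y w - G z w))\<^sup>2 \<partial>\<Xi>) \<le> L\<^sup>2 * h\<^sup>2" by linarith
    have "dual_local_norm B z (gradient f y - gradient f z) \<le> L\<^sub>1 * h"
      using L\<^sub>1(2)[OF z y h01(3)] mult_left_mono[OF zy, of L\<^sub>1] L\<^sub>1(1) by linarith
    then show "(dual_local_norm B z (gradient f y - gradient f z))\<^sup>2 \<le> L\<^sub>1\<^sup>2 * h\<^sup>2"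
      using zI by (simp only: power_mult_distrib[symmetric]) (intro power_mono, auto)
  qed (use G_variance(2)[OF y] in auto)
  also have "\<dots> = 3 * (\<gamma>\<^sup>2 * \<sigma>\<^sup>2 + (L\<^sup>2 + L\<^sub>1\<^sup>2) * (h / (1 - h))\<^sup>2)"
    by (simp add: c_def power_divide algebra_simps add_divide_distrib)
  finally have N2: "(\<integral>w. (?n (N w))\<^sup>2 \<partial>\<Xi>) \<le> 3 * (\<gamma>\<^sup>2 * \<sigma>\<^sup>2 + (L\<^sup>2 + L\<^sub>1\<^sup>2) * (h / (1 - h))\<^sup>2)" .
  have expand: "(dual_local_norm B y (E w))\<^sup>2 = (?n a)\<^sup>2 + 2 * ((Q *v a) \<bullet> N w) + (?n (N w))\<^sup>2" for w
  proof -
    have "a \<bullet> (Q *v N w) = (Q *v a) \<bullet> N w" using pd by (auto simp: pos_def_matrix_def inner_commute)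
    moreover have "N w \<bullet> (Q *v a) = (Q *v a) \<bullet> N w" by (rule inner_commute)
    ultimately show ?thesis
      unfolding n E matrix_norm_of_square[OF pd]
      by (simp add: matrix_vector_right_distrib inner_add_left inner_add_right)
  qed
  have int_cross: "integrable \<Xi> (\<lambda>w. (Q *v a) \<bullet> N w)" using intN by (rule integrable_inner_right)
  show "integrable \<Xi> (\<lambda>w. (dual_local_norm B y (E w))\<^sup>2)"
    unfolding expand using intN2 int_cross by auto
  have "(\<integral>w. (dual_local_norm B y (E w))\<^sup>2 \<partial>\<Xi>) = (?n a)\<^sup>2 + (\<integral>w. (?n (N w))\<^sup>2 \<partial>\<Xi>)"
    unfolding expand using intN2 int_cross meanN intN by (simp add: prob_space)
  also have "(?n a)\<^sup>2 \<le> ((1 - \<gamma>) / (1 - h))\<^sup>2 * (dual_local_norm B z (g - gradient f z))\<^sup>2"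
  proof -
    have "(?n a)\<^sup>2 = (1 - \<gamma>)\<^sup>2 * (?n (g - gradient f z))\<^sup>2"
      unfolding a_def matrix_norm_of_scaleR power_mult_distrib power2_abs ..
    also have "\<dots> \<le> (1 - \<gamma>)\<^sup>2 * (c\<^sup>2 * (dual_local_norm B z (g - gradient f z))\<^sup>2)"
      using transfer2 by (intro mult_left_mono) auto
    finally show ?thesis by (simp add: c_def power_divide)
  qed
  finally show "(\<integral>w. (dual_local_norm B y (E w))\<^sup>2 \<partial>\<Xi>) \<le> bound"
    using N2 by (simp add: bound_def)
qed

text \<open>Coupling the step size to the momentum by \<open>h = s \<gamma> / 3\<close> lets the
  damping \<open>1 - \<gamma>\<close> pay for the change of norm \<open>1 / (1 - h)\<close>; only
  the fraction \<open>s / 3\<close> of the damping is lost. One of the two factors of the square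
  suffices, since the other is at most 1.\<close>

lemma momentum_estimator_variance_contraction:
  fixes z y g :: "real^'n" and \<gamma> h :: real
  defines "E \<equiv> \<lambda>w. G y w + (1 - \<gamma>) *\<^sub>R (g - G z w) - gradient f y"
  assumes z: "z \<in> \<Omega>\<^sub>o" and y: "y \<in> \<Omega>\<^sub>o" and zy: "local_norm B z (y - z) \<le> h" and h: "h = s * \<gamma> / 3"
    and \<gamma>: "0 < \<gamma>" "\<gamma> \<le> 1"
  shows "integrable \<Xi> (\<lambda>w. (dual_local_norm B y (E w))\<^sup>2)"
    and "(\<integral>w. (dual_local_norm B y (E w))\<^sup>2 \<partial>\<Xi>)
      \<le> (1 - \<gamma> * (1 - s / 3)) * (dual_local_norm B z (g - gradient f z))\<^sup>2
        + (3 * (L\<^sub>1\<^sup>2 + L\<^sup>2) * s\<^sup>2 / (3 - s)\<^sup>2 + 3 * \<sigma>\<^sup>2 / (1 - s / 3)\<^sup>2) * \<gamma>\<^sup>2"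
proof -
  have s\<gamma>: "s * \<gamma> \<le> s" "0 < s * \<gamma>" using \<gamma> s mult_left_mono[of \<gamma> 1 s] by auto
  have h_bounds: "0 < h" "h \<le> s" "h \<le> s / 3" "h < 1" using s\<gamma> s unfolding h by linarith+
  note var = momentum_estimator_variance[OF z y zy h_bounds(2) _ \<gamma>(2)]
  show "integrable \<Xi> (\<lambda>w. (dual_local_norm B y (E w))\<^sup>2)" unfolding E_def using var(1) \<gamma> by simp
  let ?e2 = "(dual_local_norm B z (g - gradient f z))\<^sup>2"
  have "(\<integral>w. (dual_local_norm B y (E w))\<^sup>2 \<partial>\<Xi>)
      \<le> ((1 - \<gamma>) / (1 - h))\<^sup>2 * ?e2 + 3 * (\<gamma>\<^sup>2 * \<sigma>\<^sup>2 + (L\<^sup>2 + L\<^sub>1\<^sup>2) * (h / (1 - h))\<^sup>2)"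
    unfolding E_def using var(2) \<gamma> by simp
  also have "\<dots> \<le> (1 - \<gamma> * (1 - s / 3)) * ?e2
      + 3 * (\<gamma>\<^sup>2 * (\<sigma>\<^sup>2 / (1 - s / 3)\<^sup>2) + (L\<^sup>2 + L\<^sub>1\<^sup>2) * (s * \<gamma> / (3 - s))\<^sup>2)"
  proof (intro add_mono mult_right_mono mult_left_mono)
    let ?t = "1 - \<gamma> * (1 - s / 3)"
    have "\<gamma> * (1 - s / 3) \<le> 1 * 1" using \<gamma> s by (intro mult_mono) auto
    moreover have "0 < \<gamma> * (1 - s / 3)" using \<gamma> s by auto
    ultimately have t: "0 \<le> ?t" "?t \<le> 1" by auto
    \<comment> \<open>Exactly the difference between \<open>?t * (1 - h)\<close> and
      \<open>1 - \<gamma>\<close>.\<close>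
    have "0 \<le> s * \<gamma> * \<gamma> / 3 * (1 - s / 3)" using \<gamma> s by auto
    then have "1 - \<gamma> \<le> ?t * (1 - h)" by (simp add: h algebra_simps)
    then have "(1 - \<gamma>) / (1 - h) \<le> ?t" using h_bounds by (simp add: pos_divide_le_eq)
    then have "((1 - \<gamma>) / (1 - h))\<^sup>2 \<le> ?t\<^sup>2" using \<gamma> h_bounds by (intro power_mono) auto
    also have "\<dots> \<le> ?t" using t mult_left_mono[of ?t 1 ?t] by (simp add: power2_eq_square)
    finally show "((1 - \<gamma>) / (1 - h))\<^sup>2 \<le> ?t" .
    have "(1 - s / 3)\<^sup>2 \<le> 1" using s by (intro power_le_one) auto
    moreover have "0 < (1 - s / 3)\<^sup>2" using s by auto
    \<comment> \<open>A deliberate weakening, to reach the form in which \<open>\<sigma>\<close>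
      occurs in the announced constant.\<close>
    ultimately show "\<sigma>\<^sup>2 \<le> \<sigma>\<^sup>2 / (1 - s / 3)\<^sup>2"
      by (simp add: pos_le_divide_eq mult_left_le)
    have "h / (1 - h) \<le> h / (1 - s / 3)"
      using h_bounds s by (intro divide_left_mono mult_pos_pos) auto
    also have "\<dots> = s * \<gamma> / (3 - s)" using s by (simp add: h field_simps)
    finally show "(h / (1 - h))\<^sup>2 \<le> (s * \<gamma> / (3 - s))\<^sup>2"
      using h_bounds by (intro power_mono) auto
  qed auto
  also have "\<dots> = (1 - \<gamma> * (1 - s / 3)) * ?e2
      + (3 * (L\<^sub>1\<^sup>2 + L\<^sup>2) * s\<^sup>2 / (3 - s)\<^sup>2 + 3 * \<sigma>\<^sup>2 / (1 - s / 3)\<^sup>2) * \<gamma>\<^sup>2"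
    by (simp add: power_divide power_mult_distrib algebra_simps add_divide_distrib)
  finally show "(\<integral>w. (dual_local_norm B y (E w))\<^sup>2 \<partial>\<Xi>)
      \<le> (1 - \<gamma> * (1 - s / 3)) * ?e2
        + (3 * (L\<^sub>1\<^sup>2 + L\<^sup>2) * s\<^sup>2 / (3 - s)\<^sup>2 + 3 * \<sigma>\<^sup>2 / (1 - s / 3)\<^sup>2) * \<gamma>\<^sup>2" .
qed

section \<open>Measurability of a single iteration\<close>

abbreviation "\<S> \<equiv> restrict_space borel \<Omega>\<^sub>o \<Otimes>\<^sub>M (borel :: (real^'n) measure)"

lemma space_state: "space \<S> = \<Omega>\<^sub>o \<times> UNIV"
  by (simp add: space_pair_measure space_restrict_space)

lemma measurable_on_feasible:
  assumes "continuous_on \<Omega>\<^sub>o g" "u \<in> M \<rightarrow>\<^sub>M restrict_space borel \<Omega>\<^sub>o"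
  shows "(\<lambda>\<omega>. g (u \<omega>)) \<in> borel_measurable M"
  by (rule measurable_compose[OF assms(2) borel_measurable_continuous_on_restrict[OF assms(1)]])

lemma continuous_on_hessian: "continuous_on \<Omega>\<^sub>o H"
  by (rule has_derivative_continuous_on, rule has_derivative_at_withinI[OF hessian_has_derivative])
    (rule feasible_interior)

lemma continuous_on_gradient_barrier: "continuous_on \<Omega>\<^sub>o (gradient B)"
  by (rule has_derivative_continuous_on, rule has_derivative_at_withinI[OF gradient_has_derivative])
    (rule feasible_interior)

lemma continuous_on_barrier: "continuous_on \<Omega>\<^sub>o B"
  by (rule has_derivative_continuous_on,
      rule has_derivative_at_withinI[OF barrier_GDERIV[unfolded gderiv_def]])
    (rule feasible_interior)

lemma continuous_on_objective: "continuous_on \<Omega>\<^sub>o f"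
  by (rule has_derivative_continuous_on,
      rule has_derivative_at_withinI[OF objective_GDERIV[unfolded gderiv_def]])

lemma measurable_dual_local_norm:
  assumes "u \<in> M \<rightarrow>\<^sub>M restrict_space borel \<Omega>\<^sub>o" "v \<in> borel_measurable M"
  shows "(\<lambda>\<omega>. dual_local_norm B (u \<omega>) (v \<omega>)) \<in> borel_measurable M"
  unfolding dual_local_norm_eq
  by (intro borel_measurable_matrix_norm_of borel_measurable_matrix_inv
      measurable_on_feasible[OF continuous_on_hessian] assms)

lemma measurable_lagrange_multiplier:
  assumes "u \<in> M \<rightarrow>\<^sub>M restrict_space borel \<Omega>\<^sub>o" "v \<in> borel_measurable M"
  shows "(\<lambda>\<omega>. lagrange_multiplier A B (u \<omega>) (v \<omega>)) \<in> borel_measurable M"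
  unfolding lagrange_multiplier_def
  by (intro borel_measurable_uminus borel_measurable_matrix_inv borel_measurable_matrix_vector_mult
      borel_measurable_matrix_matrix_mult borel_measurable_const
      measurable_on_feasible[OF continuous_on_hessian] assms)

lemma measurable_projected_vector:
  assumes "u \<in> M \<rightarrow>\<^sub>M restrict_space borel \<Omega>\<^sub>o" "v \<in> borel_measurable M"
  shows "(\<lambda>\<omega>. projected_vector A B (u \<omega>) (v \<omega>)) \<in> borel_measurable M"
  unfolding projected_vector_def
  by (intro borel_measurable_add borel_measurable_matrix_vector_mult borel_measurable_const
      measurable_lagrange_multiplier assms)

lemma measurable_normalized_step:
  assumes u: "u \<in> M \<rightarrow>\<^sub>M restrict_space borel \<Omega>\<^sub>o" and v: "v \<in> borel_measurable M"
    and h: "0 \<le> h" "h \<le> s"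
  shows "(\<lambda>\<omega>. normalized_step A B h (u \<omega>) (v \<omega>)) \<in> M \<rightarrow>\<^sub>M restrict_space borel \<Omega>\<^sub>o"
proof (rule measurable_restrict_space2)
  have "u \<omega> \<in> \<Omega>\<^sub>o" if "\<omega> \<in> space M" for \<omega>
    using measurable_space[OF u that] by (simp add: space_restrict_space)
  then show "(\<lambda>\<omega>. normalized_step A B h (u \<omega>) (v \<omega>)) \<in> space M \<rightarrow> \<Omega>\<^sub>o"
    using normalized_step_feasible(1) h by auto
  have "u \<in> borel_measurable M"
    using u by (simp add: measurable_restrict_space2_iff)
  then show "(\<lambda>\<omega>. normalized_step A B h (u \<omega>) (v \<omega>)) \<in> borel_measurable M"
    unfolding normalized_step_def
    by (intro borel_measurable_diff borel_measurable_scaleR borel_measurable_divide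
        borel_measurable_const measurable_dual_local_norm borel_measurable_matrix_vector_mult
        borel_measurable_matrix_inv measurable_projected_vector
        measurable_on_feasible[OF continuous_on_hessian] u v)
qed

end

section \<open>Independence and iterated integrals\<close>

lemma (in prob_space) nn_integral_indep_var:
  assumes ind: "indep_var S Y T X" and u: "u \<in> borel_measurable (S \<Otimes>\<^sub>M T)"
  shows "(\<integral>\<^sup>+\<omega>. u (Y \<omega>, X \<omega>) \<partial>M) = (\<integral>\<^sup>+\<omega>. (\<integral>\<^sup>+w. u (Y \<omega>, w) \<partial>distr M T X) \<partial>M)"
proof -
  have Y: "Y \<in> M \<rightarrow>\<^sub>M S" and X: "X \<in> M \<rightarrow>\<^sub>M T"
    and eq: "distr M S Y \<Otimes>\<^sub>M distr M T X = distr M (S \<Otimes>\<^sub>M T) (\<lambda>\<omega>. (Y \<omega>, X \<omega>))"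
    using ind by (auto simp: indep_var_distribution_eq)
  interpret X: prob_space "distr M T X" by (rule prob_space_distr[OF X])
  have u': "u \<in> borel_measurable (distr M S Y \<Otimes>\<^sub>M distr M T X)"
    using u by (simp cong: measurable_cong_sets)
  have "(\<integral>\<^sup>+\<omega>. u (Y \<omega>, X \<omega>) \<partial>M) = integral\<^sup>N (distr M S Y \<Otimes>\<^sub>M distr M T X) u"
    unfolding eq using X Y u by (subst nn_integral_distr) auto
  also have "\<dots> = (\<integral>\<^sup>+y. (\<integral>\<^sup>+w. u (y, w) \<partial>distr M T X) \<partial>distr M S Y)"
    by (rule X.nn_integral_fst[OF u', symmetric])
  also have "\<dots> = (\<integral>\<^sup>+\<omega>. (\<integral>\<^sup>+w. u (Y \<omega>, w) \<partial>distr M T X) \<partial>M)"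
    by (rule nn_integral_distr[OF Y X.borel_measurable_nn_integral_fst[OF u']])
  finally show ?thesis .
qed

text \<open>Functions measurable with respect to independent generated sigma-algebras are
  independent. This turns independence of the output index from the whole sample sequence into
  product formulas for expectations.\<close>

lemma (in prob_space) indep_var_vimage_algebra:
  assumes X: "X \<in> vimage_algebra (space M) u S \<rightarrow>\<^sub>M N1" and Y: "Y \<in> vimage_algebra (space M) v T \<rightarrow>\<^sub>M N2"
    and ind: "indep_set (sets (vimage_algebra (space M) u S)) (sets (vimage_algebra (space M) v T))"
  shows "indep_var N1 X N2 Y"
proof -
  let ?U = "vimage_algebra (space M) u S" and ?V = "vimage_algebra (space M) v T"
  have sub: "sigma_sets (space M) {Z -` A \<inter> space M | A. A \<in> sets N} \<subseteq> sets W"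
    if "Z \<in> W \<rightarrow>\<^sub>M N" "space W = space M" for Z :: "'a \<Rightarrow> 'b" and W N
    using that measurable_sets[OF that(1)] by (intro sets.sigma_sets_subset[of _ W, unfolded that(2)]) auto
  have U: "sets ?U \<subseteq> events" and V: "sets ?V \<subseteq> events"
    using ind by (auto simp: indep_sets2_eq)
  have rv: "random_variable N Z"
    if "Z \<in> W \<rightarrow>\<^sub>M N" "space W = space M" "sets W \<subseteq> events" for Z :: "'a \<Rightarrow> 'b" and W N
    using that by (auto simp: measurable_def)
  have "random_variable N1 X" "random_variable N2 Y"
    using rv[OF X] rv[OF Y] U V by auto
  moreover have "indep_set (sigma_sets (space M) {X -` A \<inter> space M | A. A \<in> sets N1})
      (sigma_sets (space M) {Y -` A \<inter> space M | A. A \<in> sets N2})"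
    unfolding indep_sets2_eq
  proof (intro conjI ballI)
    show "prob (a \<inter> b) = prob a * prob b"
      if "a \<in> sigma_sets (space M) {X -` A \<inter> space M | A. A \<in> sets N1}"
        "b \<in> sigma_sets (space M) {Y -` A \<inter> space M | A. A \<in> sets N2}" for a b
    proof -
      have "a \<in> sets ?U" "b \<in> sets ?V"
        using that subsetD[OF sub[OF X space_vimage_algebra]] subsetD[OF sub[OF Y space_vimage_algebra]]
        by blast+
      then show ?thesis using ind unfolding indep_sets2_eq by blast
    qed
  qed (use order_trans[OF sub[OF X space_vimage_algebra] U] order_trans[OF sub[OF Y space_vimage_algebra] V] in blast)+
  ultimately show ?thesis unfolding indep_var_eq by blast
qed

section \<open>The random process of iterates and estimators\<close>

locale sipm_rm_process = stochastic_sipm \<K> \<theta> B A b f \<phi>\<^sub>l\<^sub>o\<^sub>w s L\<^sub>1 \<Omega>\<^sub>o \<Xi> G \<sigma> L + P: prob_space P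
  for \<K> :: "(real^'n) set" and \<theta> :: real and B :: "real^'n \<Rightarrow> real"
    and A :: "real^'n^'m" and b :: "real^'m" and f :: "real^'n \<Rightarrow> real"
    and \<phi>\<^sub>l\<^sub>o\<^sub>w s L\<^sub>1 :: real and \<Omega>\<^sub>o :: "(real^'n) set" and \<Xi> :: "'s measure"
    and G :: "real^'n \<Rightarrow> 's \<Rightarrow> real^'n" and \<sigma> L :: real and P :: "'w measure" +
  fixes \<xi> :: "nat \<Rightarrow> 'w \<Rightarrow> 's" and h \<gamma> \<mu> :: "nat \<Rightarrow> real" and x0 :: "real^'n"
    and x mb :: "nat \<Rightarrow> 'w \<Rightarrow> real^'n"
  assumes samples_indep: "P.indep_vars (\<lambda>_. \<Xi>) \<xi> UNIV"
    and samples_law: "\<And>k. distr P \<Xi> (\<xi> k) = \<Xi>"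
    and h: "\<And>k. h k = s / (3 * (cbrt_index k)\<^sup>2)" and \<gamma>: "\<And>k. \<gamma> k = 1 / (cbrt_index k)\<^sup>2"
    and \<mu>: "\<And>k. 0 < \<mu> k" "\<And>k. \<mu> k \<le> 1" "\<And>k. \<mu> (Suc k) \<le> \<mu> k" "\<mu> 0 = 1"
    and x0: "x0 \<in> \<Omega>\<^sub>o"
    and x_0: "\<And>\<omega>. \<omega> \<in> space P \<Longrightarrow> x 0 \<omega> = x0"
    and mb_0: "\<And>\<omega>. \<omega> \<in> space P \<Longrightarrow> mb 0 \<omega> = G x0 (\<xi> 0 \<omega>)"
    and x_Suc: "\<And>k \<omega>. \<omega> \<in> space P \<Longrightarrow>
      x (Suc k) \<omega> = normalized_step A B (h k) (x k \<omega>) (mb k \<omega> + \<mu> k *\<^sub>R (mb k \<omega> + gradient B (x k \<omega>)))"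
    and mb_Suc: "\<And>k \<omega>. \<omega> \<in> space P \<Longrightarrow>
      mb (Suc k) \<omega> = G (x (Suc k) \<omega>) (\<xi> (Suc k) \<omega>) + (1 - \<gamma> k) *\<^sub>R (mb k \<omega> - G (x k \<omega>) (\<xi> (Suc k) \<omega>))"
begin

lemma h_bounds: "0 < h k" "h k \<le> s / 3" "h k \<le> s" "h k = s * \<gamma> k / 3"
  and \<gamma>_bounds: "0 < \<gamma> k" "\<gamma> k \<le> 1"
proof -
  have w: "1 \<le> (cbrt_index k)\<^sup>2" using cbrt_index_ge_1 by (rule one_le_power)
  show \<gamma>b: "0 < \<gamma> k" "\<gamma> k \<le> 1" using w by (auto simp: \<gamma> divide_le_eq)
  show eq: "h k = s * \<gamma> k / 3" by (simp add: h \<gamma>)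
  show "0 < h k" unfolding eq using \<gamma>b s by simp
  show "h k \<le> s / 3" unfolding eq using \<gamma>b s by (simp add: mult_left_le)
  then show "h k \<le> s" using s by simp
qed

definition search :: "nat \<Rightarrow> (real^'n) \<times> (real^'n) \<Rightarrow> real^'n"
  where "search k p = snd p + \<mu> k *\<^sub>R (snd p + gradient B (fst p))"

definition step :: "nat \<Rightarrow> (real^'n) \<times> (real^'n) \<Rightarrow> real^'n"
  where "step k p = normalized_step A B (h k) (fst p) (search k p)"

definition update :: "nat \<Rightarrow> (real^'n) \<times> (real^'n) \<Rightarrow> 's \<Rightarrow> (real^'n) \<times> (real^'n)"
  where "update k p w = (step k p, G (step k p) w + (1 - \<gamma> k) *\<^sub>R (snd p - G (fst p) w))"

definition error :: "(real^'n) \<times> (real^'n) \<Rightarrow> real"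
  where "error p = dual_local_norm B (fst p) (snd p - gradient f (fst p))"

definition residual :: "nat \<Rightarrow> (real^'n) \<times> (real^'n) \<Rightarrow> real"
  where "residual k p = dual_local_norm B (fst p)
    (gradient (barrier_fun f B (\<mu> k)) (fst p) + transpose A *v lagrange_multiplier A B (fst p) (search k p))"

text \<open>The iterate alone is not Markovian; together with the momentum estimator it is, since
  the pair and one fresh sample determine the next pair.\<close>

definition state :: "nat \<Rightarrow> 'w \<Rightarrow> (real^'n) \<times> (real^'n)"
  where "state k \<omega> = (x k \<omega>, mb k \<omega>)"

lemma state_Suc: "\<omega> \<in> space P \<Longrightarrow> state (Suc k) \<omega> = update k (state k \<omega>) (\<xi> (Suc k) \<omega>)"
  by (simp add: state_def update_def step_def search_def x_Suc mb_Suc)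

lemma samples_measurable: "\<xi> k \<in> P \<rightarrow>\<^sub>M \<Xi>"
  using samples_indep by (auto simp: P.indep_vars_def)

lemma measurable_G:
  assumes "u \<in> M \<rightarrow>\<^sub>M restrict_space borel \<Omega>\<^sub>o" "v \<in> M \<rightarrow>\<^sub>M \<Xi>"
  shows "(\<lambda>\<omega>. G (u \<omega>) (v \<omega>)) \<in> borel_measurable M"
  using measurable_compose[OF measurable_Pair[OF assms] G_measurable] by simp

lemma measurable_fst_state: "fst \<in> \<S> \<rightarrow>\<^sub>M restrict_space borel \<Omega>\<^sub>o"
  and measurable_snd_state: "snd \<in> borel_measurable \<S>"
  by simp_all

lemma measurable_search: "search k \<in> borel_measurable \<S>"
  unfolding search_def
  by (intro borel_measurable_add borel_measurable_scaleR borel_measurable_const measurable_snd_state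
      measurable_on_feasible[OF continuous_on_gradient_barrier] measurable_fst_state)

lemma measurable_step: "step k \<in> \<S> \<rightarrow>\<^sub>M restrict_space borel \<Omega>\<^sub>o"
  unfolding step_def
  by (intro measurable_normalized_step measurable_fst_state measurable_search
      less_imp_le[OF h_bounds(1)] h_bounds(3))

lemma measurable_update: "(\<lambda>(p, w). update k p w) \<in> \<S> \<Otimes>\<^sub>M \<Xi> \<rightarrow>\<^sub>M \<S>"
proof -
  have step: "(\<lambda>q. step k (fst q)) \<in> \<S> \<Otimes>\<^sub>M \<Xi> \<rightarrow>\<^sub>M restrict_space borel \<Omega>\<^sub>o"
    by (rule measurable_compose[OF measurable_fst measurable_step])
  have 1: "(\<lambda>q. fst (fst q)) \<in> \<S> \<Otimes>\<^sub>M \<Xi> \<rightarrow>\<^sub>M restrict_space borel \<Omega>\<^sub>o"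
    by (rule measurable_compose[OF measurable_fst measurable_fst_state])
  have 2: "(\<lambda>q. snd (fst q)) \<in> borel_measurable (\<S> \<Otimes>\<^sub>M \<Xi>)"
    by (rule measurable_compose[OF measurable_fst measurable_snd_state])
  have 3: "snd \<in> \<S> \<Otimes>\<^sub>M \<Xi> \<rightarrow>\<^sub>M \<Xi>" by (rule measurable_snd)
  have "(\<lambda>q. update k (fst q) (snd q)) \<in> \<S> \<Otimes>\<^sub>M \<Xi> \<rightarrow>\<^sub>M \<S>"
    unfolding update_def
    by (intro measurable_Pair step borel_measurable_add borel_measurable_scaleR borel_measurable_diff
        borel_measurable_const measurable_G 1 2 3)
  then show ?thesis by (simp add: case_prod_beta')
qed

lemma measurable_error: "error \<in> borel_measurable \<S>"
  unfolding error_def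
  by (intro measurable_dual_local_norm borel_measurable_diff measurable_fst_state measurable_snd_state
      measurable_on_feasible[OF continuous_on_gradient])

lemma measurable_residual: "residual k \<in> borel_measurable \<S>"
proof -
  have "(\<lambda>p. dual_local_norm B (fst p) (gradient f (fst p) + \<mu> k *\<^sub>R (gradient f (fst p) + gradient B (fst p))
      + transpose A *v lagrange_multiplier A B (fst p) (search k p))) \<in> borel_measurable \<S>"
    by (intro measurable_dual_local_norm borel_measurable_add borel_measurable_scaleR
        borel_measurable_const borel_measurable_matrix_vector_mult measurable_lagrange_multiplier
        measurable_search measurable_fst_state measurable_on_feasible[OF continuous_on_gradient]
        measurable_on_feasible[OF continuous_on_gradient_barrier])
  then show ?thesis
    by (rule measurable_cong[THEN iffD1, rotated])
      (auto simp: residual_def gradient_barrier_fun space_state)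
qed

lemma measurable_merit: "(\<lambda>p. merit (\<mu> k) (fst p)) \<in> borel_measurable \<S>"
  unfolding merit_def barrier_fun_def
  by (intro borel_measurable_add borel_measurable_diff borel_measurable_times borel_measurable_const
      measurable_on_feasible[OF continuous_on_objective] measurable_on_feasible[OF continuous_on_barrier]
      measurable_fst_state)

text \<open>Adaptedness: with \<open>state k\<close> a measurable function of the samples up to
  \<open>k\<close>, independence from the next sample and from the output index is inherited from
  the samples.\<close>

lemma state_representation:
  "\<exists>F. F \<in> PiM {..k} (\<lambda>_. \<Xi>) \<rightarrow>\<^sub>M \<S> \<and>
    (\<forall>\<omega>\<in>space P. state k \<omega> = F (restrict (\<lambda>i. \<xi> i \<omega>) {..k}))"
proof (induction k)
  case 0
  have "(\<lambda>g. (x0, G x0 (g 0))) \<in> PiM {..0::nat} (\<lambda>_. \<Xi>) \<rightarrow>\<^sub>M \<S>"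
    using x0 by (intro measurable_Pair measurable_G measurable_const measurable_component_singleton)
      (auto simp: space_restrict_space)
  moreover have "\<forall>\<omega>\<in>space P. state 0 \<omega> = (\<lambda>g. (x0, G x0 (g 0))) (restrict (\<lambda>i. \<xi> i \<omega>) {..0})"
    by (simp add: state_def x_0 mb_0)
  ultimately show ?case by (intro exI conjI)
next
  case (Suc k)
  then obtain F where F: "F \<in> PiM {..k} (\<lambda>_. \<Xi>) \<rightarrow>\<^sub>M \<S>"
    "\<And>\<omega>. \<omega> \<in> space P \<Longrightarrow> state k \<omega> = F (restrict (\<lambda>i. \<xi> i \<omega>) {..k})" by blast
  define F' where "F' g = update k (F (restrict g {..k})) (g (Suc k))" for g
  have 1: "(\<lambda>g. F (restrict g {..k})) \<in> PiM {..Suc k} (\<lambda>_. \<Xi>) \<rightarrow>\<^sub>M \<S>"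
    by (rule measurable_compose[OF measurable_restrict_subset F(1)]) auto
  have 2: "(\<lambda>g. g (Suc k)) \<in> PiM {..Suc k} (\<lambda>_. \<Xi>) \<rightarrow>\<^sub>M \<Xi>"
    by (rule measurable_component_singleton) simp
  have "F' \<in> PiM {..Suc k} (\<lambda>_. \<Xi>) \<rightarrow>\<^sub>M \<S>"
    using measurable_compose[OF measurable_Pair[OF 1 2] measurable_update[of k]]
    by (simp add: F'_def[abs_def])
  moreover have "\<forall>\<omega>\<in>space P. state (Suc k) \<omega> = F' (restrict (\<lambda>i. \<xi> i \<omega>) {..Suc k})"
  proof
    fix \<omega> assume "\<omega> \<in> space P"
    moreover have "restrict (restrict (\<lambda>i. \<xi> i \<omega>) {..Suc k}) {..k} = restrict (\<lambda>i. \<xi> i \<omega>) {..k}"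
      by (auto simp: restrict_def)
    ultimately show "state (Suc k) \<omega> = F' (restrict (\<lambda>i. \<xi> i \<omega>) {..Suc k})"
      by (simp add: state_Suc F'_def F(2))
  qed
  ultimately show ?case by blast
qed

lemma measurable_state: "state k \<in> P \<rightarrow>\<^sub>M \<S>"
proof -
  obtain F where F: "F \<in> PiM {..k} (\<lambda>_. \<Xi>) \<rightarrow>\<^sub>M \<S>"
    "\<And>\<omega>. \<omega> \<in> space P \<Longrightarrow> state k \<omega> = F (restrict (\<lambda>i. \<xi> i \<omega>) {..k})"
    using state_representation[of k] by blast
  have "(\<lambda>\<omega>. F (restrict (\<lambda>i. \<xi> i \<omega>) {..k})) \<in> P \<rightarrow>\<^sub>M \<S>"
    by (rule measurable_compose[OF measurable_restrict F(1)]) (rule samples_measurable)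
  then show ?thesis by (rule measurable_cong[THEN iffD1, rotated]) (simp add: F(2))
qed

lemma x_feasible: "\<omega> \<in> space P \<Longrightarrow> x k \<omega> \<in> \<Omega>\<^sub>o"
  using measurable_space[OF measurable_state, of \<omega> k] by (simp add: state_def space_state)

text \<open>Takes the place of conditioning on the past: by independence and Fubini the new sample
  is averaged with the state held fixed. The nonnegative integral makes this usable before
  integrability at time \<open>k + 1\<close> is known.\<close>

lemma nn_integral_state_Suc:
  assumes u: "u \<in> borel_measurable \<S>"
  shows "(\<integral>\<^sup>+\<omega>. u (state (Suc k) \<omega>) \<partial>P) = (\<integral>\<^sup>+\<omega>. (\<integral>\<^sup>+w. u (update k (state k \<omega>) w) \<partial>\<Xi>) \<partial>P)"
proof -
  obtain F where F: "F \<in> PiM {..k} (\<lambda>_. \<Xi>) \<rightarrow>\<^sub>M \<S>"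
    "\<And>\<omega>. \<omega> \<in> space P \<Longrightarrow> state k \<omega> = F (restrict (\<lambda>i. \<xi> i \<omega>) {..k})"
    using state_representation[of k] by blast
  let ?Y = "\<lambda>\<omega>. restrict (\<lambda>i. \<xi> i \<omega>) {..k}" and ?X = "\<lambda>\<omega>. restrict (\<lambda>i. \<xi> i \<omega>) {Suc k}"
  let ?T = "PiM {Suc k} (\<lambda>_. \<Xi>)"
  have ind: "P.indep_var (PiM {..k} (\<lambda>_. \<Xi>)) ?Y ?T ?X"
    by (rule P.indep_var_restrict[OF samples_indep]) auto
  have proj: "(\<lambda>g. g (Suc k)) \<in> ?T \<rightarrow>\<^sub>M \<Xi>" by (rule measurable_component_singleton) simp
  have upd: "(\<lambda>q. u (update k (fst q) (snd q))) \<in> borel_measurable (\<S> \<Otimes>\<^sub>M \<Xi>)"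
    using measurable_compose[OF measurable_update u] by (simp add: case_prod_beta')
  have meas: "(\<lambda>q. u (update k (F (fst q)) (snd q (Suc k)))) \<in> borel_measurable (PiM {..k} (\<lambda>_. \<Xi>) \<Otimes>\<^sub>M ?T)"
    using measurable_compose[OF measurable_Pair[OF measurable_compose[OF measurable_fst F(1)]
          measurable_compose[OF measurable_snd proj]] upd]
    by simp
  have X: "?X \<in> P \<rightarrow>\<^sub>M ?T" by (intro measurable_restrict samples_measurable)
  have inner: "(\<integral>\<^sup>+g. u (update k (F (?Y \<omega>)) (g (Suc k))) \<partial>distr P ?T ?X) = (\<integral>\<^sup>+w. u (update k (state k \<omega>) w) \<partial>\<Xi>)"
    if \<omega>: "\<omega> \<in> space P" for \<omega>
  proof -
    have "state k \<omega> \<in> space \<S>" by (rule measurable_space[OF measurable_state \<omega>])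
    then have w: "(\<lambda>w. u (update k (state k \<omega>) w)) \<in> borel_measurable \<Xi>"
      using measurable_compose[OF measurable_Pair1' upd] by simp
    have "(\<integral>\<^sup>+g. u (update k (F (?Y \<omega>)) (g (Suc k))) \<partial>distr P ?T ?X)
        = (\<integral>\<^sup>+\<omega>'. u (update k (state k \<omega>) (\<xi> (Suc k) \<omega>')) \<partial>P)"
      using measurable_compose[OF proj w] by (subst nn_integral_distr[OF X]) (simp_all add: F(2)[OF \<omega>])
    also have "\<dots> = (\<integral>\<^sup>+w. u (update k (state k \<omega>) w) \<partial>distr P \<Xi> (\<xi> (Suc k)))"
      using w by (intro nn_integral_distr[symmetric] samples_measurable) simp
    finally show ?thesis unfolding samples_law .
  qed
  have "(\<integral>\<^sup>+\<omega>. u (state (Suc k) \<omega>) \<partial>P) = (\<integral>\<^sup>+\<omega>. u (update k (F (?Y \<omega>)) (?X \<omega> (Suc k))) \<partial>P)"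
    by (intro nn_integral_cong) (simp add: state_Suc F(2))
  also have "\<dots> = (\<integral>\<^sup>+\<omega>. (\<integral>\<^sup>+g. u (update k (F (?Y \<omega>)) (g (Suc k))) \<partial>distr P ?T ?X) \<partial>P)"
    using P.nn_integral_indep_var[OF ind meas] by simp
  also have "\<dots> = (\<integral>\<^sup>+\<omega>. (\<integral>\<^sup>+w. u (update k (state k \<omega>) w) \<partial>\<Xi>) \<partial>P)"
    by (intro nn_integral_cong inner)
  finally show ?thesis .
qed

lemma residual_nonneg: "p \<in> space \<S> \<Longrightarrow> 0 \<le> residual k p"
  by (auto simp: residual_def space_state intro!: dual_local_norm_nonneg feasible_interior)

lemma state_in_space: "\<omega> \<in> space P \<Longrightarrow> state k \<omega> \<in> space \<S>"
  by (rule measurable_space[OF measurable_state])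

lemma measurable_of_state:
  assumes "u \<in> borel_measurable \<S>"
  shows "(\<lambda>\<omega>. u (state k \<omega>)) \<in> borel_measurable P"
  by (rule measurable_compose[OF measurable_state assms])

section \<open>Second moments of the estimator error\<close>

definition variance_constant :: real
  where "variance_constant = 3 * (L\<^sub>1\<^sup>2 + L\<^sup>2) * s\<^sup>2 / (3 - s)\<^sup>2 + 3 * \<sigma>\<^sup>2 / (1 - s / 3)\<^sup>2"

lemma variance_constant_nonneg: "0 \<le> variance_constant"
  by (auto simp: variance_constant_def intro!: add_nonneg_nonneg divide_nonneg_nonneg mult_nonneg_nonneg)

lemma integrable_error_0: "integrable P (\<lambda>\<omega>. (error (state 0 \<omega>))\<^sup>2)"
  and expectation_error_0: "(\<integral>\<omega>. (error (state 0 \<omega>))\<^sup>2 \<partial>P) \<le> \<sigma>\<^sup>2"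
proof -
  let ?g = "\<lambda>w. (dual_local_norm B x0 (G x0 w - gradient f x0))\<^sup>2"
  have g: "integrable (distr P \<Xi> (\<xi> 0)) ?g" unfolding samples_law by (rule G_variance(1)[OF x0])
  have gm: "?g \<in> borel_measurable \<Xi>" using G_variance(1)[OF x0] by auto
  have eq: "(error (state 0 \<omega>))\<^sup>2 = ?g (\<xi> 0 \<omega>)" if "\<omega> \<in> space P" for \<omega>
    using that by (simp add: error_def state_def x_0 mb_0)
  have "integrable P (\<lambda>\<omega>. ?g (\<xi> 0 \<omega>))"
    using g integrable_distr_eq[OF samples_measurable gm] by blast
  then show "integrable P (\<lambda>\<omega>. (error (state 0 \<omega>))\<^sup>2)"
    by (rule Bochner_Integration.integrable_cong[THEN iffD1, OF refl, rotated]) (simp add: eq)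
  have "(\<integral>\<omega>. (error (state 0 \<omega>))\<^sup>2 \<partial>P) = (\<integral>\<omega>. ?g (\<xi> 0 \<omega>) \<partial>P)"
    by (intro Bochner_Integration.integral_cong) (auto simp: eq)
  also have "\<dots> = (\<integral>w. ?g w \<partial>distr P \<Xi> (\<xi> 0))"
    by (rule integral_distr[OF samples_measurable gm, symmetric])
  finally show "(\<integral>\<omega>. (error (state 0 \<omega>))\<^sup>2 \<partial>P) \<le> \<sigma>\<^sup>2"
    using G_variance(2)[OF x0] by (simp add: samples_law)
qed

text \<open>The pointwise contraction is averaged over the state. The finite bound on the
  nonnegative integral yields integrability at \<open>k + 1\<close> first, and only then the
  inequality between expectations.\<close>

lemma error_contraction:
  assumes int: "integrable P (\<lambda>\<omega>. (error (state k \<omega>))\<^sup>2)"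
  shows "integrable P (\<lambda>\<omega>. (error (state (Suc k) \<omega>))\<^sup>2)"
    and "(\<integral>\<omega>. (error (state (Suc k) \<omega>))\<^sup>2 \<partial>P)
      \<le> (1 - \<gamma> k * (1 - s / 3)) * (\<integral>\<omega>. (error (state k \<omega>))\<^sup>2 \<partial>P) + variance_constant * (\<gamma> k)\<^sup>2"
proof -
  let ?a = "1 - \<gamma> k * (1 - s / 3)" and ?c = "variance_constant * (\<gamma> k)\<^sup>2"
  have "\<gamma> k * (1 - s / 3) \<le> 1 * 1" using \<gamma>_bounds[of k] s by (intro mult_mono) auto
  then have a: "0 \<le> ?a" by simp
  have c: "0 \<le> ?c" using variance_constant_nonneg by simp
  let ?u = "\<lambda>p. ennreal ((error p)\<^sup>2)"
  have u: "?u \<in> borel_measurable \<S>" using measurable_error by measurable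
  have inner: "(\<integral>\<^sup>+w. ?u (update k p w) \<partial>\<Xi>) \<le> ennreal (?a * (error p)\<^sup>2 + ?c)" if p: "p \<in> space \<S>" for p
  proof -
    have z: "fst p \<in> \<Omega>\<^sub>o" using p by (auto simp: space_state)
    have y: "step k p \<in> \<Omega>\<^sub>o" "local_norm B (fst p) (step k p - fst p) \<le> h k"
      unfolding step_def using h_bounds[of k] by (intro normalized_step_feasible z; simp)+
    note var = momentum_estimator_variance_contraction[OF z y h_bounds(4) \<gamma>_bounds, of "snd p"]
    have "(\<integral>\<^sup>+w. ?u (update k p w) \<partial>\<Xi>) = ennreal (\<integral>w. (error (update k p w))\<^sup>2 \<partial>\<Xi>)"
      using var(1) by (intro nn_integral_eq_integral) (auto simp: error_def update_def)
    also have "\<dots> \<le> ennreal (?a * (error p)\<^sup>2 + ?c)"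
      using var(2) by (intro ennreal_leI) (simp add: error_def update_def variance_constant_def)
    finally show ?thesis .
  qed
  have int': "integrable P (\<lambda>\<omega>. ?a * (error (state k \<omega>))\<^sup>2 + ?c)" using int by auto
  have "(\<integral>\<^sup>+\<omega>. ?u (state (Suc k) \<omega>) \<partial>P) = (\<integral>\<^sup>+\<omega>. (\<integral>\<^sup>+w. ?u (update k (state k \<omega>) w) \<partial>\<Xi>) \<partial>P)"
    by (rule nn_integral_state_Suc[OF u])
  also have "\<dots> \<le> (\<integral>\<^sup>+\<omega>. ennreal (?a * (error (state k \<omega>))\<^sup>2 + ?c) \<partial>P)"
    by (intro nn_integral_mono inner state_in_space)
  also have "\<dots> = ennreal (\<integral>\<omega>. ?a * (error (state k \<omega>))\<^sup>2 + ?c \<partial>P)"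
    using a c by (intro nn_integral_eq_integral int') auto
  also have "(\<integral>\<omega>. ?a * (error (state k \<omega>))\<^sup>2 + ?c \<partial>P) = ?a * (\<integral>\<omega>. (error (state k \<omega>))\<^sup>2 \<partial>P) + ?c"
    using int by (simp add: P.prob_space)
  finally have le: "(\<integral>\<^sup>+\<omega>. ?u (state (Suc k) \<omega>) \<partial>P) \<le> ennreal (?a * (\<integral>\<omega>. (error (state k \<omega>))\<^sup>2 \<partial>P) + ?c)" .
  have meas: "(\<lambda>\<omega>. (error (state (Suc k) \<omega>))\<^sup>2) \<in> borel_measurable P"
    by (intro borel_measurable_power measurable_of_state measurable_error)
  show int_Suc: "integrable P (\<lambda>\<omega>. (error (state (Suc k) \<omega>))\<^sup>2)"
    using le by (intro integrableI_nonneg meas) (auto intro: le_less_trans)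
  have "ennreal (\<integral>\<omega>. (error (state (Suc k) \<omega>))\<^sup>2 \<partial>P) \<le> ennreal (?a * (\<integral>\<omega>. (error (state k \<omega>))\<^sup>2 \<partial>P) + ?c)"
    using le nn_integral_eq_integral[OF int_Suc] by simp
  then show "(\<integral>\<omega>. (error (state (Suc k) \<omega>))\<^sup>2 \<partial>P) \<le> ?a * (\<integral>\<omega>. (error (state k \<omega>))\<^sup>2 \<partial>P) + ?c"
    using a c by (subst (asm) ennreal_le_iff) (auto intro!: add_nonneg_nonneg mult_nonneg_nonneg)
qed

lemma integrable_error: "integrable P (\<lambda>\<omega>. (error (state k \<omega>))\<^sup>2)"
  by (induction k) (auto intro: integrable_error_0 error_contraction)

section \<open>Expected descent of the merit function\<close>

definition curvature :: real
  where "curvature = 2 * L\<^sub>1 + 1 / (1 - s)"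

lemma curvature_pos: "0 < curvature"
  using L\<^sub>1(1) s by (auto simp: curvature_def intro!: add_pos_pos)

lemma merit_descent:
  assumes \<omega>: "\<omega> \<in> space P"
  shows "h k * residual k (state k \<omega>) \<le> merit (\<mu> k) (x k \<omega>) - merit (\<mu> (Suc k)) (x (Suc k) \<omega>)
    + 4 * h k * error (state k \<omega>) + curvature / 2 * (h k)\<^sup>2"
proof -
  note z = x_feasible[OF \<omega>, of k]
  let ?g = "search k (state k \<omega>)"
  have y: "x (Suc k) \<omega> = normalized_step A B (h k) (x k \<omega>) ?g"
    using \<omega> by (simp add: x_Suc search_def state_def)
  have "barrier_fun f B (\<mu> k) (x (Suc k) \<omega>) \<le> barrier_fun f B (\<mu> k) (x k \<omega>)
      - h k * residual k (state k \<omega>) + 4 * h k * error (state k \<omega>) + curvature / 2 * (h k)\<^sup>2"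
    unfolding y residual_def error_def curvature_def
    using normalized_step_descent[OF z less_imp_le[OF h_bounds(1)] h_bounds(3) \<mu>(1,2),
        where g = ?g and mb = "mb k \<omega>"]
    by (simp add: state_def search_def)
  moreover have "merit (\<mu> (Suc k)) (x (Suc k) \<omega>) \<le> merit (\<mu> k) (x (Suc k) \<omega>)"
    by (intro merit_mono x_feasible \<omega> \<mu>)
  ultimately show ?thesis by (simp add: merit_def)
qed

text \<open>Descent involves the error linearly while the recursion controls its square; completing
  the square with a free weight \<open>q\<close> bridges the two.\<close>

lemma merit_descent_Young:
  assumes \<omega>: "\<omega> \<in> space P" and q: "0 < q"
  shows "h k * residual k (state k \<omega>) \<le> merit (\<mu> k) (x k \<omega>) - merit (\<mu> (Suc k)) (x (Suc k) \<omega>)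
    + q * (error (state k \<omega>))\<^sup>2 + 4 * (h k)\<^sup>2 / q + curvature / 2 * (h k)\<^sup>2"
proof -
  have "0 \<le> (q * error (state k \<omega>) - 2 * h k)\<^sup>2 / q" using q by simp
  also have "\<dots> = q * (error (state k \<omega>))\<^sup>2 - 4 * h k * error (state k \<omega>) + 4 * (h k)\<^sup>2 / q"
    using q by (simp add: power2_eq_square field_simps)
  finally show ?thesis using merit_descent[OF \<omega>, of k] by linarith
qed

text \<open>By induction, the descent inequality with its nonnegative residual term dropped bounds
  the next, nonnegative merit by integrable quantities.\<close>

lemma integrable_merit: "integrable P (\<lambda>\<omega>. merit (\<mu> k) (x k \<omega>))"
proof (induction k)
  case 0
  have "integrable P (\<lambda>\<omega>. merit (\<mu> 0) x0)" by simp
  then show ?case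
    by (rule Bochner_Integration.integrable_cong[THEN iffD1, OF refl, rotated]) (simp add: x_0)
next
  case (Suc k)
  let ?D = "\<lambda>\<omega>. merit (\<mu> k) (x k \<omega>) + 1 * (error (state k \<omega>))\<^sup>2 + 4 * (h k)\<^sup>2 / 1 + curvature / 2 * (h k)\<^sup>2"
  show ?case
  proof (rule Bochner_Integration.integrable_bound)
    show "integrable P ?D" using Suc integrable_error by auto
    show "(\<lambda>\<omega>. merit (\<mu> (Suc k)) (x (Suc k) \<omega>)) \<in> borel_measurable P"
      using measurable_of_state[OF measurable_merit[of "Suc k"], of "Suc k"] by (simp add: state_def)
    show "AE \<omega> in P. norm (merit (\<mu> (Suc k)) (x (Suc k) \<omega>)) \<le> norm (?D \<omega>)"
    proof (rule AE_I2)
      fix \<omega> assume \<omega>: "\<omega> \<in> space P"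
      have "0 \<le> merit (\<mu> (Suc k)) (x (Suc k) \<omega>)" by (intro merit_nonneg x_feasible \<omega> \<mu>)
      moreover have "0 \<le> h k * residual k (state k \<omega>)"
        by (intro mult_nonneg_nonneg residual_nonneg state_in_space less_imp_le[OF h_bounds(1)] \<omega>)
      ultimately show "norm (merit (\<mu> (Suc k)) (x (Suc k) \<omega>)) \<le> norm (?D \<omega>)"
        using merit_descent_Young[OF \<omega> zero_less_one, of k] by (simp only: real_norm_def)
    qed
  qed
qed

lemma integrable_residual: "integrable P (\<lambda>\<omega>. residual k (state k \<omega>))"
proof -
  let ?D = "\<lambda>\<omega>. merit (\<mu> k) (x k \<omega>) - merit (\<mu> (Suc k)) (x (Suc k) \<omega>)
    + 1 * (error (state k \<omega>))\<^sup>2 + 4 * (h k)\<^sup>2 / 1 + curvature / 2 * (h k)\<^sup>2"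
  have "integrable P (\<lambda>\<omega>. h k * residual k (state k \<omega>))"
  proof (rule Bochner_Integration.integrable_bound)
    show "integrable P ?D" using integrable_merit integrable_error by auto
    show "(\<lambda>\<omega>. h k * residual k (state k \<omega>)) \<in> borel_measurable P"
      by (intro borel_measurable_times borel_measurable_const measurable_of_state measurable_residual)
    show "AE \<omega> in P. norm (h k * residual k (state k \<omega>)) \<le> norm (?D \<omega>)"
    proof (rule AE_I2)
      fix \<omega> assume \<omega>: "\<omega> \<in> space P"
      have "0 \<le> h k * residual k (state k \<omega>)"
        by (intro mult_nonneg_nonneg residual_nonneg state_in_space less_imp_le[OF h_bounds(1)] \<omega>)
      then show "norm (h k * residual k (state k \<omega>)) \<le> norm (?D \<omega>)"
        using merit_descent_Young[OF \<omega> zero_less_one, of k] by (simp only: real_norm_def)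
    qed
  qed
  then show ?thesis using h_bounds(1)[of k] by simp
qed

lemma expected_residual_nonneg: "0 \<le> (\<integral>\<omega>. residual k (state k \<omega>) \<partial>P)"
  by (intro integral_nonneg_AE AE_I2 residual_nonneg state_in_space)

lemma expected_merit_descent:
  assumes q: "0 < q"
  shows "h k * (\<integral>\<omega>. residual k (state k \<omega>) \<partial>P)
    \<le> (\<integral>\<omega>. merit (\<mu> k) (x k \<omega>) \<partial>P) - (\<integral>\<omega>. merit (\<mu> (Suc k)) (x (Suc k) \<omega>) \<partial>P)
      + q * (\<integral>\<omega>. (error (state k \<omega>))\<^sup>2 \<partial>P) + 4 * (h k)\<^sup>2 / q + curvature / 2 * (h k)\<^sup>2"
proof -
  have "h k * (\<integral>\<omega>. residual k (state k \<omega>) \<partial>P) = (\<integral>\<omega>. h k * residual k (state k \<omega>) \<partial>P)"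
    by simp
  also have "\<dots> \<le> (\<integral>\<omega>. merit (\<mu> k) (x k \<omega>) - merit (\<mu> (Suc k)) (x (Suc k) \<omega>)
    + q * (error (state k \<omega>))\<^sup>2 + 4 * (h k)\<^sup>2 / q + curvature / 2 * (h k)\<^sup>2 \<partial>P)"
    using integrable_residual integrable_merit integrable_error merit_descent_Young[OF _ q]
    by (intro integral_mono) auto
  also have "\<dots> = (\<integral>\<omega>. merit (\<mu> k) (x k \<omega>) \<partial>P) - (\<integral>\<omega>. merit (\<mu> (Suc k)) (x (Suc k) \<omega>) \<partial>P)
      + q * (\<integral>\<omega>. (error (state k \<omega>))\<^sup>2 \<partial>P) + 4 * (h k)\<^sup>2 / q + curvature / 2 * (h k)\<^sup>2"
    using integrable_merit integrable_error by (simp add: P.prob_space)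
  finally show ?thesis .
qed

lemma expected_residual_sum:
  assumes K: "3 \<le> K"
  shows "(\<Sum>k<K. h k * (\<integral>\<omega>. residual k (state k \<omega>) \<partial>P))
    \<le> (potential_gap f B \<phi>\<^sub>l\<^sub>o\<^sub>w x0 + \<sigma>\<^sup>2 + 2 * s\<^sup>2 * curvature / 9
        + 4 * (4 * s\<^sup>2 / (3 * (3 - s)) + variance_constant)) * ln (real K)"
proof -
  let ?\<Phi> = "\<lambda>k. \<integral>\<omega>. merit (\<mu> k) (x k \<omega>) \<partial>P" and ?V = "\<lambda>k. \<integral>\<omega>. (error (state k \<omega>))\<^sup>2 \<partial>P"
  have "(\<Sum>k<K. h k * (\<integral>\<omega>. residual k (state k \<omega>) \<partial>P))
    \<le> (?\<Phi> 0 + ?V 0 + 2 * s\<^sup>2 * curvature / 9 + 4 * (4 * s\<^sup>2 / (3 * (3 - s)) + variance_constant)) * ln (real K)"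
  proof (rule weighted_descent_sum_bound[where \<Phi> = ?\<Phi> and V = ?V, OF s variance_constant_nonneg _ h \<gamma> refl])
    show "0 \<le> curvature" using curvature_pos by simp
    show "0 \<le> ?\<Phi> k" for k by (intro integral_nonneg_AE AE_I2 merit_nonneg x_feasible \<mu>)
    show "0 \<le> ?V k" for k by simp
    show "h k * (\<integral>\<omega>. residual k (state k \<omega>) \<partial>P) \<le> ?\<Phi> k - ?\<Phi> (Suc k)
        + (2 - s) / (3 * cbrt_index k) * ?V k + 4 * (h k)\<^sup>2 / ((2 - s) / (3 * cbrt_index k))
        + curvature / 2 * (h k)\<^sup>2" for k
      using s cbrt_index_pos by (intro expected_merit_descent divide_pos_pos) auto
    show "?V (Suc k) \<le> (1 - \<gamma> k * (1 - s / 3)) * ?V k + variance_constant * (\<gamma> k)\<^sup>2" for k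
      by (rule error_contraction(2)[OF integrable_error])
  qed (rule K)
  also have "\<dots> \<le> (potential_gap f B \<phi>\<^sub>l\<^sub>o\<^sub>w x0 + \<sigma>\<^sup>2 + 2 * s\<^sup>2 * curvature / 9
        + 4 * (4 * s\<^sup>2 / (3 * (3 - s)) + variance_constant)) * ln (real K)"
  proof (intro mult_right_mono add_right_mono add_mono)
    \<comment> \<open>The initial barrier parameter is exactly 1, which is why
      \<open>potential_gap\<close> contains \<open>f + B\<close> with full weight.\<close>
    have "?\<Phi> 0 = (\<integral>\<omega>. merit 1 x0 \<partial>P)"
      by (intro Bochner_Integration.integral_cong) (auto simp: x_0 \<mu>)
    then show "?\<Phi> 0 \<le> potential_gap f B \<phi>\<^sub>l\<^sub>o\<^sub>w x0"
      using merit_1_le_potential_gap[of x0] by (simp add: P.prob_space)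
    show "?V 0 \<le> \<sigma>\<^sup>2" by (rule expectation_error_0)
    show "0 \<le> ln (real K)" using K by simp
  qed
  finally show ?thesis .
qed

lemma potential_gap_nonneg: "0 \<le> potential_gap f B \<phi>\<^sub>l\<^sub>o\<^sub>w x0"
  using merit_nonneg[OF x0, of 1] merit_1_le_potential_gap[of x0] by simp

end

section \<open>The residual at the random output index\<close>

context sipm_rm_process
begin

text \<open>Almost surely the residual at \<open>\<kappa>\<close> is a finite sum of residuals times
  indicators of the values of \<open>\<kappa>\<close>. Residuals depend on the samples only, so
  every product expectation factors and each indicator contributes
  \<open>1 / card I\<close>.\<close>

lemma residual_at_random_index:
  fixes \<kappa> :: "'w \<Rightarrow> nat" and I :: "nat set"
  assumes \<kappa>: "\<kappa> \<in> P \<rightarrow>\<^sub>M count_space UNIV" and I: "finite I" "I \<noteq> {}"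
    and law: "distr P (count_space UNIV) \<kappa> = measure_pmf (pmf_of_set I)"
    and indep: "P.indep_set (sets (vimage_algebra (space P) \<kappa> (count_space UNIV)))
      (sets (vimage_algebra (space P) (\<lambda>\<omega> k. \<xi> k \<omega>) (\<Pi>\<^sub>M k\<in>UNIV. \<Xi>)))"
  shows "AE \<omega> in P. \<kappa> \<omega> \<in> I"
    and "integrable P (\<lambda>\<omega>. residual (\<kappa> \<omega>) (state (\<kappa> \<omega>) \<omega>))"
    and "(\<integral>\<omega>. residual (\<kappa> \<omega>) (state (\<kappa> \<omega>) \<omega>) \<partial>P)
      = (\<Sum>k\<in>I. \<integral>\<omega>. residual k (state k \<omega>) \<partial>P) / real (card I)"
proof -
  let ?V = "vimage_algebra (space P) (\<lambda>\<omega> k. \<xi> k \<omega>) (\<Pi>\<^sub>M k\<in>UNIV. \<Xi>)"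
  have "AE j in distr P (count_space UNIV) \<kappa>. j \<in> I"
    unfolding law using I by (simp add: AE_measure_pmf_iff)
  then show AE: "AE \<omega> in P. \<kappa> \<omega> \<in> I" by (rule AE_distrD[OF \<kappa>])
  define ind where "ind k \<omega> = (if \<kappa> \<omega> = k then 1 else 0 :: real)" for k \<omega>
  have ind_meas: "ind k \<in> borel_measurable P" for k
    unfolding ind_def by (rule measurable_compose[OF \<kappa>]) simp
  have ind_int: "integrable P (ind k)" for k
    by (rule P.integrable_const_bound[where B = 1]) (auto simp: ind_meas, simp add: ind_def)
  have ind_mean: "(\<integral>\<omega>. ind k \<omega> \<partial>P) = 1 / real (card I)" if k: "k \<in> I" for k
  proof -
    have "(\<integral>\<omega>. ind k \<omega> \<partial>P) = (\<integral>j. (if j = k then 1 else 0) \<partial>distr P (count_space UNIV) \<kappa>)"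
      unfolding ind_def by (rule integral_distr[OF \<kappa>, symmetric]) simp
    also have "\<dots> = (\<integral>j. indicator {k} j \<partial>measure_pmf (pmf_of_set I))"
      unfolding law by (intro Bochner_Integration.integral_cong) (auto simp: indicator_def)
    also have "\<dots> = 1 / real (card I)"
      using I k by (simp add: measure_pmf_single)
    finally show ?thesis .
  qed
  have indep_k: "P.indep_var borel (ind k) borel (\<lambda>\<omega>. residual k (state k \<omega>))" for k
  proof (rule P.indep_var_vimage_algebra[OF _ _ indep])
    have "\<kappa> \<in> vimage_algebra (space P) \<kappa> (count_space UNIV) \<rightarrow>\<^sub>M count_space UNIV"
      by (rule measurable_vimage_algebra1) simp
    then show "ind k \<in> vimage_algebra (space P) \<kappa> (count_space UNIV) \<rightarrow>\<^sub>M borel"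
      unfolding ind_def by (rule measurable_compose) simp
    obtain F where F: "F \<in> PiM {..k} (\<lambda>_. \<Xi>) \<rightarrow>\<^sub>M \<S>"
      "\<And>\<omega>. \<omega> \<in> space P \<Longrightarrow> state k \<omega> = F (restrict (\<lambda>i. \<xi> i \<omega>) {..k})"
      using state_representation[of k] by blast
    have "(\<lambda>\<omega> i. \<xi> i \<omega>) \<in> ?V \<rightarrow>\<^sub>M (\<Pi>\<^sub>M i\<in>UNIV. \<Xi>)"
      using measurable_space[OF samples_measurable]
      by (intro measurable_vimage_algebra1) (auto simp: space_PiM)
    then have "(\<lambda>\<omega>. restrict (\<lambda>i. \<xi> i \<omega>) {..k}) \<in> ?V \<rightarrow>\<^sub>M PiM {..k} (\<lambda>_. \<Xi>)"
      by (rule measurable_compose[OF _ measurable_restrict_subset]) simp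
    then have "(\<lambda>\<omega>. residual k (F (restrict (\<lambda>i. \<xi> i \<omega>) {..k}))) \<in> borel_measurable ?V"
      by (rule measurable_compose[OF measurable_compose[OF _ F(1)] measurable_residual])
    then show "(\<lambda>\<omega>. residual k (state k \<omega>)) \<in> borel_measurable ?V"
      by (rule measurable_cong[THEN iffD1, rotated]) (simp add: F(2))
  qed
  note prod_int = P.indep_var_integrable[OF indep_k ind_int integrable_residual]
  have sum_int: "integrable P (\<lambda>\<omega>. \<Sum>k\<in>I. ind k \<omega> * residual k (state k \<omega>))"
    by (intro Bochner_Integration.integrable_sum prod_int)
  have meas: "(\<lambda>\<omega>. residual (\<kappa> \<omega>) (state (\<kappa> \<omega>) \<omega>)) \<in> borel_measurable P"
    by (rule measurable_compose_countable[OF _ \<kappa>]) (rule measurable_of_state[OF measurable_residual])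
  have eq: "AE \<omega> in P. (\<Sum>k\<in>I. ind k \<omega> * residual k (state k \<omega>)) = residual (\<kappa> \<omega>) (state (\<kappa> \<omega>) \<omega>)"
    using AE
  proof eventually_elim
    case (elim \<omega>)
    have "(\<Sum>k\<in>I. ind k \<omega> * residual k (state k \<omega>)) = (\<Sum>k\<in>I. if \<kappa> \<omega> = k then residual k (state k \<omega>) else 0)"
      by (intro sum.cong) (auto simp: ind_def)
    then show ?case using elim I by simp
  qed
  show "integrable P (\<lambda>\<omega>. residual (\<kappa> \<omega>) (state (\<kappa> \<omega>) \<omega>))"
    using integrable_cong_AE[OF borel_measurable_integrable[OF sum_int] meas eq] sum_int by simp
  have "(\<integral>\<omega>. residual (\<kappa> \<omega>) (state (\<kappa> \<omega>) \<omega>) \<partial>P) = (\<integral>\<omega>. (\<Sum>k\<in>I. ind k \<omega> * residual k (state k \<omega>)) \<partial>P)"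
    by (rule integral_cong_AE[OF borel_measurable_integrable[OF sum_int] meas eq, symmetric])
  also have "\<dots> = (\<Sum>k\<in>I. \<integral>\<omega>. ind k \<omega> * residual k (state k \<omega>) \<partial>P)"
    by (rule Bochner_Integration.integral_sum) (rule prod_int)
  also have "\<dots> = (\<Sum>k\<in>I. 1 / real (card I) * (\<integral>\<omega>. residual k (state k \<omega>) \<partial>P))"
    by (intro sum.cong refl) (simp add: P.indep_var_lebesgue_integral[OF indep_k ind_int integrable_residual] ind_mean)
  finally show "(\<integral>\<omega>. residual (\<kappa> \<omega>) (state (\<kappa> \<omega>) \<omega>) \<partial>P)
      = (\<Sum>k\<in>I. \<integral>\<omega>. residual k (state k \<omega>) \<partial>P) / real (card I)"
    by (simp add: sum_divide_distrib)
qed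

end

theorem theorem8:
  fixes \<K> :: "(real^'n) set" and A :: "real^'n^'m" and b :: "real^'m"
    and f B :: "real^'n \<Rightarrow> real"
    and \<theta> \<phi>\<^sub>l\<^sub>o\<^sub>w s\<^sub>\<eta> \<sigma> \<epsilon> L\<^sub>\<phi> M\<^sub>r\<^sub>m :: real
    and L\<^sub>1 L :: "real \<Rightarrow> real"
    and \<Omega> \<Omega>\<^sub>o :: "(real^'n) set"
    and \<Xi> :: "'s measure" and G :: "real^'n \<Rightarrow> 's \<Rightarrow> real^'n"
    and P :: "'w measure" and \<xi> :: "nat \<Rightarrow> 'w \<Rightarrow> 's" and \<kappa> :: "nat \<Rightarrow> 'w \<Rightarrow> nat"
    and \<eta> \<gamma> \<mu> :: "nat \<Rightarrow> real" and x0 :: "real^'n"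
    and x mb m :: "nat \<Rightarrow> 'w \<Rightarrow> real^'n" and lam :: "nat \<Rightarrow> 'w \<Rightarrow> real^'m"
  assumes cone: "proper_cone \<K>"
    and full_row_rank: "rank A = CARD('m)"
    and \<Omega>: "\<Omega> = feasible_set A b \<K>"
    and \<Omega>\<^sub>o: "\<Omega>\<^sub>o = strictly_feasible_set A b \<K>"
    and f_C1: "C1_on_within \<Omega> \<K> f"
    and minimizer: "\<exists>z\<in>\<Omega>. \<forall>y\<in>\<Omega>. f z \<le> f y"
    and barrier: "log_homogeneous_sc_barrier \<K> \<theta> B"
    and s\<^sub>\<eta>: "0 < s\<^sub>\<eta>" "s\<^sub>\<eta> < 1"
    \<comment> \<open>(a)\<close>
    and nonempty: "\<Omega>\<^sub>o \<noteq> {}"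
    and lower_bound: "\<And>z t. z \<in> \<Omega>\<^sub>o \<Longrightarrow> 0 < t \<Longrightarrow> t \<le> 1 \<Longrightarrow> \<phi>\<^sub>l\<^sub>o\<^sub>w \<le> f z + t * B z"
    \<comment> \<open>(b)\<close>
    and L\<^sub>1: "\<And>s. 0 < s \<Longrightarrow> s < 1 \<Longrightarrow> 0 < L\<^sub>1 s \<and>
      (\<forall>z\<in>\<Omega>\<^sub>o. \<forall>y\<in>\<Omega>\<^sub>o. local_norm B z (y - z) \<le> s \<longrightarrow>
         dual_local_norm B z (gradient f y - gradient f z) \<le> L\<^sub>1 s * local_norm B z (y - z))"
    \<comment> \<open>(c)\<close>
    and \<Xi>: "prob_space \<Xi>"
    and G_measurable:
      "(\<lambda>(z, w). G z w) \<in> borel_measurable (restrict_space borel \<Omega>\<^sub>o \<Otimes>\<^sub>M \<Xi>)"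
    and \<sigma>: "0 < \<sigma>"
    and G_unbiased: "\<And>z. z \<in> \<Omega>\<^sub>o \<Longrightarrow>
      integrable \<Xi> (G z) \<and> (\<integral>w. G z w \<partial>\<Xi>) = gradient f z"
    and G_variance: "\<And>z. z \<in> \<Omega>\<^sub>o \<Longrightarrow>
      integrable \<Xi> (\<lambda>w. (dual_local_norm B z (G z w - gradient f z))\<^sup>2) \<and>
      (\<integral>w. (dual_local_norm B z (G z w - gradient f z))\<^sup>2 \<partial>\<Xi>) \<le> \<sigma>\<^sup>2"
    \<comment> \<open>(d)\<close>
    and L: "\<And>s. 0 < s \<Longrightarrow> s < 1 \<Longrightarrow> 0 < L s \<and>
      (\<forall>z\<in>\<Omega>\<^sub>o. \<forall>y\<in>\<Omega>\<^sub>o. local_norm B z (y - z) \<le> s \<longrightarrow>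
         integrable \<Xi> (\<lambda>w. (dual_local_norm B z (G y w - G z w))\<^sup>2) \<and>
         (\<integral>w. (dual_local_norm B z (G y w - G z w))\<^sup>2 \<partial>\<Xi>)
           \<le> (L s)\<^sup>2 * (local_norm B z (y - z))\<^sup>2)"
    \<comment> \<open>randomness: i.i.d. samples with law \<open>\<Xi>\<close>, and an independent uniform output index\<close>
    and P: "prob_space P"
    and \<xi>_indep: "prob_space.indep_vars P (\<lambda>_. \<Xi>) \<xi> UNIV"
    and \<xi>_law: "\<And>k. distr P \<Xi> (\<xi> k) = \<Xi>"
    and \<kappa>_measurable: "\<And>K. K \<ge> 1 \<Longrightarrow> \<kappa> K \<in> P \<rightarrow>\<^sub>M count_space UNIV"
    and \<kappa>_uniform: "\<And>K. K \<ge> 1 \<Longrightarrow>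
      distr P (count_space UNIV) (\<kappa> K) = measure_pmf (pmf_of_set {K div 2..K - 1})"
    and \<kappa>_indep: "\<And>K. K \<ge> 1 \<Longrightarrow> prob_space.indep_set P
      (sets (vimage_algebra (space P) (\<kappa> K) (count_space UNIV)))
      (sets (vimage_algebra (space P) (\<lambda>\<omega> k. \<xi> k \<omega>) (\<Pi>\<^sub>M k\<in>UNIV. \<Xi>)))"
    \<comment> \<open>parameters\<close>
    and \<epsilon>: "0 < \<epsilon>" "\<epsilon> < 1"
    and \<eta>: "\<And>k. \<eta> k = s\<^sub>\<eta> / (3 * (real k + 1) powr (2/3))"
    and \<gamma>: "\<And>k. \<gamma> k = 1 / (real k + 1) powr (2/3)"
    and \<mu>: "\<And>k. \<mu> k = max (1 / (real k + 1) powr (1/3)) (\<epsilon> / (1 + sqrt \<theta>))"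
    \<comment> \<open>the algorithm\<close>
    and x0: "x0 \<in> \<Omega>\<^sub>o"
    and run: "\<And>\<omega>. \<omega> \<in> space P \<Longrightarrow> sipm_rm_run A B G x0 \<eta> \<gamma> \<mu>
      (\<lambda>k. \<xi> k \<omega>) (\<lambda>k. x k \<omega>) (\<lambda>k. mb k \<omega>) (\<lambda>k. m k \<omega>) (\<lambda>k. lam k \<omega>)"
    and well_defined: "AE \<omega> in P. \<forall>k. m k \<omega> + transpose A *v lam k \<omega> \<noteq> 0"
    \<comment> \<open>constants\<close>
    and L\<^sub>\<phi>: "L\<^sub>\<phi> = 2 * L\<^sub>1 s\<^sub>\<eta> + 1 / (1 - s\<^sub>\<eta>)"
    and M\<^sub>r\<^sub>m: "M\<^sub>r\<^sub>m = 6 * ((potential_gap f B \<phi>\<^sub>l\<^sub>o\<^sub>w x0 + \<sigma>\<^sup>2) / s\<^sub>\<eta> + 2 * s\<^sub>\<eta> * L\<^sub>\<phi> / 9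
      + 4 * (4 * s\<^sub>\<eta> / (3 * (3 - s\<^sub>\<eta>))
             + 3 * ((L\<^sub>1 s\<^sub>\<eta>)\<^sup>2 + (L s\<^sub>\<eta>)\<^sup>2) * s\<^sub>\<eta> / (3 - s\<^sub>\<eta>)\<^sup>2
             + 3 * \<sigma>\<^sup>2 / (s\<^sub>\<eta> * (1 - s\<^sub>\<eta> / 3)\<^sup>2)))"
  shows "\<forall>K::nat.
    real K \<ge> Max {2 * ((1 + sqrt \<theta>) / \<epsilon>) ^ 3,
                  (6 * M\<^sub>r\<^sub>m * (1 + sqrt \<theta>) / \<epsilon> * ln (6 * M\<^sub>r\<^sub>m * (1 + sqrt \<theta>) / \<epsilon>)) ^ 3,
                  3} \<longrightarrow>
    (let r = (\<lambda>\<omega>. dual_local_norm B (x (\<kappa> K \<omega>) \<omega>)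
                (gradient (barrier_fun f B (\<mu> (\<kappa> K \<omega>))) (x (\<kappa> K \<omega>) \<omega>)
                 + transpose A *v lam (\<kappa> K \<omega>) \<omega>))
     in integrable P r \<and>
        (AE \<omega> in P. (\<integral>\<omega>'. r \<omega>' \<partial>P) \<le> \<mu> (\<kappa> K \<omega>) \<and> \<mu> (\<kappa> K \<omega>) \<le> \<epsilon> / (1 + sqrt \<theta>)))"
  proof -
  let ?s = s\<^sub>\<eta>
  have \<theta>: "1 \<le> \<theta>" using barrier by (simp add: log_homogeneous_sc_barrier_def)
  \<comment> \<open>The floor of the barrier parameters is \<open>1 / c\<close>;
    \<open>c > 1\<close> ensures that they start at 1 and stay in \<open>(0, 1]\<close>.\<close>
  define c where "c = (1 + sqrt \<theta>) / \<epsilon>"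
  have c: "1 < c"
  proof -
    have "0 \<le> sqrt \<theta>" using \<theta> by simp
    then have "\<epsilon> < 1 + sqrt \<theta>" using \<epsilon> by linarith
    then show ?thesis using \<epsilon> unfolding c_def by (simp add: less_divide_eq)
  qed
  have c_inv: "\<epsilon> / (1 + sqrt \<theta>) = 1 / c" by (simp add: c_def)
  have \<mu>_eq: "\<mu> k = max (1 / cbrt_index k) (1 / c)" for k
    by (simp add: \<mu> cbrt_index_def c_inv)
  interpret P: prob_space P by (rule P)
  interpret R: sipm_rm_process \<K> \<theta> B A b f \<phi>\<^sub>l\<^sub>o\<^sub>w ?s "L\<^sub>1 ?s" \<Omega>\<^sub>o \<Xi> G \<sigma> "L ?s" P \<xi> \<eta> \<gamma> \<mu> x0 x mb
  proof (intro sipm_rm_process.intro stochastic_sipm.intro sipm.intro sc_barrier_cone.intro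
      sipm_axioms.intro stochastic_sipm_axioms.intro sipm_rm_process_axioms.intro)
    fix \<omega> k assume \<omega>: "\<omega> \<in> space P"
    note r = run[OF \<omega>, unfolded sipm_rm_run_def Let_def]
    show "x 0 \<omega> = x0" using r by blast
    show "mb 0 \<omega> = G x0 (\<xi> 0 \<omega>)" using r by (auto dest: spec[of _ 0])
    have rk: "m k \<omega> = mb k \<omega> + \<mu> k *\<^sub>R (mb k \<omega> + gradient B (x k \<omega>))"
      "lam k \<omega> = lagrange_multiplier A B (x k \<omega>) (m k \<omega>)"
      "x (Suc k) \<omega> = normalized_step A B (\<eta> k) (x k \<omega>) (m k \<omega>)"
      using r unfolding lagrange_multiplier_def normalized_step_def projected_vector_def by auto
    then show "x (Suc k) \<omega> = normalized_step A B (\<eta> k) (x k \<omega>) (mb k \<omega> + \<mu> k *\<^sub>R (mb k \<omega> + gradient B (x k \<omega>)))"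
      by simp
    show "mb (Suc k) \<omega> = G (x (Suc k) \<omega>) (\<xi> (Suc k) \<omega>) + (1 - \<gamma> k) *\<^sub>R (mb k \<omega> - G (x k \<omega>) (\<xi> (Suc k) \<omega>))"
      using r by (auto dest: spec[of _ "Suc k"])
  next
    show "\<eta> k = ?s / (3 * (cbrt_index k)\<^sup>2)" "\<gamma> k = 1 / (cbrt_index k)\<^sup>2" for k
      unfolding \<eta> \<gamma> cbrt_index_square by simp_all
    show "0 < \<mu> k" "\<mu> k \<le> 1" for k
      unfolding \<mu>_eq using c cbrt_index_pos[of k] cbrt_index_ge_1[of k] by (auto simp: less_max_iff_disj)
    show "\<mu> (Suc k) \<le> \<mu> k" for k
      unfolding \<mu>_eq using c cbrt_index_pos[of k] cbrt_index_pos[of "Suc k"] cbrt_index_mono[of k "Suc k"]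
      by (intro max.mono divide_left_mono) auto
    show "\<mu> 0 = 1" unfolding \<mu>_eq using c by (simp add: cbrt_index_def)
  qed (use cone barrier full_row_rank \<Omega>\<^sub>o f_C1 \<Omega> s\<^sub>\<eta> lower_bound L\<^sub>1 L \<Xi> G_measurable G_unbiased G_variance
      \<xi>_indep \<xi>_law x0 P in \<open>auto\<close>)
  have gap: "0 \<le> potential_gap f B \<phi>\<^sub>l\<^sub>o\<^sub>w x0" by (rule R.potential_gap_nonneg)
  have M_eq: "?s * M\<^sub>r\<^sub>m / 6 = potential_gap f B \<phi>\<^sub>l\<^sub>o\<^sub>w x0 + \<sigma>\<^sup>2 + 2 * ?s\<^sup>2 * R.curvature / 9
        + 4 * (4 * ?s\<^sup>2 / (3 * (3 - ?s)) + R.variance_constant)"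
  proof -
    \<comment> \<open>With the constants abstracted to letters, the identity is polynomial in them
      and their inverses once the two summands that need \<open>t / t = 1\<close> are set
      apart.\<close>
    have *: "t * (6 * (g / t + 2 * t * l / 9 + 4 * (4 * t / p + 3 * e * t / q + 3 * v / (t * r)))) / 6
        = g + 2 * t\<^sup>2 * l / 9 + 4 * (4 * t\<^sup>2 / p + (3 * e * t\<^sup>2 / q + 3 * v / r))"
      if "0 < t" for t g l p e q v r :: real
    proof -
      have "t * (g / t) = g" "t * (3 * v / (t * r)) = 3 * v / r" using that by simp_all
      moreover have "t * (6 * (g / t + 2 * t * l / 9 + 4 * (4 * t / p + 3 * e * t / q + 3 * v / (t * r)))) / 6
        = t * (g / t) + 2 * t\<^sup>2 * l / 9 + 4 * (4 * t\<^sup>2 / p + (3 * e * t\<^sup>2 / q + t * (3 * v / (t * r))))"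
        by (simp only: power2_eq_square divide_inverse) algebra
      ultimately show ?thesis by simp
    qed
    have "R.curvature = L\<^sub>\<phi>" by (simp add: L\<^sub>\<phi> R.curvature_def)
    then show ?thesis
      unfolding M\<^sub>r\<^sub>m R.variance_constant_def by (simp only: *[OF s\<^sub>\<eta>(1)])
  qed
  \<comment> \<open>Strict positivity comes from the variance term; the threshold estimate divides
    by, and takes the logarithm of, a multiple of this constant.\<close>
  have "0 < ?s * M\<^sub>r\<^sub>m / 6"
    unfolding M_eq
  proof (rule add_pos_nonneg[OF add_pos_nonneg[OF add_nonneg_pos[OF gap]]])
    show "0 < \<sigma>\<^sup>2" using \<sigma> by simp
  qed (use s\<^sub>\<eta> R.curvature_pos R.variance_constant_nonneg in auto)
  then have M_pos: "0 < M\<^sub>r\<^sub>m" using s\<^sub>\<eta> by (simp add: zero_less_mult_iff)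
  show ?thesis
  proof (intro allI impI)
    fix K :: nat
    assume "real K \<ge> Max {2 * ((1 + sqrt \<theta>) / \<epsilon>) ^ 3,
                  (6 * M\<^sub>r\<^sub>m * (1 + sqrt \<theta>) / \<epsilon> * ln (6 * M\<^sub>r\<^sub>m * (1 + sqrt \<theta>) / \<epsilon>)) ^ 3, 3}"
    then have K: "2 * c ^ 3 \<le> real K" "(6 * M\<^sub>r\<^sub>m * c * ln (6 * M\<^sub>r\<^sub>m * c)) ^ 3 \<le> real K" "3 \<le> K"
      by (auto simp: c_def)
    let ?I = "{K div 2..K - 1}"
    define r where "r = (\<lambda>\<omega>. dual_local_norm B (x (\<kappa> K \<omega>) \<omega>)
                (gradient (barrier_fun f B (\<mu> (\<kappa> K \<omega>))) (x (\<kappa> K \<omega>) \<omega>)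
                 + transpose A *v lam (\<kappa> K \<omega>) \<omega>))"
    have r_eq: "r \<omega> = R.residual (\<kappa> K \<omega>) (R.state (\<kappa> K \<omega>) \<omega>)" if \<omega>: "\<omega> \<in> space P" for \<omega>
    proof -
      note r = run[OF \<omega>, unfolded sipm_rm_run_def Let_def]
      have "lam k \<omega> = lagrange_multiplier A B (x k \<omega>) (mb k \<omega> + \<mu> k *\<^sub>R (mb k \<omega> + gradient B (x k \<omega>)))" for k
        using r unfolding lagrange_multiplier_def by metis
      then show ?thesis by (simp add: r_def R.residual_def R.state_def R.search_def)
    qed
    have K1: "1 \<le> K" and I: "finite ?I" "?I \<noteq> {}" using K(3) by auto
    note idx = R.residual_at_random_index[OF \<kappa>_measurable[OF K1] I \<kappa>_uniform[OF K1] \<kappa>_indep[OF K1]]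
    have int: "integrable P r"
      using idx(2) by (rule Bochner_Integration.integrable_cong[THEN iffD1, OF refl, rotated]) (simp add: r_eq)
    have "(\<integral>\<omega>. r \<omega> \<partial>P) = (\<integral>\<omega>. R.residual (\<kappa> K \<omega>) (R.state (\<kappa> K \<omega>) \<omega>) \<partial>P)"
      by (intro Bochner_Integration.integral_cong) (auto simp: r_eq)
    also have "\<dots> \<le> M\<^sub>r\<^sub>m * ln (real K) / real K powr (1/3)"
      unfolding idx(3)
      using R.expected_residual_sum[OF K(3)] R.expected_residual_nonneg s\<^sub>\<eta> R.h K1
      by (intro tail_average_bound[where h = \<eta> and s = ?s]) (simp_all only: M_eq)
    also have "\<dots> \<le> 1 / c"
      using c M_pos K K1 by (intro iteration_threshold) auto
    finally have bound: "(\<integral>\<omega>. r \<omega> \<partial>P) \<le> 1 / c" .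
    have "AE \<omega> in P. (\<integral>\<omega>'. r \<omega>' \<partial>P) \<le> \<mu> (\<kappa> K \<omega>) \<and> \<mu> (\<kappa> K \<omega>) \<le> \<epsilon> / (1 + sqrt \<theta>)"
      using idx(1)
    proof eventually_elim
      case (elim \<omega>)
      let ?k = "\<kappa> K \<omega>"
      \<comment> \<open>The index shift absorbs the rounding in \<open>K div 2\<close>. With
        \<open>K \<ge> 2 c^3\<close> it gives \<open>?k + 1 \<ge> c^3\<close>, so on the whole
        window the barrier parameter has reached its floor \<open>1 / c\<close>.\<close>
      have "real K \<le> 2 * (real ?k + 1)" using elim by auto
      from order_trans[OF K(1) this] have "c ^ 3 \<le> cbrt_index ?k ^ 3" unfolding cbrt_index_cube by simp
      then have "c \<le> cbrt_index ?k"
        using power_mono_iff[of c "cbrt_index ?k" 3] c cbrt_index_pos[of ?k] by simp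
      then have "1 / cbrt_index ?k \<le> 1 / c" using c by (intro divide_left_mono) auto
      then show ?case unfolding c_inv \<mu>_eq using bound by simp
    qed
    with int show "let r = (\<lambda>\<omega>. dual_local_norm B (x (\<kappa> K \<omega>) \<omega>)
                (gradient (barrier_fun f B (\<mu> (\<kappa> K \<omega>))) (x (\<kappa> K \<omega>) \<omega>)
                 + transpose A *v lam (\<kappa> K \<omega>) \<omega>))
     in integrable P r \<and>
        (AE \<omega> in P. (\<integral>\<omega>'. r \<omega>' \<partial>P) \<le> \<mu> (\<kappa> K \<omega>) \<and> \<mu> (\<kappa> K \<omega>) \<le> \<epsilon> / (1 + sqrt \<theta>))"
      unfolding Let_def r_def by blast
  qed
qed

end
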